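(* In the two-user Poisson channel with parameters $a_y,a_z,\lambda_y,\lambda_z\ge0$ described in the context, the following conditions are equivalent: (I) $\Phi(x)=\phi_y(x)-\phi_z(x)$ is a convex function over $[0,1]$. (II) Receiver 1 is less noisy than receiver 2. (III) Receiver 1 is more capable than receiver 2. (IV) The channel parameters satisfy either - $a_y\ge a_z$ and $a_y^2\lambda_z\ge a_z^2\lambda_y$; or - $0<a_y<a_z$ and $a_y^2(a_z+\lambda_z)\ge a_z^2(a_y+\lambda_y)$.
   Context: Conventions: $\log$ is natural, $0\log 0=0$, $\exp(\log 0)=0$; $\int_a^b$ in Lebesgue-Stieltjes integrals means $\int_{(a,b]}$. Channel model. Fix $0<T<\infty$ and parameters $a_y,a_z,\lambda_y,\lambda_z\ge0$. $\mathcal X_0^T$ is the set of càdlàg functions $[0,T]\to[0,1]$ (the channel inputs), and $\mathcal N_0^T$ is the set of right-continuous functions $[0,T]\to\{0,1,2,\dots\}$ with unit jumps starting at $0$; both carry the $\sigma$-fields generated by the open sets of the Skorohod topology ($\mathfrak F^X$ for $\mathcal X_0^T$). $P_0^{Y_0^T}$ and $P_0^{Z_0^T}$ are the laws on $\mathcal N_0^T$ of a unit-rate Poisson process. For $u\in\{y,z\}$, $$p_u(x_0^T,u_0^T)=\exp\Bigl(\int_0^T\log(a_ux_t+\lambda_u)\,du_t+\int_0^T[1-(a_ux_t+\lambda_u)]\,dt\Bigr).$$ Given a measurable space $(\mathcal M,\mathfrak F^M)$, a probability measure $\nu$ on it and a transition probability $\mu_m(dx_0^T)$ from it to $(\mathcal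 X_0^T,\mathfrak F^X)$, let, on $\Omega=\mathcal M\times\mathcal X_0^T\times\mathcal N_0^T\times\mathcal N_0^T$ with the product $\sigma$-field, $$P=\nu(dm)\,\mu_m(dx_0^T)\,p_y(x_0^T,y_0^T)\,P_0^{Y_0^T}(dy_0^T)\,p_z(x_0^T,z_0^T)\,P_0^{Z_0^T}(dz_0^T),$$ with coordinate maps $M,X_0^T,Y_0^T,Z_0^T$. Thus $M\rightleftarrows X_0^T\rightleftarrows(Y_0^T,Z_0^T)$ is a Markov chain, and given $X_0^T$ the outputs $Y_0^T$ (receiver 1) and $Z_0^T$ (receiver 2) are independent Poisson processes with rates $a_yX_t+\lambda_y$ and $a_zX_t+\lambda_z$. For $u\in\{y,z\}$, $\phi_u(x)=(a_ux+\lambda_u)\log(a_ux+\lambda_u)$, $x\in[0,1]$. $I(\cdot\,;\cdot)$ is mutual information for general random objects: $I(A;C)=\sup\sum_{i,j}P(\mathtt A_i,\mathtt C_j)\log\frac{P(\mathtt A_i,\mathtt C_j)}{P(\mathtt A_i)P(\mathtt C_j)}$ over finite partitions $\{\mathtt A_i\}\subseteq\sigma(A)$, $\{\mathtt C_j\}\subseteq\sigma(C)$ of $\Omega$. Receiver 1 is less noisy than receiver 2 if $I(M;Y_0^T)\ge I(M;Z_0^T)$ for every choice of measurable space $(\mathcal M,\mathfrak F^M)$, probability measure $\nu$ on it and transition probability $\mu_m(dx_0^T)$ from it to $(\mathcal X_0^T,\mathfrak F^X)$, where $(M,X_0^T,Y_0^T,Z_0^T)$ has joint law $P=\nu(dm)\,\mu_m(dx_0^T)\,p_y(x_0^T,y_0^T)\,P_0^{Y_0^T}(dy_0^T)\,p_z(x_0^T,z_0^T)\,P_0^{Z_0^T}(dz_0^T)$.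 Receiver 1 is more capable than receiver 2 if $I(X_0^T;Y_0^T)\ge I(X_0^T;Z_0^T)$ for all probability measures (laws of $X_0^T$) on the input space $(\mathcal X_0^T,\mathfrak F^X)$. *)

theory Defs
  imports "HOL-Probability.Probability"
begin

section \<open>Path spaces on \<open>[0,T]\<close>\<close>

text \<open>Paths are extensional functions, so that a path is determined by its values on \<open>[0,T]\<close>.
  Counting paths take their values in the natural numbers as a subset of the reals.\<close>

definition cadlag_on :: "real \<Rightarrow> (real \<Rightarrow> real) \<Rightarrow> bool" where
  "cadlag_on T x \<longleftrightarrow>
     (\<forall>t\<in>{0..<T}. (x \<longlongrightarrow> x t) (at_right t)) \<and>
     (\<forall>t\<in>{0<..T}. \<exists>l. (x \<longlongrightarrow> l) (at_left t))"

definition input_paths :: "real \<Rightarrow> (real \<Rightarrow> real) set" where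
  "input_paths T = {x \<in> {0..T} \<rightarrow>\<^sub>E {0..1}. cadlag_on T x}"

definition count_paths :: "real \<Rightarrow> (real \<Rightarrow> real) set" where
  "count_paths T = {u \<in> {0..T} \<rightarrow>\<^sub>E \<nat>. cadlag_on T u \<and> u 0 = 0 \<and>
     (\<forall>t\<in>{0<..T}. \<forall>l. (u \<longlongrightarrow> l) (at_left t) \<longrightarrow> u t = l \<or> u t = l + 1)}"

definition time_changes :: "real \<Rightarrow> (real \<Rightarrow> real) set" where
  "time_changes T = {\<tau>. strict_mono_on {0..T} \<tau> \<and> continuous_on {0..T} \<tau> \<and> \<tau> ` {0..T} = {0..T}}"

text \<open>
  The Skorohod \<open>J\<^sub>1\<close> topology, relative to a set \<open>D\<close> of paths: the basic neighbourhoods of \<open>x\<close>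
  consist of the paths that are uniformly \<open>e\<close>-close to \<open>x\<close> after a time change which is uniformly
  \<open>e\<close>-close to the identity.
\<close>

definition skorohod_open :: "real \<Rightarrow> (real \<Rightarrow> real) set \<Rightarrow> (real \<Rightarrow> real) set \<Rightarrow> bool" where
  "skorohod_open T D U \<longleftrightarrow> U \<subseteq> D \<and>
     (\<forall>x\<in>U. \<exists>e>0. \<forall>y\<in>D.
        (\<exists>\<tau>\<in>time_changes T. \<forall>t\<in>{0..T}. \<bar>\<tau> t - t\<bar> < e \<and> dist (x t) (y (\<tau> t)) < e) \<longrightarrow> y \<in> U)"

definition skorohod_borel :: "real \<Rightarrow> (real \<Rightarrow> real) set \<Rightarrow> (real \<Rightarrow> real) measure" where
  "skorohod_borel T D = sigma D {U. skorohod_open T D U}"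

abbreviation input_space :: "real \<Rightarrow> (real \<Rightarrow> real) measure" where
  "input_space T \<equiv> skorohod_borel T (input_paths T)"

abbreviation output_space :: "real \<Rightarrow> (real \<Rightarrow> real) measure" where
  "output_space T \<equiv> skorohod_borel T (count_paths T)"

definition unit_poisson_law :: "real \<Rightarrow> (real \<Rightarrow> real) measure \<Rightarrow> bool" where
  "unit_poisson_law T Q \<longleftrightarrow> prob_space Q \<and>
     space Q = space (output_space T) \<and> sets Q = sets (output_space T) \<and>
     (\<forall>s t. 0 \<le> s \<and> s < t \<and> t \<le> T \<longrightarrow>
        distr Q borel (\<lambda>u. u t - u s) = distr (measure_pmf (poisson_pmf (t - s))) borel real) \<and>
     (\<forall>(n::nat) (t::nat \<Rightarrow> real).
        0 \<le> t 0 \<and> (\<forall>i<n. t i \<le> t (Suc i)) \<and> t n \<le> T \<longrightarrow>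
        prob_space.indep_vars Q (\<lambda>_. borel) (\<lambda>i u. u (t (Suc i)) - u (t i)) {..<n})"

section \<open>The likelihood ratio\<close>

text \<open>Logarithm and exponential with \<open>log 0 = -\<infinity>\<close> and \<open>exp (log 0) = 0\<close> (whereas \<open>ln 0 = 0\<close>).\<close>

definition ext_log :: "real \<Rightarrow> ereal" where
  "ext_log r = (if r = 0 then - \<infinity> else ereal (ln r))"

definition ext_exp :: "ereal \<Rightarrow> ennreal" where
  "ext_exp r = (case r of ereal s \<Rightarrow> ennreal (exp s) | PInfty \<Rightarrow> \<infinity> | MInfty \<Rightarrow> 0)"

text \<open>
  Integral of an extended real-valued function, as the difference of the integrals of its positive
  and negative parts (\<^const>\<open>e2ennreal\<close> maps negative numbers to \<open>0\<close>). It is only used for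
  functions with positive part of finite integral.
\<close>

definition ext_integral :: "'a measure \<Rightarrow> ('a \<Rightarrow> ereal) \<Rightarrow> ereal" where
  "ext_integral M f =
     enn2ereal (\<integral>\<^sup>+ t. e2ennreal (f t) \<partial>M) - enn2ereal (\<integral>\<^sup>+ t. e2ennreal (- f t) \<partial>M)"

text \<open>
  Lebesgue-Stieltjes integral over \<open>(0,T]\<close> with respect to a counting path, which is extended to
  the real line as a constant on either side of \<open>[0,T]\<close>.
\<close>

definition stieltjes :: "real \<Rightarrow> (real \<Rightarrow> real) \<Rightarrow> (real \<Rightarrow> ereal) \<Rightarrow> ereal" where
  "stieltjes T u f =
     ext_integral (restrict_space (interval_measure (\<lambda>t. u (max 0 (min t T)))) {0<..T}) f"

definition likelihood ::
    "real \<Rightarrow> real \<Rightarrow> real \<Rightarrow> (real \<Rightarrow> real) \<Rightarrow> (real \<Rightarrow> real) \<Rightarrow> ennreal" where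
  "likelihood T a l x u = ext_exp
     (stieltjes T u (\<lambda>t. ext_log (a * x t + l))
      + ereal (set_lebesgue_integral lborel {0<..T} (\<lambda>t. 1 - (a * x t + l))))"

section \<open>The channel\<close>

text \<open>
  \<open>\<rho>(dx) p\<^sub>y(x,y) Q\<^sub>y(dy) p\<^sub>z(x,z) Q\<^sub>z(dz)\<close>, the joint law of the input and the two outputs when
  the input has law \<open>\<rho>\<close>; \<open>Qy\<close> and \<open>Qz\<close> stand for the reference Poisson laws.
\<close>

definition channel_law :: "real \<Rightarrow> real \<Rightarrow> real \<Rightarrow> real \<Rightarrow> real \<Rightarrow>
    (real \<Rightarrow> real) measure \<Rightarrow> (real \<Rightarrow> real) measure \<Rightarrow> (real \<Rightarrow> real) measure \<Rightarrow>
    ((real \<Rightarrow> real) \<times> (real \<Rightarrow> real) \<times> (real \<Rightarrow> real)) measure" where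
  "channel_law T ay ly az lz Qy Qz \<rho> =
     density (\<rho> \<Otimes>\<^sub>M (Qy \<Otimes>\<^sub>M Qz))
       (\<lambda>(x, y, z). likelihood T ay ly x y * likelihood T az lz x z)"

definition joint_law :: "real \<Rightarrow> real \<Rightarrow> real \<Rightarrow> real \<Rightarrow> real \<Rightarrow>
    (real \<Rightarrow> real) measure \<Rightarrow> (real \<Rightarrow> real) measure \<Rightarrow>
    'm measure \<Rightarrow> ('m \<Rightarrow> (real \<Rightarrow> real) measure) \<Rightarrow>
    ('m \<times> (real \<Rightarrow> real) \<times> (real \<Rightarrow> real) \<times> (real \<Rightarrow> real)) measure" where
  "joint_law T ay ly az lz Qy Qz \<nu> \<mu> =
     \<nu> \<bind> (\<lambda>m. distr (channel_law T ay ly az lz Qy Qz (\<mu> m))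
       (\<nu> \<Otimes>\<^sub>M (input_space T \<Otimes>\<^sub>M (output_space T \<Otimes>\<^sub>M output_space T)))
       (\<lambda>(x, y, z). (m, x, y, z)))"

section \<open>Mutual information and the comparison of receivers\<close>

definition finite_partitions :: "'w measure \<Rightarrow> 's measure \<Rightarrow> ('w \<Rightarrow> 's) \<Rightarrow> 'w set set set" where
  "finite_partitions P S A =
     {\<A>. finite \<A> \<and> \<A> \<subseteq> sets (vimage_algebra (space P) A S) \<and> partition_on (space P) \<A>}"

text \<open>\<open>I(A;C)\<close> for random objects \<open>A\<close>, \<open>C\<close> on \<open>P\<close> with values in \<open>S\<close>, \<open>R\<close>, in nats.
  The library's mutual information is real-valued and defined through a divergence rather than through partitions.\<close>

definition mutual_info ::
    "'w measure \<Rightarrow> 's measure \<Rightarrow> ('w \<Rightarrow> 's) \<Rightarrow> 'r measure \<Rightarrow> ('w \<Rightarrow> 'r) \<Rightarrow> ereal" where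
  "mutual_info P S A R C =
     (SUP (\<A>, \<C>) \<in> finite_partitions P S A \<times> finite_partitions P R C.
        ereal (\<Sum>a\<in>\<A>. \<Sum>c\<in>\<C>.
          measure P (a \<inter> c) * ln (measure P (a \<inter> c) / (measure P a * measure P c))))"

text \<open>
  A definition cannot quantify over types, so the type carrying the message spaces is a parameter;
  \<open>\<nu>\<close> ranges over all probability measures on all measurable spaces carried by subsets of it.
  A claim about all message spaces is one about \<open>TYPE('m + (real \<Rightarrow> real))\<close> for every type \<open>'m\<close>: this
  accommodates each carrier \<open>'m\<close> and is never too small to contain the path space.
\<close>

definition less_noisy :: "'m itself \<Rightarrow> real \<Rightarrow> real \<Rightarrow> real \<Rightarrow> real \<Rightarrow> real \<Rightarrow>
    (real \<Rightarrow> real) measure \<Rightarrow> (real \<Rightarrow> real) measure \<Rightarrow> bool" where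
  "less_noisy _ T ay ly az lz Qy Qz \<longleftrightarrow>
     (\<forall>(\<nu> :: 'm measure) \<mu>. prob_space \<nu> \<longrightarrow> \<mu> \<in> \<nu> \<rightarrow>\<^sub>M prob_algebra (input_space T) \<longrightarrow>
        (let P = joint_law T ay ly az lz Qy Qz \<nu> \<mu> in
         mutual_info P \<nu> (\<lambda>(m, x, y, z). m) (output_space T) (\<lambda>(m, x, y, z). y)
         \<ge> mutual_info P \<nu> (\<lambda>(m, x, y, z). m) (output_space T) (\<lambda>(m, x, y, z). z)))"

definition more_capable :: "real \<Rightarrow> real \<Rightarrow> real \<Rightarrow> real \<Rightarrow> real \<Rightarrow>
    (real \<Rightarrow> real) measure \<Rightarrow> (real \<Rightarrow> real) measure \<Rightarrow> bool" where
  "more_capable T ay ly az lz Qy Qz \<longleftrightarrow>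
     (\<forall>\<rho> \<in> space (prob_algebra (input_space T)).
        (let P = channel_law T ay ly az lz Qy Qz \<rho> in
         mutual_info P (input_space T) (\<lambda>(x, y, z). x) (output_space T) (\<lambda>(x, y, z). y)
         \<ge> mutual_info P (input_space T) (\<lambda>(x, y, z). x) (output_space T) (\<lambda>(x, y, z). z)))"

definition phi :: "real \<Rightarrow> real \<Rightarrow> real \<Rightarrow> real" where
  "phi a l x = (a * x + l) * ln (a * x + l)"

end

theory Submission
  imports Defs
begin

text \<open>
  Sampling the input on a grid of mesh \<open>T/n\<close> turns a Poisson output into \<open>n\<close> binary slots in which
  the conditional probability of a count, \<open>(T/n) (a x + l)\<close>, is affine in the input. Given the other
  outputs, the information that one slot carries about a finite-valued label is therefore \<open>T/n\<close> times
  the Jensen gap of \<open>\<phi>\<close> at the posterior means of the input, up to \<open>O(n\<^sup>-\<^sup>2)\<close>. Switching the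
  slots one at a time from receiver 2 to receiver 1 changes the information by Jensen gaps of \<open>\<Phi>\<close>,
  so for convex \<open>\<Phi>\<close> receiver 1 loses at most \<open>O(1/n)\<close>. The slot densities converge pointwise to
  the likelihood and are dominated by \<open>e\<^sup>T K\<^bsup>u(T)\<^esup>\<close>, which gives the comparison in the limit.

  If \<open>\<Phi>\<close> is not convex, it violates Jensen's inequality for some law on two interior points. Let the
  input equal one of these points on \<open>[0,\<delta>)\<close> and vanish afterwards. Then \<open>I(X;Y)\<close> is at most \<open>\<delta>\<close>
  times the Jensen gap of \<open>\<phi>\<^sub>y\<close>, whereas the absence of counts before \<open>\<delta>\<close> alone gives
  information \<open>\<delta>\<close> times the Jensen gap of \<open>\<phi>\<^sub>z\<close>, up to \<open>o(\<delta>)\<close>, about \<open>X\<close> at receiver 2.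
\<close>

section \<open>Finite labels and binary slots\<close>

text \<open>Since mutual information is a supremum over finite partitions, the message or the input
  enters only through a finite label \<open>i\<close> and a finite measure \<open>\<rho> i\<close>,
  the law of the input on the event that the label is \<open>i\<close>. In this form (II) and (III)
  are the same inequality between the two marginal channels; they differ only in where the family
  \<open>\<rho>\<close> comes from.

  The input may have arbitrary memory. Slots can nevertheless be exchanged singly because they are
  independent given the whole input path: once the outcome of the other slots is fixed, an affine
  success probability sees the input, for each label, only through its conditional mean. The entropy
  of one slot contains a term of order \<open>(T/n) ln (T/n)\<close>, too large to be summed over
  \<open>n\<close> slots; it multiplies an affine function of the input, and Jensen gaps annihilate
  affine functions.

  For the converse the information is compared to first order in \<open>\<delta>\<close>, where
  observing one slot of length \<open>\<delta>\<close> is as good as observing the path. After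
  \<open>\<delta>\<close> the two inputs agree, so that nothing more is learnt about the
  label.\<close>

text \<open>
  Minus the entropy of the label given the output, for the joint weights \<open>v i\<close> of label \<open>i\<close> and one
  output. It is homogeneous of degree 1, hence also makes sense for densities.
\<close>

definition hent :: "'i set \<Rightarrow> ('i \<Rightarrow> real) \<Rightarrow> real" where
  "hent I v = (\<Sum>i\<in>I. v i * ln (v i / sum v I))"

lemma hent_cong: "(\<And>i. i \<in> I \<Longrightarrow> v i = w i) \<Longrightarrow> hent I v = hent I w"
  unfolding hent_def by (metis (no_types, lifting) sum.cong)

lemma hent_scale:
  assumes "0 \<le> c"
  shows "hent I (\<lambda>i. c * v i) = c * hent I v"
proof (cases "c = 0")
  case False
  then show ?thesis
    by (simp add: hent_def sum_distrib_left[symmetric] mult.assoc)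
qed (simp add: hent_def)

text \<open>The posterior weight \<open>v i * r i / (V * R)\<close> factors into a prior weight and
  a likelihood ratio, so its logarithm splits. The point of the form on the right: for the
  complementary factors \<open>r\<close> and \<open>1 - r\<close> the first sums add up to
  \<open>hent I v\<close>, which isolates the \<open>t ln t\<close> terms.\<close>

lemma hent_weighted:
  assumes I: "finite I" and v: "\<And>i. i \<in> I \<Longrightarrow> 0 \<le> v i" and r: "\<And>i. i \<in> I \<Longrightarrow> 0 \<le> r i"
  defines "V \<equiv> sum v I"
  defines "R \<equiv> (\<Sum>i\<in>I. v i * r i) / V"
  shows "hent I (\<lambda>i. v i * r i) =
    (\<Sum>i\<in>I. v i * r i * ln (v i / V)) + (\<Sum>i\<in>I. v i * (r i * ln (r i))) - V * (R * ln R)"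
proof (cases "V = 0")
  case True
  then have "\<And>i. i \<in> I \<Longrightarrow> v i = 0"
    using v I by (simp add: V_def sum_nonneg_eq_0_iff)
  then show ?thesis using True by (simp add: hent_def)
next
  case False
  then have V: "V > 0" using v by (simp add: V_def order_less_le sum_nonneg)
  have VR: "V * R = (\<Sum>i\<in>I. v i * r i)" using V by (simp add: R_def)
  have *: "v i * r i * ln (v i * r i / (V * R)) =
      v i * r i * ln (v i / V) + v i * (r i * ln (r i)) - v i * r i * ln R" if i: "i \<in> I" for i
  proof (cases "v i * r i = 0")
    case True
    then show ?thesis by auto
  next
    case nz: False
    then have pos: "v i > 0" "r i > 0" using v[OF i] r[OF i] by auto
    have "v i * r i \<le> V * R"
      unfolding VR using i I v r by (intro member_le_sum) auto
    then have "V * R > 0" using pos mult_pos_pos[OF pos] by linarith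
    then have "R > 0" using V by (simp add: zero_less_mult_iff)
    have "ln (v i * r i / (V * R)) = ln (v i / V) + ln (r i) - ln R"
      using pos V \<open>R > 0\<close> by (simp add: ln_div ln_mult)
    then show ?thesis unfolding \<open>ln (v i * r i / (V * R)) = _\<close> by (simp add: algebra_simps)
  qed
  have "hent I (\<lambda>i. v i * r i) = (\<Sum>i\<in>I. v i * r i * ln (v i * r i / (V * R)))"
    by (simp add: hent_def VR)
  also have "\<dots> = (\<Sum>i\<in>I. v i * r i * ln (v i / V) + v i * (r i * ln (r i)) - v i * r i * ln R)"
    using * by (intro sum.cong) auto
  also have "\<dots> = (\<Sum>i\<in>I. v i * r i * ln (v i / V)) + (\<Sum>i\<in>I. v i * (r i * ln (r i)))
      - (\<Sum>i\<in>I. v i * r i) * ln R"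
    by (simp add: sum.distrib sum_subtractf sum_distrib_right)
  finally show ?thesis by (simp add: VR[symmetric])
qed

section \<open>Jensen gaps and the information in a single slot\<close>

text \<open>The defect in Jensen's inequality for \<open>f\<close> under the normalised weights,
  multiplied by the total weight. This makes it homogeneous of degree 1 in \<open>v\<close>, in
  accordance with \<open>hent\<close>.\<close>

definition jgap :: "'i set \<Rightarrow> ('i \<Rightarrow> real) \<Rightarrow> ('i \<Rightarrow> real) \<Rightarrow> (real \<Rightarrow> real) \<Rightarrow> real" where
  "jgap I v x f = (\<Sum>i\<in>I. v i * f (x i)) - sum v I * f ((\<Sum>i\<in>I. v i * x i) / sum v I)"

text \<open>Affine functions have no Jensen gap. This removes the \<open>ln d\<close> that arises
  when a rate is multiplied by the slot length \<open>d\<close>.\<close>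

lemma jgap_cong_affine:
  assumes "finite I" "\<And>i. i \<in> I \<Longrightarrow> 0 \<le> v i"
    and fg: "\<And>t. g t = c * f t + (b * t + k)"
  shows "jgap I v x g = c * jgap I v x f"
proof -
  define m where "m = (\<Sum>i\<in>I. v i * x i) / sum v I"
  have m: "sum v I * m = (\<Sum>i\<in>I. v i * x i)"
  proof (cases "sum v I = 0")
    case True
    then have "\<And>i. i \<in> I \<Longrightarrow> v i = 0" using assms by (simp add: sum_nonneg_eq_0_iff)
    then show ?thesis by simp
  qed (simp add: m_def)
  have "(\<Sum>i\<in>I. v i * g (x i)) = c * (\<Sum>i\<in>I. v i * f (x i)) + b * (\<Sum>i\<in>I. v i * x i) + k * sum v I"
    by (simp add: fg algebra_simps sum.distrib sum_distrib_left)
  moreover have "sum v I * g m = c * (sum v I * f m) + b * (sum v I * m) + k * sum v I"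
    by (simp add: fg algebra_simps)
  ultimately show ?thesis
    unfolding jgap_def m_def[symmetric] m by (simp add: algebra_simps)
qed

text \<open>Both bounds are \<open>ln t \<le> t - 1\<close>, taken at \<open>1 / (1 - s)\<close> and
  at \<open>1 - s\<close>. They say that the empty-slot term is linear up to a quadratic
  error.\<close>

lemma one_minus_ln_bounds:
  fixes s :: real
  assumes "0 \<le> s" "s \<le> 1"
  shows "- s \<le> (1 - s) * ln (1 - s)" "(1 - s) * ln (1 - s) \<le> - s + s\<^sup>2"
proof -
  show "- s \<le> (1 - s) * ln (1 - s)"
  proof (cases "s = 1")
    case False
    then have s: "1 - s > 0" using assms by simp
    have "- ln (1 - s) = ln (1 / (1 - s))" using s by (simp add: ln_div)
    also have "\<dots> \<le> 1 / (1 - s) - 1" using s by (intro ln_le_minus_one) simp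
    finally have "(1 - s) * (- ln (1 - s)) \<le> (1 - s) * (1 / (1 - s) - 1)"
      using s by (intro mult_left_mono) auto
    also have "\<dots> = s" using s by (simp add: field_simps)
    finally show ?thesis by simp
  qed simp
  show "(1 - s) * ln (1 - s) \<le> - s + s\<^sup>2"
  proof (cases "s = 1")
    case False
    then have s: "1 - s > 0" using assms by simp
    have "ln (1 - s) \<le> - s" using ln_le_minus_one[OF s] by simp
    then have "(1 - s) * ln (1 - s) \<le> (1 - s) * (- s)" using s by (intro mult_left_mono) auto
    then show ?thesis by (simp add: power2_eq_square algebra_simps)
  qed simp
qed

lemma weighted_mean_range:
  fixes v x :: "'i \<Rightarrow> real"
  assumes "finite I" "\<And>i. i \<in> I \<Longrightarrow> 0 \<le> v i" "\<And>i. i \<in> I \<Longrightarrow> x i \<in> {0..1}"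
  shows "(\<Sum>i\<in>I. v i * x i) / sum v I \<in> {0..1}"
proof -
  have "0 \<le> (\<Sum>i\<in>I. v i * x i)" using assms by (intro sum_nonneg) auto
  moreover have "(\<Sum>i\<in>I. v i * x i) \<le> sum v I"
    using assms by (intro sum_mono) (auto intro: mult_left_le)
  ultimately show ?thesis by (auto simp: divide_le_eq_1 zero_le_divide_iff)
qed

lemma rate_range:
  fixes x :: real
  assumes "x \<in> {0..1}" "0 \<le> a" "0 \<le> l" "0 \<le> d" "d * (a + l) \<le> 1"
  shows "0 \<le> d * (a * x + l)" "d * (a * x + l) \<le> d * (a + l)" "d * (a * x + l) \<in> {0..1}"
proof -
  have "a * x \<le> a" using assms by (intro mult_left_le) auto
  then have "a * x + l \<le> a + l" by simp
  then show *: "d * (a * x + l) \<le> d * (a + l)" using assms by (intro mult_left_mono) auto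
  show **: "0 \<le> d * (a * x + l)" using assms by simp
  show "d * (a * x + l) \<in> {0..1}" using * ** assms(5) by simp
qed

text \<open>Up to an error in \<open>[0, (d * (a + l))\<^sup>2]\<close>, the function is
  \<open>- s\<close> with \<open>s\<close> affine, and an affine function has no gap. So the
  weighted sum and its value at the mean lie in the same interval of length
  \<open>sum v I * (d * (a + l))\<^sup>2\<close>. With \<open>d = T/n\<close> this is the
  \<open>O(n\<^sup>-\<^sup>2)\<close> loss of a slot.\<close>

lemma jgap_remainder:
  assumes I: "finite I" and v: "\<And>i. i \<in> I \<Longrightarrow> 0 \<le> v i" and x: "\<And>i. i \<in> I \<Longrightarrow> x i \<in> {0..1}"
    and c: "0 \<le> a" "0 \<le> l" "0 \<le> d" "d * (a + l) \<le> 1"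
  shows "\<bar>jgap I v x (\<lambda>t. (1 - d * (a * t + l)) * ln (1 - d * (a * t + l)))\<bar> \<le> sum v I * (d * (a + l))\<^sup>2"
proof -
  define V where "V = sum v I"
  define m where "m = (\<Sum>i\<in>I. v i * x i) / V"
  define s where "s = (\<lambda>t. d * (a * t + l))"
  define k where "k = (\<lambda>t. (1 - s t) * ln (1 - s t))"
  have m: "m \<in> {0..1}" unfolding m_def V_def by (intro weighted_mean_range I v x)
  have V: "0 \<le> V" using v by (auto simp: V_def intro: sum_nonneg)
  have s: "0 \<le> s t" "s t \<le> d * (a + l)" if "t \<in> {0..1}" for t
    using rate_range[OF that c] by (auto simp: s_def)
  have s1: "s t \<le> 1" if "t \<in> {0..1}" for t using s[OF that] c by linarith
  have s2: "(s t)\<^sup>2 \<le> (d * (a + l))\<^sup>2" if "t \<in> {0..1}" for t using s[OF that] by (intro power_mono) auto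
  have mean: "V * s m = (\<Sum>i\<in>I. v i * s (x i))"
  proof (cases "V = 0")
    case True
    then have "\<And>i. i \<in> I \<Longrightarrow> v i = 0" using I v by (simp add: V_def sum_nonneg_eq_0_iff)
    then show ?thesis using True by simp
  next
    case False
    have "V * s m = d * (a * (V * m) + l * V)" by (simp add: s_def algebra_simps)
    also have "V * m = (\<Sum>i\<in>I. v i * x i)" using False by (simp add: m_def)
    finally show ?thesis
      by (simp add: s_def V_def sum_distrib_left sum.distrib algebra_simps)
  qed
  have "(\<Sum>i\<in>I. v i * k (x i)) \<le> (\<Sum>i\<in>I. v i * (- s (x i) + (d * (a + l))\<^sup>2))"
  proof (intro sum_mono mult_left_mono v)
    fix i assume "i \<in> I"
    show "k (x i) \<le> - s (x i) + (d * (a + l))\<^sup>2"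
      using one_minus_ln_bounds(2)[of "s (x i)"] s[OF x] s1[OF x] s2[OF x] \<open>i \<in> I\<close> unfolding k_def by force
  qed
  also have "\<dots> = - V * s m + V * (d * (a + l))\<^sup>2"
    using mean by (simp add: V_def algebra_simps sum.distrib sum_subtractf sum_distrib_left sum_distrib_right)
  finally have up: "(\<Sum>i\<in>I. v i * k (x i)) \<le> - V * s m + V * (d * (a + l))\<^sup>2" .
  have "(\<Sum>i\<in>I. v i * k (x i)) \<ge> (\<Sum>i\<in>I. v i * (- s (x i)))"
    using one_minus_ln_bounds(1)[OF s(1)[OF x] s1[OF x]] v unfolding k_def by (intro sum_mono mult_left_mono) auto
  then have lo: "(\<Sum>i\<in>I. v i * k (x i)) \<ge> - V * s m" using mean by (simp add: sum_negf)
  have "k m \<ge> - s m" unfolding k_def using one_minus_ln_bounds(1)[OF s(1)[OF m] s1[OF m]] .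
  then have k1: "V * k m \<ge> - V * s m" using mult_left_mono[OF _ V] by fastforce
  have "k m \<le> - s m + (d * (a + l))\<^sup>2" unfolding k_def
    using one_minus_ln_bounds(2)[OF s(1)[OF m] s1[OF m]] s2[OF m] by linarith
  then have k2: "V * k m \<le> - V * s m + V * (d * (a + l))\<^sup>2"
    using mult_left_mono[OF _ V, of "k m" "- s m + (d * (a + l))\<^sup>2"] by (simp add: algebra_simps)
  have "jgap I v x (\<lambda>t. (1 - d * (a * t + l)) * ln (1 - d * (a * t + l))) = (\<Sum>i\<in>I. v i * k (x i)) - V * k m"
    by (simp add: jgap_def k_def s_def V_def m_def)
  then show ?thesis using up lo k1 k2 by (simp add: V_def abs_le_iff)
qed

text \<open>An instance of \<open>hent_weighted\<close> for the success and the failure of the slot.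
  The success part is a gap of \<open>t ln t\<close> composed with \<open>d * (a * t + l)\<close>,
  which is \<open>d * phi a l t\<close> plus an affine function of \<open>t\<close>.\<close>

lemma hent_bernoulli:
  assumes I: "finite I" and v: "\<And>i. i \<in> I \<Longrightarrow> 0 \<le> v i" and x: "\<And>i. i \<in> I \<Longrightarrow> x i \<in> {0..1}"
    and c: "0 \<le> a" "0 \<le> l" "0 < d" "d * (a + l) \<le> 1"
  shows "hent I (\<lambda>i. v i * (d * (a * x i + l))) + hent I (\<lambda>i. v i * (1 - d * (a * x i + l))) =
    hent I v + d * jgap I v x (phi a l) +
    jgap I v x (\<lambda>t. (1 - d * (a * t + l)) * ln (1 - d * (a * t + l)))"
proof -
  define V where "V = sum v I"
  define m where "m = (\<Sum>i\<in>I. v i * x i) / V"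
  define s where "s = (\<lambda>t. d * (a * t + l))"
  define \<theta> where "\<theta> = (\<lambda>t::real. t * ln t)"
  have m: "m \<in> {0..1}" unfolding m_def V_def by (intro weighted_mean_range I v x)
  have s: "0 \<le> s t" "s t \<le> 1" if "t \<in> {0..1}" for t
    using rate_range[OF that c(1,2) less_imp_le[OF c(3)] c(4)] by (auto simp: s_def)
  have jg: "jgap I v x (\<lambda>t. \<theta> (s t)) = d * jgap I v x (phi a l)"
  proof (rule jgap_cong_affine[OF I v])
    fix t
    show "\<theta> (s t) = d * phi a l t + ((d * ln d * a) * t + d * ln d * l)"
    \<comment> \<open>At a vanishing rate \<open>ln (d * r) = ln d + ln r\<close> fails because
      \<open>ln 0 = 0\<close>, but the factor in front of the logarithm vanishes as well.\<close>
    proof (cases "a * t + l = 0")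
      case True
      have "(d * ln d * a) * t + d * ln d * l = d * ln d * (a * t + l)" by (simp add: algebra_simps)
      then show ?thesis using True by (simp add: \<theta>_def s_def phi_def)
    next
      case False
      then have "ln (d * (a * t + l)) = ln d + ln (a * t + l)" using c by (simp add: ln_mult)
      then show ?thesis by (simp add: \<theta>_def s_def phi_def algebra_simps)
    qed
  qed
  have *: "V * \<theta> ((\<Sum>i\<in>I. v i * f (x i)) / V) = V * \<theta> (f m)"
    if f: "\<And>t. f t = b * t + k" for f b k
  proof (cases "V = 0")
    case False
    have "(\<Sum>i\<in>I. v i * f (x i)) = b * (\<Sum>i\<in>I. v i * x i) + k * V"
      by (simp add: f V_def algebra_simps sum.distrib sum_distrib_left)
    then have "(\<Sum>i\<in>I. v i * f (x i)) / V = f m" using False by (simp add: f m_def field_simps)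
    then show ?thesis by simp
  qed simp
  have aff: "hent I (\<lambda>i. v i * f (x i)) = (\<Sum>i\<in>I. v i * f (x i) * ln (v i / V)) + jgap I v x (\<lambda>t. \<theta> (f t))"
    if f: "\<And>t. f t = b * t + k" and f0: "\<And>t. t \<in> {0..1} \<Longrightarrow> 0 \<le> f t" for f b k
  proof -
    have "hent I (\<lambda>i. v i * f (x i)) = (\<Sum>i\<in>I. v i * f (x i) * ln (v i / V)) +
        (\<Sum>i\<in>I. v i * \<theta> (f (x i))) - V * \<theta> ((\<Sum>i\<in>I. v i * f (x i)) / V)"
      unfolding V_def \<theta>_def by (rule hent_weighted[OF I v, where r="\<lambda>i. f (x i)"]) (auto intro: f0[OF x])
    then show ?thesis using *[of f b k, OF f]
      unfolding jgap_def V_def[symmetric] m_def[symmetric] by linarith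
  qed
  have 1: "hent I (\<lambda>i. v i * s (x i)) = (\<Sum>i\<in>I. v i * s (x i) * ln (v i / V)) + jgap I v x (\<lambda>t. \<theta> (s t))"
    using s by (intro aff[of s "d * a" "d * l"]) (auto simp: s_def algebra_simps)
  have 2: "hent I (\<lambda>i. v i * (1 - s (x i))) = (\<Sum>i\<in>I. v i * (1 - s (x i)) * ln (v i / V)) + jgap I v x (\<lambda>t. \<theta> (1 - s t))"
    using s by (intro aff[of "\<lambda>t. 1 - s t" "- d * a" "1 - d * l"]) (auto simp: s_def algebra_simps)
  have "(\<Sum>i\<in>I. v i * s (x i) * ln (v i / V)) + (\<Sum>i\<in>I. v i * (1 - s (x i)) * ln (v i / V)) = hent I v"
    by (simp add: hent_def V_def sum.distrib[symmetric] algebra_simps)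
  then show ?thesis using 1 2 jg by (simp add: s_def \<theta>_def)
qed

lemma jgap_convex:
  assumes I: "finite I" and v: "\<And>i. i \<in> I \<Longrightarrow> 0 \<le> v i" and x: "\<And>i. i \<in> I \<Longrightarrow> x i \<in> {0..1}"
    and f: "convex_on {0..1} f"
  shows "0 \<le> jgap I v x f"
proof (cases "sum v I = 0")
  case True
  then have "\<And>i. i \<in> I \<Longrightarrow> v i = 0" using I v by (simp add: sum_nonneg_eq_0_iff)
  then show ?thesis using True by (simp add: jgap_def)
next
  case False
  then have V: "sum v I > 0" using v by (simp add: order_less_le sum_nonneg)
  have "f (\<Sum>i\<in>I. (v i / sum v I) *\<^sub>R x i) \<le> (\<Sum>i\<in>I. (v i / sum v I) * f (x i))"
    using V v x I False
    by (intro convex_on_sum[OF I _ f]) (auto simp: sum_divide_distrib[symmetric])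
  then have "sum v I * f ((\<Sum>i\<in>I. v i * x i) / sum v I) \<le> sum v I * (\<Sum>i\<in>I. (v i / sum v I) * f (x i))"
    using V by (intro mult_left_mono) (auto simp: sum_divide_distrib)
  also have "\<dots> = (\<Sum>i\<in>I. v i * f (x i))" using V by (simp add: sum_distrib_left)
  finally show ?thesis by (simp add: jgap_def)
qed

text \<open>Here \<open>v i\<close> is the joint weight of label \<open>i\<close> and the outcome of
  all other slots, and \<open>e i\<close> is the integral of the current input over the same event.
  Replacing receiver 2 by receiver 1 in the current slot gains \<open>d\<close> times the Jensen gap
  of \<open>\<Phi>\<close>, which is nonnegative by convexity, up to the two quadratic
  remainders.\<close>

lemma hent_bernoulli_compare:
  assumes I: "finite I" and v: "\<And>i. i \<in> I \<Longrightarrow> 0 \<le> v i" and e: "\<And>i. i \<in> I \<Longrightarrow> 0 \<le> e i" "\<And>i. i \<in> I \<Longrightarrow> e i \<le> v i"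
    and y: "0 \<le> ay" "0 \<le> ly" "d * (ay + ly) \<le> 1" and z: "0 \<le> az" "0 \<le> lz" "d * (az + lz) \<le> 1"
    and d: "0 < d"
    and cvx: "convex_on {0..1} (\<lambda>x. phi ay ly x - phi az lz x)"
  shows "hent I (\<lambda>i. d * (az * e i + lz * v i)) + hent I (\<lambda>i. v i - d * (az * e i + lz * v i)) \<le>
    hent I (\<lambda>i. d * (ay * e i + ly * v i)) + hent I (\<lambda>i. v i - d * (ay * e i + ly * v i))
     + d\<^sup>2 * ((ay + ly)\<^sup>2 + (az + lz)\<^sup>2) * sum v I"
proof -
  \<comment> \<open>The conditional mean of the input. For \<open>v i = 0\<close> the bounds force
    \<open>e i = 0\<close>, so \<open>e i = v i * x i\<close> holds in all cases.\<close>
  define x where "x = (\<lambda>i. e i / v i)"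
  have ex: "e i = v i * x i" if "i \<in> I" for i
    using e[OF that] by (auto simp: x_def)
  have x: "x i \<in> {0..1}" if "i \<in> I" for i
    using e[OF that] v[OF that] by (auto simp: x_def divide_le_eq_1 zero_le_divide_iff)
  have eq1: "hent I (\<lambda>i. d * (a * e i + l * v i)) = hent I (\<lambda>i. v i * (d * (a * x i + l)))" for a l
    by (intro hent_cong) (auto simp: ex algebra_simps)
  have eq2: "hent I (\<lambda>i. v i - d * (a * e i + l * v i)) = hent I (\<lambda>i. v i * (1 - d * (a * x i + l)))" for a l
    by (intro hent_cong) (auto simp: ex algebra_simps)
  have "0 \<le> jgap I v x (\<lambda>x. phi ay ly x - phi az lz x)"
    by (intro jgap_convex I v x cvx)
  also have "\<dots> = jgap I v x (phi ay ly) - jgap I v x (phi az lz)"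
    by (simp add: jgap_def algebra_simps sum_subtractf)
  finally have "d * jgap I v x (phi az lz) \<le> d * jgap I v x (phi ay ly)" using d by simp
  moreover have "(d * (ay + ly))\<^sup>2 * sum v I + (d * (az + lz))\<^sup>2 * sum v I =
      d\<^sup>2 * ((ay + ly)\<^sup>2 + (az + lz)\<^sup>2) * sum v I"
    unfolding power_mult_distrib by (simp add: algebra_simps)
  ultimately show ?thesis
    unfolding eq1 eq2
    using hent_bernoulli[OF I, of v x, OF v x y(1,2) d y(3)] hent_bernoulli[OF I, of v x, OF v x z(1,2) d z(3)]
      jgap_remainder[OF I, of v x, OF v x y(1,2) less_imp_le[OF d] y(3)]
      jgap_remainder[OF I, of v x, OF v x z(1,2) less_imp_le[OF d] z(3)]
    by (simp add: abs_le_iff mult.commute[of "sum v I"])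
qed

text \<open>The probability that independent slots in \<open>K\<close> with success probabilities \<open>s\<close> succeed exactly on \<open>S\<close>.\<close>

definition bprod :: "nat set \<Rightarrow> (nat \<Rightarrow> real) \<Rightarrow> nat set \<Rightarrow> real" where
  "bprod K s S = (\<Prod>j\<in>K. if j \<in> S then s j else 1 - s j)"

section \<open>Products of slots and the exchange of receivers slot by slot\<close>

lemma sum_Pow_insert:
  fixes f :: "'a set \<Rightarrow> real"
  assumes "finite K" "k \<notin> K"
  shows "(\<Sum>S\<in>Pow (insert k K). f S) = (\<Sum>S\<in>Pow K. f S + f (insert k S))"
proof -
  have "(\<Sum>S\<in>Pow (insert k K). f S) = (\<Sum>S\<in>Pow K. f S) + (\<Sum>S\<in>insert k ` Pow K. f S)"
    unfolding Pow_insert using assms by (intro sum.union_disjoint) auto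
  also have "(\<Sum>S\<in>insert k ` Pow K. f S) = (\<Sum>S\<in>Pow K. f (insert k S))"
    using assms by (intro sum.reindex_cong[where l="insert k"]) (auto simp: inj_on_def)
  finally show ?thesis by (simp add: sum.distrib)
qed

lemma bprod_insert:
  assumes "finite K" "k \<notin> K" "S \<subseteq> K"
  shows "bprod (insert k K) s S = (1 - s k) * bprod K s S"
    "bprod (insert k K) s (insert k S) = s k * bprod K s S"
proof -
  show "bprod (insert k K) s S = (1 - s k) * bprod K s S"
    using assms by (auto simp: bprod_def)
  have "(\<Prod>j\<in>K. if j \<in> insert k S then s j else 1 - s j) = (\<Prod>j\<in>K. if j \<in> S then s j else 1 - s j)"
    using assms by (intro prod.cong) auto
  then show "bprod (insert k K) s (insert k S) = s k * bprod K s S"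
    using assms by (simp add: bprod_def)
qed

lemma sum_bprod:
  assumes "finite K"
  shows "(\<Sum>S\<in>Pow K. bprod K s S) = 1"
  using assms
proof (induction K)
  case (insert k K)
  have "(\<Sum>S\<in>Pow (insert k K). bprod (insert k K) s S) = (\<Sum>S\<in>Pow K. bprod K s S)"
    unfolding sum_Pow_insert[OF insert.hyps] using insert.hyps
    by (intro sum.cong) (auto simp: bprod_insert algebra_simps)
  then show ?case using insert.IH by simp
qed (simp add: bprod_def)

lemma bprod_bounds:
  assumes "\<And>j. j \<in> K \<Longrightarrow> s j \<in> {0..1}"
  shows "0 \<le> bprod K s S" "bprod K s S \<le> 1"
  using assms unfolding bprod_def by (fastforce intro!: prod_nonneg prod_le_1)+

lemma bprod_cong: "(\<And>j. j \<in> K \<Longrightarrow> s j = s' j) \<Longrightarrow> bprod K s S = bprod K s' S"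
  unfolding bprod_def by (intro prod.cong) auto

lemma bprod_measurable:
  assumes "\<And>j. j \<in> K \<Longrightarrow> (\<lambda>x. s x j) \<in> borel_measurable M"
  shows "(\<lambda>x. bprod K (s x) S) \<in> borel_measurable M"
  unfolding bprod_def
proof (rule borel_measurable_prod)
  fix j assume "j \<in> K"
  then show "(\<lambda>x. if j \<in> S then s x j else 1 - s x j) \<in> borel_measurable M"
    using assms by (cases "j \<in> S") auto
qed

text \<open>A telescoping argument over hybrids. Two neighbouring hybrids differ in slot
  \<open>k\<close> only; given the pattern \<open>S\<close> of the others,
  \<open>hent_bernoulli_compare\<close> applies to that slot, and the error terms summed over
  \<open>S\<close> amount to the total mass. Hence each exchange costs at most \<open>C\<close>,
  whatever the dependence between the values \<open>X j\<close>.\<close>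

lemma sum_hent_hybrid:
  fixes \<rho> :: "'i \<Rightarrow> 'x measure" and X :: "nat \<Rightarrow> 'x \<Rightarrow> real"
  assumes I: "finite I" and fin: "\<And>i. i \<in> I \<Longrightarrow> finite_measure (\<rho> i)"
    and X: "\<And>i j. i \<in> I \<Longrightarrow> X j \<in> borel_measurable (\<rho> i)"
    and Xr: "\<And>i j x. i \<in> I \<Longrightarrow> x \<in> space (\<rho> i) \<Longrightarrow> X j x \<in> {0..1}"
    and y: "0 \<le> ay" "0 \<le> ly" "d * (ay + ly) \<le> 1" and z: "0 \<le> az" "0 \<le> lz" "d * (az + lz) \<le> 1"
    and d: "0 < d"
    and cvx: "convex_on {0..1} (\<lambda>x. phi ay ly x - phi az lz x)"
  shows "(\<Sum>S\<in>Pow {..<n}. hent I (\<lambda>i. \<integral>x. bprod {..<n} (\<lambda>j. d * (az * X j x + lz)) S \<partial>\<rho> i)) \<le>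
    (\<Sum>S\<in>Pow {..<n}. hent I (\<lambda>i. \<integral>x. bprod {..<n} (\<lambda>j. d * (ay * X j x + ly)) S \<partial>\<rho> i)) +
    n * (d\<^sup>2 * ((ay + ly)\<^sup>2 + (az + lz)\<^sup>2) * (\<Sum>i\<in>I. measure (\<rho> i) (space (\<rho> i))))"
proof -
  define C where "C = d\<^sup>2 * ((ay + ly)\<^sup>2 + (az + lz)\<^sup>2) * (\<Sum>i\<in>I. measure (\<rho> i) (space (\<rho> i)))"
  \<comment> \<open>the hybrid output: receiver 1 in the first \<open>k\<close> slots, receiver 2 in the others\<close>
  define mix where "mix = (\<lambda>k x j. if j < k then d * (ay * X j x + ly) else d * (az * X j x + lz))"
  define G where "G = (\<lambda>k. \<Sum>S\<in>Pow {..<n}. hent I (\<lambda>i. \<integral>x. bprod {..<n} (mix k x) S \<partial>\<rho> i))"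
  have rate: "d * (a * X j x + l) \<in> {0..1}" if "i \<in> I" "x \<in> space (\<rho> i)" "0 \<le> a" "0 \<le> l" "d * (a + l) \<le> 1" for i a l j x
    using rate_range(3)[OF Xr] that d by simp
  have mixr: "mix k x j \<in> {0..1}" if "i \<in> I" "x \<in> space (\<rho> i)" for i k x j
    unfolding mix_def using rate[OF that y] rate[OF that z] by auto
  have mixm: "(\<lambda>x. mix k x j) \<in> borel_measurable (\<rho> i)" if "i \<in> I" for i k j
    unfolding mix_def by (intro measurable_If borel_measurable_add borel_measurable_times X[OF that]) auto
  have int: "integrable (\<rho> i) (\<lambda>x. f x * bprod K (mix k x) S)"
    if i: "i \<in> I" and f: "f \<in> borel_measurable (\<rho> i)" "\<And>x. x \<in> space (\<rho> i) \<Longrightarrow> f x \<in> {0..1}" for i K k S and f :: "'x \<Rightarrow> real"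
  proof -
    interpret finite_measure "\<rho> i" by (rule fin[OF i])
    have "\<bar>f x\<bar> * \<bar>bprod K (mix k x) S\<bar> \<le> 1" if "x \<in> space (\<rho> i)" for x
      using f(2)[OF that] bprod_bounds[of K "mix k x" S, OF mixr[OF i that]]
      by (intro mult_le_one) auto
    moreover have "(\<lambda>x. f x * bprod K (mix k x) S) \<in> borel_measurable (\<rho> i)"
      by (intro borel_measurable_times f(1) bprod_measurable mixm[OF i])
    ultimately show ?thesis
      by (intro integrable_const_bound[where B=1] AE_I2) (auto simp: abs_mult)
  qed
  have step: "G k \<le> G (Suc k) + C" if k: "k < n" for k
  proof -
    define K where "K = {..<n} - {k}"
    have K: "finite K" "k \<notin> K" "insert k K = {..<n}" using k by (auto simp: K_def)
    define v where "v = (\<lambda>S i. \<integral>x. bprod K (mix k x) S \<partial>\<rho> i)"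
    define e where "e = (\<lambda>S i. \<integral>x. X k x * bprod K (mix k x) S \<partial>\<rho> i)"
    \<comment> \<open>The weights \<open>v\<close> and \<open>e\<close> of the remaining slots are
      therefore common to both hybrids.\<close>
    have mK: "bprod K (mix (Suc k) x) S = bprod K (mix k x) S" for x S
      by (rule bprod_cong) (auto simp: mix_def K_def)
    have iv: "integrable (\<rho> i) (\<lambda>x. bprod K (mix k x) S)" if "i \<in> I" for i S
      using int[OF that, where f="\<lambda>_. 1"] by simp
    have ie: "integrable (\<rho> i) (\<lambda>x. X k x * bprod K (mix k x) S)" if "i \<in> I" for i S
      using int[OF that, where f="X k"] X Xr that by simp
    have v0: "0 \<le> v S i" if "i \<in> I" for S i
      unfolding v_def using bprod_bounds[OF mixr[OF that]] by (intro integral_nonneg_AE AE_I2) auto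
    have e0: "0 \<le> e S i" if "i \<in> I" for S i
      unfolding e_def using bprod_bounds[OF mixr[OF that]] Xr[OF that]
      by (intro integral_nonneg_AE AE_I2 mult_nonneg_nonneg) auto
    have ev: "e S i \<le> v S i" if "i \<in> I" for S i
      unfolding v_def e_def using bprod_bounds[OF mixr[OF that]] Xr[OF that]
      by (intro integral_mono_AE iv ie that AE_I2 mult_left_le_one_le) auto
    have split: "(\<integral>x. (d * (a * X k x + l)) * bprod K (mix k x) S \<partial>\<rho> i) = d * (a * e S i + l * v S i)" if "i \<in> I" for S i a l
    proof -
      have "(\<integral>x. (d * (a * X k x + l)) * bprod K (mix k x) S \<partial>\<rho> i) =
         (\<integral>x. (d * a) * (X k x * bprod K (mix k x) S) + (d * l) * bprod K (mix k x) S \<partial>\<rho> i)"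
        by (simp add: algebra_simps)
      also have "\<dots> = (d * a) * e S i + (d * l) * v S i"
        unfolding e_def v_def using iv[OF that] ie[OF that] by simp
      finally show ?thesis by (simp add: algebra_simps)
    qed
    have split2: "(\<integral>x. (1 - d * (a * X k x + l)) * bprod K (mix k x) S \<partial>\<rho> i) = v S i - d * (a * e S i + l * v S i)" if "i \<in> I" for S i a l
    proof -
      have "(\<integral>x. (1 - d * (a * X k x + l)) * bprod K (mix k x) S \<partial>\<rho> i) =
         (\<integral>x. (1 - d * l) * bprod K (mix k x) S - (d * a) * (X k x * bprod K (mix k x) S) \<partial>\<rho> i)"
        by (simp add: algebra_simps)
      also have "\<dots> = (1 - d * l) * v S i - (d * a) * e S i"
        unfolding e_def v_def using iv[OF that] ie[OF that] by simp
      finally show ?thesis by (simp add: algebra_simps)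
    qed
    have mixk: "mix k x k = d * (az * X k x + lz)" "mix (Suc k) x k = d * (ay * X k x + ly)" for x
      by (simp_all add: mix_def)
    have Gz: "G k = (\<Sum>S\<in>Pow K. hent I (\<lambda>i. d * (az * e S i + lz * v S i)) + hent I (\<lambda>i. v S i - d * (az * e S i + lz * v S i)))"
    proof -
      have "G k = (\<Sum>S\<in>Pow K. hent I (\<lambda>i. \<integral>x. bprod (insert k K) (mix k x) S \<partial>\<rho> i) +
          hent I (\<lambda>i. \<integral>x. bprod (insert k K) (mix k x) (insert k S) \<partial>\<rho> i))"
        unfolding G_def K(3)[symmetric] by (rule sum_Pow_insert[OF K(1,2)])
      also have "\<dots> = (\<Sum>S\<in>Pow K. hent I (\<lambda>i. v S i - d * (az * e S i + lz * v S i)) + hent I (\<lambda>i. d * (az * e S i + lz * v S i)))"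
        by (intro sum.cong refl arg_cong2[where f="(+)"] hent_cong)
          (auto simp: bprod_insert[OF K(1,2)] mixk split split2)
      finally show ?thesis by (simp add: add.commute)
    qed
    have Gy: "G (Suc k) = (\<Sum>S\<in>Pow K. hent I (\<lambda>i. d * (ay * e S i + ly * v S i)) + hent I (\<lambda>i. v S i - d * (ay * e S i + ly * v S i)))"
    proof -
      have "G (Suc k) = (\<Sum>S\<in>Pow K. hent I (\<lambda>i. \<integral>x. bprod (insert k K) (mix (Suc k) x) S \<partial>\<rho> i) +
          hent I (\<lambda>i. \<integral>x. bprod (insert k K) (mix (Suc k) x) (insert k S) \<partial>\<rho> i))"
        unfolding G_def K(3)[symmetric] by (rule sum_Pow_insert[OF K(1,2)])
      also have "\<dots> = (\<Sum>S\<in>Pow K. hent I (\<lambda>i. v S i - d * (ay * e S i + ly * v S i)) + hent I (\<lambda>i. d * (ay * e S i + ly * v S i)))"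
        by (intro sum.cong refl arg_cong2[where f="(+)"] hent_cong)
          (auto simp: bprod_insert[OF K(1,2)] mK mixk split split2)
      finally show ?thesis by (simp add: add.commute)
    qed
    \<comment> \<open>Summing over the patterns of the other slots restores the mass of the input
      measures, which keeps the error of the whole sum at the size of that of a single
      pattern.\<close>
    have "(\<Sum>S\<in>Pow K. \<Sum>i\<in>I. v S i) = (\<Sum>i\<in>I. \<integral>x. (\<Sum>S\<in>Pow K. bprod K (mix k x) S) \<partial>\<rho> i)"
      unfolding v_def using iv by (subst sum.swap) (intro sum.cong refl Bochner_Integration.integral_sum[symmetric], auto)
    also have "\<dots> = (\<Sum>i\<in>I. measure (\<rho> i) (space (\<rho> i)))"
      by (simp add: sum_bprod[OF K(1)])
    finally have tot: "(\<Sum>S\<in>Pow K. \<Sum>i\<in>I. v S i) = (\<Sum>i\<in>I. measure (\<rho> i) (space (\<rho> i)))" .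
    have "G k \<le> (\<Sum>S\<in>Pow K. hent I (\<lambda>i. d * (ay * e S i + ly * v S i)) + hent I (\<lambda>i. v S i - d * (ay * e S i + ly * v S i))
        + d\<^sup>2 * ((ay + ly)\<^sup>2 + (az + lz)\<^sup>2) * (\<Sum>i\<in>I. v S i))"
      unfolding Gz by (intro sum_mono hent_bernoulli_compare[OF I _ _ _ y z d cvx] v0 e0 ev)
    also have "\<dots> = G (Suc k) + C"
      unfolding Gy C_def tot[symmetric] by (simp add: sum.distrib sum_distrib_left)
    finally show ?thesis .
  qed
  have "G 0 \<le> G k + k * C" if "k \<le> n" for k
    using that
  proof (induction k)
    case (Suc k)
    then show ?case using step[of k] by (simp add: algebra_simps)
  qed simp
  from this[of n] have "G 0 \<le> G n + n * C" by simp
  moreover have "bprod {..<n} (mix n x) S = bprod {..<n} (\<lambda>j. d * (ay * X j x + ly)) S" for x S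
    by (rule bprod_cong) (auto simp: mix_def)
  moreover have "bprod {..<n} (mix 0 x) S = bprod {..<n} (\<lambda>j. d * (az * X j x + lz)) S" for x S
    by (rule bprod_cong) (auto simp: mix_def)
  ultimately show ?thesis by (simp add: G_def C_def)
qed

section \<open>Convexity of \<open>\<Phi>\<close>\<close>

text \<open>The inequality \<open>ln s \<le> s - 1\<close> at \<open>s = 1 / sqrt t\<close>. The
  square root leaves a bound that tends to 0 with \<open>t\<close>, which gives continuity of
  \<open>t ln t\<close> at 0 under the convention \<open>0 ln 0 = 0\<close>.\<close>

lemma abs_mult_ln_le:
  fixes t :: real
  assumes "0 \<le> t" "t \<le> 1"
  shows "\<bar>t * ln t\<bar> \<le> 2 * sqrt t"
proof (cases "t = 0")
  case False
  then have t: "0 < t" using assms by simp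
  have "ln (1 / sqrt t) \<le> 1 / sqrt t - 1" using t by (intro ln_le_minus_one) simp
  then have "- ln t / 2 \<le> 1 / sqrt t" using t by (simp add: ln_div ln_sqrt)
  then have "t * (- ln t) \<le> t * (2 / sqrt t)" using t by (intro mult_left_mono) auto
  also have "\<dots> = 2 * (t / sqrt t)" by simp
  also have "\<dots> = 2 * sqrt t" using t by (subst real_div_sqrt) auto
  finally show ?thesis using t assms by (simp add: abs_mult)
qed simp

lemma continuous_on_mult_ln: "continuous_on {0::real..} (\<lambda>t. t * ln t)"
  unfolding continuous_on_def
proof (intro ballI)
  fix t :: real assume "t \<in> {0..}"
  then consider "t = 0" | "t > 0" by force
  then show "((\<lambda>t. t * ln t) \<longlongrightarrow> t * ln t) (at t within {0..})"
  proof cases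
    case 1
    have ev: "eventually (\<lambda>s::real. norm (s * ln s) \<le> 2 * sqrt s) (at 0 within {0..})"
      unfolding eventually_at by (rule exI[of _ 1]) (use abs_mult_ln_le in \<open>force simp: dist_real_def\<close>)
    have "((\<lambda>s::real. s * ln s) \<longlongrightarrow> 0) (at 0 within {0..})"
    proof (rule Lim_null_comparison)
      show "eventually (\<lambda>s::real. norm (s * ln s) \<le> 2 * sqrt s) (at 0 within {0..})" by (rule ev)
      have "((\<lambda>s. 2 * sqrt s) \<longlongrightarrow> 2 * sqrt 0) (at 0 within {0..})" by (intro tendsto_intros)
      then show "((\<lambda>s. 2 * sqrt s) \<longlongrightarrow> 0) (at 0 within {0..})" by simp
    qed
    then show ?thesis using 1 by simp
  next
    case 2
    then show ?thesis by (intro tendsto_intros) auto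
  qed
qed

lemma continuous_on_phi:
  assumes "0 \<le> a" "0 \<le> l"
  shows "continuous_on {0..1} (phi a l)"
  unfolding phi_def using assms
  by (intro continuous_on_compose2[OF continuous_on_mult_ln, where f="\<lambda>x. a * x + l"] continuous_intros) auto

text \<open>Serves twice: at the end points a rate may vanish and \<open>\<phi>\<close> need not be
  differentiable, so convexity is first shown inside; and, read backwards, a failure of convexity
  can be witnessed by two interior points, where a receiver with positive gain has a positive
  rate.\<close>

lemma convex_on_from_interior:
  fixes f :: "real \<Rightarrow> real"
  assumes cont: "continuous_on {0..1} f"
    and ineq: "\<And>x y u v. x \<in> {0<..<1} \<Longrightarrow> y \<in> {0<..<1} \<Longrightarrow> 0 < u \<Longrightarrow> 0 < v \<Longrightarrow> u + v = 1 \<Longrightarrow>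
      f (u * x + v * y) \<le> u * f x + v * f y"
  shows "convex_on {0..1} f"
  unfolding convex_on_def
proof (intro conjI ballI allI impI)
  fix x y u v :: real
  assume xy: "x \<in> {0..1}" "y \<in> {0..1}" and uv: "0 \<le> u" "0 \<le> v" "u + v = 1"
  show "f (u *\<^sub>R x + v *\<^sub>R y) \<le> u * f x + v * f y"
  proof (cases "u = 0 \<or> v = 0")
    case False
    then have uv': "0 < u" "0 < v" using uv by auto
    define e where "e = (\<lambda>n. inverse (real (Suc (Suc n))))"
    \<comment> \<open>A contraction towards \<open>1/2\<close>. It moves every point into the
      interior, converges to the identity and, being affine, commutes with convex
      combinations.\<close>
    define X where "X = (\<lambda>z n. (1 - e n) * z + e n / 2)"
    have e: "0 < e n" "e n < 1" for n by (auto simp: e_def inverse_less_1_iff)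
    have elim: "e \<longlonglongrightarrow> 0" unfolding e_def by (rule LIMSEQ_Suc[OF LIMSEQ_inverse_real_of_nat])
    have X: "X z n \<in> {0<..<1}" if "z \<in> {0..1}" for z n
    proof -
      have "(1 - e n) * z \<le> 1 - e n" "0 \<le> (1 - e n) * z" using that e[of n] by (auto intro: mult_left_le)
      moreover have "0 < e n / 2" "e n / 2 < e n" using e[of n] by auto
      ultimately show ?thesis unfolding X_def greaterThanLessThan_iff by linarith
    qed
    have Xlim: "X z \<longlonglongrightarrow> z" for z
    proof -
      have "(\<lambda>n. (1 - e n) * z + e n / 2) \<longlonglongrightarrow> (1 - 0) * z + 0 / 2" by (intro tendsto_intros elim) simp
      then show ?thesis by (simp add: X_def)
    qed
    have fX: "(\<lambda>n. f (X z n)) \<longlonglongrightarrow> f z" if "z \<in> {0..1}" for z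
      using X[OF that] that less_imp_le by (intro continuous_on_tendsto_compose[OF cont Xlim]) (auto intro!: always_eventually)
    have z: "u * x + v * y \<in> {0..1}"
      using convexD[of "{0..1::real}" x y u v] xy uv by simp
    have XX: "u * X x n + v * X y n = X (u * x + v * y) n" for n
    proof -
      have "u * X x n + v * X y n = (1 - e n) * (u * x + v * y) + (u + v) * e n / 2"
        unfolding X_def by (simp add: algebra_simps)
      then show ?thesis using uv(3) by (simp add: X_def)
    qed
    have "f (u * x + v * y) \<le> u * f x + v * f y"
    proof (rule LIMSEQ_le)
      show "(\<lambda>n. f (X (u * x + v * y) n)) \<longlonglongrightarrow> f (u * x + v * y)" by (rule fX[OF z])
      show "(\<lambda>n. u * f (X x n) + v * f (X y n)) \<longlonglongrightarrow> u * f x + v * f y" by (intro tendsto_intros fX xy)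
      show "\<exists>N. \<forall>n\<ge>N. f (X (u * x + v * y) n) \<le> u * f (X x n) + v * f (X y n)"
        unfolding XX[symmetric] using ineq[OF X[OF xy(1)] X[OF xy(2)] uv' uv(3)] by blast
    qed
    then show ?thesis by simp
  qed (use uv in auto)
qed simp

lemma phi_deriv:
  assumes "0 \<le> a" "0 \<le> l" "0 < x"
  shows "(phi a l has_real_derivative a * (ln (a * x + l) + 1)) (at x)"
    "((\<lambda>x. a * (ln (a * x + l) + 1)) has_real_derivative a\<^sup>2 / (a * x + l)) (at x)"
proof -
  \<comment> \<open>For \<open>a = 0\<close> the rate may be 0 even at positive \<open>x\<close>;
    the function is then constant and both derivatives are 0.\<close>
  consider "a = 0" | "a > 0" using assms by force
  then have "(phi a l has_real_derivative a * (ln (a * x + l) + 1)) (at x) \<and>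
    ((\<lambda>x. a * (ln (a * x + l) + 1)) has_real_derivative a\<^sup>2 / (a * x + l)) (at x)"
  proof cases
    case 1
    then show ?thesis by (simp add: phi_def[abs_def])
  next
    case 2
    then have p: "a * x + l > 0" using assms by (simp add: add_pos_nonneg)
    show ?thesis unfolding phi_def[abs_def]
      by (rule conjI; (rule derivative_eq_intros refl | use p in \<open>simp add: field_simps power2_eq_square\<close>)+)
  qed
  then show "(phi a l has_real_derivative a * (ln (a * x + l) + 1)) (at x)"
    "((\<lambda>x. a * (ln (a * x + l) + 1)) has_real_derivative a\<^sup>2 / (a * x + l)) (at x)" by auto
qed

section \<open>The sign of the second derivative of \<open>\<Phi>\<close>\<close>

text \<open>Covers two uses: \<open>s = 1\<close>, \<open>k = 0\<close> for convexity of
  \<open>\<Phi>\<close>, and \<open>s = -1\<close>, \<open>k > 0\<close> for strong concavity of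
  \<open>\<Phi>\<close> near a point with negative second derivative.\<close>

lemma phi_diff_convex_onI:
  assumes nn: "0 \<le> ay" "0 \<le> az" "0 \<le> ly" "0 \<le> lz" and C: "convex C" "C \<subseteq> {0<..<1}"
    and ge: "\<And>x. x \<in> C \<Longrightarrow> 2 * k \<le> s * (ay\<^sup>2 / (ay * x + ly) - az\<^sup>2 / (az * x + lz))"
  shows "convex_on C (\<lambda>x. s * (phi ay ly x - phi az lz x) - k * x\<^sup>2)"
proof (rule f''_ge0_imp_convex[OF C(1),
    where f'="\<lambda>x. s * (ay * (ln (ay * x + ly) + 1) - az * (ln (az * x + lz) + 1)) - k * (2 * x)"
      and f''="\<lambda>x. s * (ay\<^sup>2 / (ay * x + ly) - az\<^sup>2 / (az * x + lz)) - k * 2"])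
  fix x assume x: "x \<in> C"
  then have "0 < x" using C by auto
  note D = phi_deriv[OF nn(1,3) this] phi_deriv[OF nn(2,4) this]
  show "((\<lambda>x. s * (phi ay ly x - phi az lz x) - k * x\<^sup>2) has_real_derivative
      s * (ay * (ln (ay * x + ly) + 1) - az * (ln (az * x + lz) + 1)) - k * (2 * x)) (at x)"
    by (intro DERIV_diff DERIV_cmult D) (auto intro!: derivative_eq_intros)
  show "((\<lambda>x. s * (ay * (ln (ay * x + ly) + 1) - az * (ln (az * x + lz) + 1)) - k * (2 * x)) has_real_derivative
      s * (ay\<^sup>2 / (ay * x + ly) - az\<^sup>2 / (az * x + lz)) - k * 2) (at x)"
    by (intro DERIV_diff DERIV_cmult D) (auto intro!: derivative_eq_intros)
  show "0 \<le> s * (ay\<^sup>2 / (ay * x + ly) - az\<^sup>2 / (az * x + lz)) - k * 2" using ge[OF x] by simp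
qed

text \<open>For positive \<open>ay\<close> and \<open>az\<close> the second derivative of
  \<open>\<Phi>\<close> has the sign of \<open>D\<close>, which is affine, so only
  \<open>D 0\<close> and \<open>D 1\<close> matter. As
  \<open>D 1 - D 0 = ay * az * (ay - az)\<close>, the smaller of them is \<open>D 0\<close> if
  \<open>ay \<ge> az\<close> and \<open>D 1\<close> otherwise; its nonnegativity is the respective
  alternative of the parameter condition.\<close>

lemma phi_diff_convex_iff:
  assumes nn: "0 \<le> ay" "0 \<le> az" "0 \<le> ly" "0 \<le> lz"
  shows "convex_on {0..1} (\<lambda>x. phi ay ly x - phi az lz x) \<longleftrightarrow>
      (ay \<ge> az \<and> ay\<^sup>2 * lz \<ge> az\<^sup>2 * ly) \<or>
      (0 < ay \<and> ay < az \<and> ay\<^sup>2 * (az + lz) \<ge> az\<^sup>2 * (ay + ly))" (is "?C \<longleftrightarrow> ?IV")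
proof
  define D where "D = (\<lambda>x. ay\<^sup>2 * (az * x + lz) - az\<^sup>2 * (ay * x + ly))"
  define f2 where "f2 = (\<lambda>x. ay\<^sup>2 / (ay * x + ly) - az\<^sup>2 / (az * x + lz))"
  have f2: "f2 x = D x / ((ay * x + ly) * (az * x + lz))" if "0 < x" "0 < ay" "0 < az" for x
  proof -
    have "ay * x + ly > 0" "az * x + lz > 0" using that nn by (auto intro!: add_pos_nonneg)
    then show ?thesis by (simp add: f2_def D_def field_simps)
  qed
  have D_lin: "D x = (1 - x) * D 0 + x * D 1" for x
    by (simp add: D_def algebra_simps)
  have D01: "D 1 = D 0 + ay * az * (ay - az)" by (simp add: D_def algebra_simps power2_eq_square)
  {
    assume IV: ?IV
    have f2nn: "0 \<le> f2 x" if x: "x \<in> {0<..<1}" for x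
    proof (cases "az = 0")
      case True
      then show ?thesis using nn x by (simp add: f2_def)
    next
      case False
      then have pos: "0 < az" "0 < ay" using nn IV by auto
      have "0 \<le> D 0 \<and> 0 \<le> D 1"
      proof (cases "ay \<ge> az")
        case True
        then have "0 \<le> D 0" using IV by (auto simp: D_def)
        moreover have "0 \<le> ay * az * (ay - az)" using True pos by simp
        ultimately show ?thesis using D01 by simp
      next
        case False
        then have "0 \<le> D 1" using IV by (auto simp: D_def)
        moreover have "ay * az * (ay - az) \<le> 0" using False pos by (simp add: mult_nonneg_nonpos)
        ultimately show ?thesis using D01 by simp
      qed
      then have "0 \<le> D x" unfolding D_lin[of x] using x by auto
      then show ?thesis using f2[of x] x pos nn by auto
    qed
    have "convex_on {0<..<1} (\<lambda>x. 1 * (phi ay ly x - phi az lz x) - 0 * x\<^sup>2)"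
      by (rule phi_diff_convex_onI[OF nn]) (use f2nn in \<open>auto simp: f2_def\<close>)
    then have cv: "convex_on {0<..<1} (\<lambda>x. phi ay ly x - phi az lz x)" by simp
    then have ineq: "\<And>x y u v. x \<in> {0<..<1} \<Longrightarrow> y \<in> {0<..<1} \<Longrightarrow> 0 < u \<Longrightarrow> 0 < v \<Longrightarrow> u + v = 1 \<Longrightarrow>
        phi ay ly (u * x + v * y) - phi az lz (u * x + v * y) \<le> u * (phi ay ly x - phi az lz x) + v * (phi ay ly y - phi az lz y)"
      unfolding convex_on_def real_scaleR_def by (meson less_imp_le)
    show ?C
      by (intro convex_on_from_interior continuous_on_diff continuous_on_phi nn ineq)
  }
  {
    assume C: ?C
    show ?IV
    proof (rule ccontr)
      assume nIV: "\<not> ?IV"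
      have az: "0 < az" using nIV nn by (cases "az = 0") auto
      obtain x0 where x0: "x0 \<in> {0<..<1}" "f2 x0 < 0"
      \<comment> \<open>With \<open>ay = 0 < az\<close> the function \<open>\<phi>\<close> of
        receiver 1 is constant, and \<open>\<Phi>\<close> is strictly concave in the
        interior.\<close>
      proof (cases "ay = 0")
        case True
        have "az * (1/2) + lz > 0" using az nn by (simp add: add_pos_nonneg)
        then have "f2 (1/2) < 0" using True az by (simp add: f2_def)
        then show thesis by (intro that[of "1/2"]) auto
      next
        case False
        then have ay: "0 < ay" using nn by simp
        \<comment> \<open>Which of the two holds depends on the order of \<open>ay\<close> and
          \<open>az\<close>. Continuity of \<open>D\<close> then carries the strict sign from the
          end point to an interior point.\<close>
        have "D 0 < 0 \<or> D 1 < 0" using nIV ay by (auto simp: D_def not_le)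
        moreover have cont: "(D \<longlongrightarrow> D c) (at c within A)" for c A unfolding D_def by (intro tendsto_intros)
        ultimately have "\<exists>x\<in>{0<..<1}. D x < 0"
        proof (elim disjE)
          assume "D 0 < 0"
          then have "eventually (\<lambda>x. D x < 0) (at_right 0)" using order_tendstoD(2)[OF cont] by blast
          moreover have "eventually (\<lambda>x. x \<in> {0<..<1::real}) (at_right 0)" by (intro eventually_at_rightI[of _ 1]) auto
          ultimately have "eventually (\<lambda>x. x \<in> {0<..<1} \<and> D x < 0) (at_right 0)" by eventually_elim auto
          from eventually_happens[OF this] show ?thesis by auto
        next
          assume "D 1 < 0"
          then have "eventually (\<lambda>x. D x < 0) (at_left 1)" using order_tendstoD(2)[OF cont] by blast
          moreover have "eventually (\<lambda>x. x \<in> {0<..<1::real}) (at_left 1)" by (intro eventually_at_leftI[of 0]) auto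
          ultimately have "eventually (\<lambda>x. x \<in> {0<..<1} \<and> D x < 0) (at_left 1)" by eventually_elim auto
          from eventually_happens[OF this] show ?thesis by auto
        qed
        then obtain x where x: "x \<in> {0<..<1}" "D x < 0" by auto
        then have "0 < (ay * x + ly) * (az * x + lz)" using ay az nn by (auto intro!: add_pos_nonneg mult_pos_pos)
        then have "f2 x < 0" using f2[of x] x ay az by (simp add: divide_neg_pos)
        then show thesis using x that by blast
      qed
      \<comment> \<open>Then \<open>- 2 * k\<close> is half of \<open>f2 x0\<close>, so that by
        continuity \<open>f2\<close> stays below \<open>- 2 * k\<close> near
        \<open>x0\<close>.\<close>
      define k where "k = - f2 x0 / 4"
      have k: "k > 0" using x0 by (simp add: k_def)
      have "isCont (\<lambda>x. a\<^sup>2 / (a * x + l)) x0" if "0 \<le> a" "0 \<le> l" for a l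
      proof (cases "a = 0")
        case False
        then have "a * x0 + l > 0" using that x0 by (auto intro!: add_pos_nonneg)
        then show ?thesis by (intro continuous_intros) auto
      qed simp
      then have "isCont f2 x0" unfolding f2_def using nn by (intro continuous_diff) auto
      then have lim: "(f2 \<longlongrightarrow> f2 x0) (nhds x0)" by (simp add: continuous_at tendsto_at_iff_tendsto_nhds)
      have "eventually (\<lambda>x. f2 x < - 2 * k) (nhds x0)"
        by (rule order_tendstoD(2)[OF lim]) (use x0 in \<open>simp add: k_def\<close>)
      moreover have "eventually (\<lambda>x. x \<in> {0<..<1}) (nhds x0)"
        by (rule eventually_nhds_in_open) (use x0 in auto)
      ultimately have "eventually (\<lambda>x. x \<in> {0<..<1} \<and> f2 x < - 2 * k) (nhds x0)"
        by eventually_elim auto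
      then obtain e where e: "e > 0" "\<And>x. \<bar>x - x0\<bar> < e \<Longrightarrow> x \<in> {0<..<1} \<and> f2 x < - 2 * k"
        by (auto simp: eventually_nhds_metric dist_real_def)
      define U where "U = {x0 - e <..< x0 + e}"
      have U: "x \<in> {0<..<1}" "f2 x < - 2 * k" if "x \<in> U" for x
        using e(2)[of x] that by (auto simp: U_def)
      \<comment> \<open>\<open>- \<Phi> - k x\<^sup>2\<close> and \<open>\<Phi>\<close> are both convex on \<open>U\<close>, hence so is \<open>- k x\<^sup>2\<close>, a contradiction\<close>
      have "convex_on U (\<lambda>x. (-1) * (phi ay ly x - phi az lz x) - k * x\<^sup>2)"
      proof (rule phi_diff_convex_onI[OF nn])
        show "convex U" by (simp add: U_def)
        show "U \<subseteq> {0<..<1}" using U by blast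
        show "2 * k \<le> (-1) * (ay\<^sup>2 / (ay * x + ly) - az\<^sup>2 / (az * x + lz))" if "x \<in> U" for x
          using U(2)[OF that] by (simp add: f2_def)
      qed
      moreover have "convex_on U (\<lambda>x. phi ay ly x - phi az lz x)"
        using U(1) by (intro convex_on_subset[OF C]) (auto simp: less_imp_le U_def)
      ultimately have "convex_on U (\<lambda>x. ((-1) * (phi ay ly x - phi az lz x) - k * x\<^sup>2) + (phi ay ly x - phi az lz x))"
        by (rule convex_on_add)
      then have cv: "convex_on U (\<lambda>x. - (k * x\<^sup>2))" by simp
      \<comment> \<open>Convexity at the midpoint of \<open>x0 - e/2\<close> and
        \<open>x0 + e/2\<close>, which reduces to \<open>k * (e/2)\<^sup>2 \<le> 0\<close>.\<close>
      have "- (k * ((1/2) *\<^sub>R (x0 - e/2) + (1/2) *\<^sub>R (x0 + e/2))\<^sup>2) \<le> (1/2) * (- (k * (x0 - e/2)\<^sup>2)) + (1/2) * (- (k * (x0 + e/2)\<^sup>2))"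
        using convex_onD[OF cv, of "1/2" "x0 - e/2" "x0 + e/2"] e(1) by (simp add: U_def)
      then have "k * (e/2)\<^sup>2 \<le> 0" by (simp add: power2_eq_square field_simps)
      then show False using k e(1) by (simp add: mult_le_0_iff)
    qed
  }
qed

lemma convex_on_phi: "0 \<le> a \<Longrightarrow> 0 \<le> l \<Longrightarrow> convex_on {0..1} (phi a l)"
  using phi_diff_convex_iff[of a 0 l 0] by (simp add: phi_def[of 0])

section \<open>Counting paths and their likelihood\<close>

definition jump_set :: "real \<Rightarrow> (real \<Rightarrow> real) \<Rightarrow> real set \<Rightarrow> bool" where
  "jump_set T u J \<longleftrightarrow> finite J \<and> J \<subseteq> {0<..T} \<and> (\<forall>t\<in>{0..T}. u t = card (J \<inter> {..t}))"

text \<open>The naturals are closed and their distinct points have distance at least 1. One-sided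
  limits of a counting path are thus attained on a whole one-sided neighbourhood.\<close>

lemma tendsto_Nats_eventually_const:
  fixes f :: "'a \<Rightarrow> real"
  assumes F: "F \<noteq> bot" and lim: "(f \<longlongrightarrow> l) F" and ev: "eventually (\<lambda>x. f x \<in> \<nat>) F"
  shows "l \<in> \<nat>" "eventually (\<lambda>x. f x = l) F"
proof -
  have closed: "closed (\<nat> :: real set)" by simp
  show l: "l \<in> \<nat>"
    by (rule Lim_in_closed_set[OF closed ev F lim])
  have "eventually (\<lambda>x. dist (f x) l < 1) F" using lim by (rule tendstoD) simp
  with ev show "eventually (\<lambda>x. f x = l) F"
  proof eventually_elim
    case (elim x)
    then obtain m n where "f x = real m" "l = real n" using l by (auto simp: Nats_def)
    then show ?case using elim by (simp add: dist_real_def)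
  qed
qed

text \<open>A continuation argument: let \<open>c\<close> be the supremum of the times up to which
  the path is described by finitely many unit jumps. The left limit at \<open>c\<close>, with a
  possible jump there, shows that \<open>c\<close> is itself such a time; right continuity would
  extend the description beyond \<open>c\<close> if \<open>c < T\<close>.\<close>

lemma count_path_jump_set:
  assumes T: "0 < T" and u: "u \<in> count_paths T"
  obtains J where "jump_set T u J"
proof -
  have uN: "u t \<in> \<nat>" if "t \<in> {0..T}" for t using u that by (auto simp: count_paths_def)
  have u0: "u 0 = 0" using u by (auto simp: count_paths_def)
  define S where "S = {t\<in>{0..T}. \<exists>J. finite J \<and> J \<subseteq> {0<..t} \<and> (\<forall>s\<in>{0..t}. u s = card (J \<inter> {..s}))}"
  have S0: "0 \<in> S" using T u0 by (auto simp: S_def intro!: exI[of _ "{}"])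
  have bdd: "bdd_above S" by (auto simp: S_def bdd_above_def)
  define c where "c = Sup S"
  have c: "0 \<le> c" "c \<le> T"
    using S0 bdd by (auto simp: c_def S_def intro!: cSup_upper cSup_least)
  have cS: "c \<in> S"
  proof (cases "c = 0")
    case False
    then have c0: "c \<in> {0<..T}" using c by auto
    then obtain l where l: "(u \<longlongrightarrow> l) (at_left c)" using u unfolding count_paths_def cadlag_on_def by blast
    then have uc: "u c = l \<or> u c = l + 1" using u c0 unfolding count_paths_def by blast
    have "eventually (\<lambda>x. x \<in> {0<..<c}) (at_left c)"
      using c0 by (intro eventually_at_leftI[of 0]) auto
    then have "eventually (\<lambda>x. u x \<in> \<nat>) (at_left c)"
      by eventually_elim (use c uN in auto)
    from tendsto_Nats_eventually_const(2)[OF _ l this]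
    have "eventually (\<lambda>x. u x = l) (at_left c)" by simp
    then obtain b where b: "b < c" "\<And>x. b < x \<Longrightarrow> x < c \<Longrightarrow> u x = l"
      by (auto simp: eventually_at_left_field)
    obtain t where t: "t \<in> S" "max b 0 < t"
      using less_cSupD[of S "max b 0"] S0 b(1) c0 by (auto simp: c_def[symmetric])
    have tc: "t \<le> c" using t bdd by (auto simp: c_def intro: cSup_upper)
    show ?thesis
    proof (cases "t = c")
      case False
      then have tc: "t < c" using tc by simp
      obtain J where J: "finite J" "J \<subseteq> {0<..t}" "\<And>s. s \<in> {0..t} \<Longrightarrow> u s = card (J \<inter> {..s})"
        using t by (auto simp: S_def)
      have "J \<inter> {..t} = J" using J by auto
      then have cardJ: "card J = l" using J(3)[of t] b(2)[of t] tc t by auto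
      have before: "u s = card (J \<inter> {..s})" if s: "0 \<le> s" "s < c" for s
      proof (cases "s \<le> t")
        case False
        then have "J \<inter> {..s} = J" using J by auto
        then show ?thesis using b(2)[of s] s False t cardJ by auto
      qed (use J s in auto)
      show ?thesis
      proof (cases "u c = l")
        case True
        have "J \<inter> {..c} = J" using J tc by auto
        then have "\<forall>s\<in>{0..c}. u s = card (J \<inter> {..s})" using before cardJ True by (auto simp: le_less)
        then show ?thesis using J tc c unfolding S_def by (fastforce intro!: exI[of _ J])
      next
        case False
        then have uc: "u c = l + 1" using uc by simp
        let ?J = "insert c J"
        have "?J \<inter> {..s} = J \<inter> {..s}" if "s < c" for s using that by auto
        moreover have "?J \<inter> {..c} = ?J" "c \<notin> J" using J tc by auto
        ultimately have "\<forall>s\<in>{0..c}. u s = card (?J \<inter> {..s})"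
          using before cardJ uc J(1) by (auto simp: le_less)
        then show ?thesis using J tc c c0 unfolding S_def by (fastforce intro!: exI[of _ ?J])
      qed
    qed (use t in simp)
  qed (use S0 in simp)
  have "c = T"
  proof (rule ccontr)
    assume "c \<noteq> T"
    then have cT: "c < T" using c by simp
    obtain J where J: "finite J" "J \<subseteq> {0<..c}" "\<And>s. s \<in> {0..c} \<Longrightarrow> u s = card (J \<inter> {..s})"
      using cS by (auto simp: S_def)
    have lim: "(u \<longlongrightarrow> u c) (at_right c)" using u c cT by (auto simp: count_paths_def cadlag_on_def)
    have "eventually (\<lambda>x. x \<in> {c<..<T}) (at_right c)"
      using cT by (intro eventually_at_rightI[of _ T]) auto
    then have "eventually (\<lambda>x. u x \<in> \<nat>) (at_right c)"
      by eventually_elim (use c uN in auto)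
    from tendsto_Nats_eventually_const(2)[OF _ lim this]
    have "eventually (\<lambda>x. u x = u c) (at_right c)" by simp
    then obtain b where b: "c < b" "\<And>x. c < x \<Longrightarrow> x < b \<Longrightarrow> u x = u c"
      by (auto simp: eventually_at_right_field)
    define t where "t = (c + min b T) / 2"
    have t: "c < t" "t < b" "t < T" using b(1) cT by (auto simp: t_def)
    have "u s = card (J \<inter> {..s})" if s: "s \<in> {0..t}" for s
    proof (cases "s \<le> c")
      case False
      then have "J \<inter> {..s} = J \<inter> {..c}" using J by auto
      then show ?thesis using b(2)[of s] False s t J(3)[of c] c by auto
    qed (use J s in auto)
    then have "t \<in> S" using J t c unfolding S_def by (fastforce intro!: exI[of _ J])
    then have "t \<le> c" using bdd by (auto simp: c_def intro: cSup_upper)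
    then show False using t by simp
  qed
  then obtain J where "finite J" "J \<subseteq> {0<..T}" "\<forall>s\<in>{0..T}. u s = card (J \<inter> {..s})"
    using cS by (auto simp: S_def)
  then show thesis by (intro that[of J]) (auto simp: jump_set_def)
qed

text \<open>The Stieltjes measure of the path is the counting measure on \<open>J\<close>: each jump
  time has mass 1, and the total mass \<open>card J\<close> leaves nothing for the rest of
  \<open>(0,T]\<close>.\<close>

lemma jump_set_interval_measure:
  assumes T: "0 < T" and J: "jump_set T u J"
  defines "\<mu> \<equiv> interval_measure (\<lambda>t. u (max 0 (min t T)))"
  shows "(\<integral>\<^sup>+t. f t \<partial>restrict_space \<mu> {0<..T}) = (\<Sum>s\<in>J. f s)"
proof -
  define F where "F = (\<lambda>t. u (max 0 (min t T)))"
  have fin: "finite J" and sub: "J \<subseteq> {0<..T}" using J by (auto simp: jump_set_def)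
  have F: "F t = card (J \<inter> {..t})" for t
  proof -
    have "J \<inter> {..max 0 (min t T)} = J \<inter> {..t}" using sub by (fastforce simp: le_max_iff_disj)
    moreover have "max 0 (min t T) \<in> {0..T}" using T by auto
    ultimately show ?thesis using J by (metis F_def jump_set_def)
  qed
  have mono: "F x \<le> F y" if "x \<le> y" for x y
    unfolding F using fin that by (auto intro!: card_mono)
  have rc: "continuous (at_right a) F" for a
  proof -
    obtain e where e: "e > 0" "\<And>x. dist x a < e \<Longrightarrow> x \<notin> J - {a}"
      using finite_set_avoid[OF fin, of a] by (auto simp: dist_commute not_le[symmetric])
    have "F x = F a" if "a < x" "x < a + e" for x
    proof -
      have "y \<notin> J" if "a < y" "y \<le> x" for y
        using e(2)[of y] that \<open>x < a + e\<close> by (auto simp: dist_real_def)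
      then have "y \<le> a" if "y \<in> J" "y \<le> x" for y using that by (meson not_le)
      then have "J \<inter> {..x} = J \<inter> {..a}" using that(1) by auto
      then show ?thesis by (simp add: F)
    qed
    then have "eventually (\<lambda>x. F x = F a) (at_right a)"
      using e(1) by (intro eventually_at_rightI[of _ "a + e"]) auto
    then show ?thesis by (simp add: continuous_within tendsto_eventually)
  qed
  have em: "emeasure \<mu> {a<..b} = ennreal (F b - F a)" if "a \<le> b" for a b
    unfolding \<mu>_def F_def[symmetric] by (rule emeasure_interval_measure_Ioc[OF that mono rc])
  have sets: "sets \<mu> = sets borel" and space: "space \<mu> = UNIV" by (simp_all add: \<mu>_def)
  have point: "emeasure \<mu> {s} = 1" if s: "s \<in> J" for s
  proof -
    obtain e where e: "e > 0" "\<And>x. dist x s < e \<Longrightarrow> x \<notin> J - {s}"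
      using finite_set_avoid[OF fin, of s] by (auto simp: dist_commute not_le[symmetric])
    \<comment> \<open>Intervals that shrink to \<open>{s}\<close>. The denominator starts at 2, so
      that each length is less than \<open>e\<close> and \<open>s\<close> is the only jump
      inside.\<close>
    define A where "A = (\<lambda>n::nat. {s - e / (Suc (Suc n)) <..s})"
    have F1: "F s - F (s - e / (Suc (Suc n))) = 1" for n
    proof -
      have "0 < e / real (Suc (Suc n))" using e(1) by (intro divide_pos_pos) simp_all
      moreover have "e * 1 < e * real (Suc (Suc n))" using e(1) by (intro mult_strict_left_mono) auto
      then have "e / real (Suc (Suc n)) < e" by (simp add: pos_divide_less_eq del: of_nat_Suc)
      ultimately have lt: "s - e / (Suc (Suc n)) < s" "s - e / (Suc (Suc n)) > s - e" by linarith+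
      have "y \<notin> J" if "s - e / (Suc (Suc n)) < y" "y < s" for y
        using e(2)[of y] that lt by (auto simp: dist_real_def)
      then have "y \<le> s - e / (Suc (Suc n))" if "y \<in> J" "y \<le> s" "y \<noteq> s" for y
        using that by (meson not_le order_less_le)
      then have "J \<inter> {..s} = insert s (J \<inter> {..s - e / (Suc (Suc n))})" using lt(1) s by auto
      moreover have "s \<notin> J \<inter> {..s - e / (Suc (Suc n))}" using lt by auto
      ultimately show ?thesis using fin by (simp add: F)
    qed
    have A1: "emeasure \<mu> (A n) = 1" for n
      unfolding A_def using e(1) F1[of n] by (subst em) simp_all
    have "(\<Inter>n. A n) = {s}"
    proof (intro equalityI subsetI)
      fix x assume x: "x \<in> (\<Inter>n. A n)"
      have "x \<ge> s - e / (Suc (Suc n))" for n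
      proof -
        have "x \<in> A n" using x by blast
        then show ?thesis by (simp add: A_def del: of_nat_Suc)
      qed
      moreover have "(\<lambda>n. s - e / (Suc (Suc n))) \<longlonglongrightarrow> s - 0"
        by (intro tendsto_diff tendsto_const) (rule LIMSEQ_Suc[OF LIMSEQ_Suc[OF lim_const_over_n]])
      ultimately have "s - 0 \<le> x" by (intro LIMSEQ_le_const2[of _ "s - 0" x]) auto
      moreover have "x \<in> A 0" using x by blast
      ultimately show "x \<in> {s}" by (simp add: A_def)
    next
      have "0 < e / real (Suc (Suc n))" for n using e(1) by (intro divide_pos_pos) simp_all
      then show "x \<in> (\<Inter>n. A n)" if "x \<in> {s}" for x using that by (simp add: A_def del: of_nat_Suc)
    qed
    moreover have "(\<lambda>n. emeasure \<mu> (A n)) \<longlonglongrightarrow> emeasure \<mu> (\<Inter>n. A n)"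
    proof (rule Lim_emeasure_decseq)
      show "decseq A" unfolding A_def decseq_def
      proof (intro allI impI subsetI)
        fix m n :: nat and x assume "m \<le> n" and x: "x \<in> {s - e / real (Suc (Suc n))<..s}"
        then have "e / real (Suc (Suc n)) \<le> e / real (Suc (Suc m))" using e by (intro divide_left_mono) auto
        then show "x \<in> {s - e / real (Suc (Suc m))<..s}" using x by auto
      qed
      show "range A \<subseteq> sets \<mu>" by (auto simp: sets A_def)
      show "emeasure \<mu> (A n) \<noteq> \<infinity>" for n by (simp add: A1)
    qed
    ultimately show ?thesis using A1 by (simp add: LIMSEQ_const_iff)
  qed
  have J_sets: "J \<in> sets \<mu>" using fin by (simp add: sets finite_imp_closed borel_closed)
  have emJ: "emeasure \<mu> J = card J"
    using fin point by (subst emeasure_eq_sum_singleton) (auto simp: sets)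
  have "J \<inter> {..T} = J" "J \<inter> {..0} = {}" using sub by auto
  then have emT: "emeasure \<mu> {0<..T} = card J"
    using em[of 0 T] T by (simp add: F ennreal_of_nat_eq_real_of_nat)
  have null: "emeasure \<mu> ({0<..T} - J) = 0"
    using sub J_sets by (subst emeasure_Diff) (auto simp: sets emJ emT)
  then have AE: "AE t in \<mu>. t \<in> {0<..T} \<longrightarrow> t \<in> J"
    using J_sets by (intro AE_I[of _ _ "{0<..T} - J"]) (auto simp: sets)
  have "(\<integral>\<^sup>+t. f t \<partial>restrict_space \<mu> {0<..T}) = (\<integral>\<^sup>+t. f t * indicator {0<..T} t \<partial>\<mu>)"
    by (subst nn_integral_restrict_space) (auto simp: sets)
  also have "\<dots> = (\<integral>\<^sup>+t. f t * indicator J t \<partial>\<mu>)"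
    using AE sub by (intro nn_integral_cong_AE) (auto elim!: eventually_mono split: split_indicator)
  also have "\<dots> = (\<Sum>s\<in>J. f s * emeasure \<mu> {s})"
    using fin by (intro nn_integral_indicator_finite) (auto simp: sets)
  also have "\<dots> = (\<Sum>s\<in>J. f s)" using point by simp
  finally show ?thesis .
qed

lemma e2ennreal_ext_log: "e2ennreal (ext_log r) = ennreal (if r = 0 then 0 else max 0 (ln r))"
  by (cases "0 \<le> ln r") (auto simp: ext_log_def max_def e2ennreal_ereal ennreal_neg e2ennreal_neg)

lemma e2ennreal_uminus_ext_log: "r \<noteq> 0 \<Longrightarrow> e2ennreal (- ext_log r) = ennreal (max 0 (- ln r))"
  by (cases "0 \<le> - ln r") (auto simp: ext_log_def max_def e2ennreal_ereal ennreal_neg)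

text \<open>With finitely many unit jumps, the exponential of the Stieltjes integral is a product of
  rates. If the rate is 0 at some jump, the negative part of the integral is infinite while the
  positive part stays finite, so the integral is \<open>-\<infinity>\<close>, its exponential is 0,
  and the product is 0 as well.\<close>

lemma likelihood_jump_set:
  assumes T: "0 < T" and J: "jump_set T u J" and lam: "\<And>t. t \<in> {0<..T} \<Longrightarrow> 0 \<le> a * x t + l"
  shows "likelihood T a l x u = ennreal (exp (LBINT t:{0<..T}. 1 - (a * x t + l)) * (\<Prod>s\<in>J. a * x s + l))"
proof -
  have fin: "finite J" and sub: "J \<subseteq> {0<..T}" using J by (auto simp: jump_set_def)
  define \<Lambda> where "\<Lambda> = (\<lambda>s. a * x s + l)"
  define c where "c = (LBINT t:{0<..T}. 1 - (a * x t + l))"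
  have st: "stieltjes T u (\<lambda>t. ext_log (a * x t + l)) =
      enn2ereal (\<Sum>s\<in>J. e2ennreal (ext_log (\<Lambda> s))) - enn2ereal (\<Sum>s\<in>J. e2ennreal (- ext_log (\<Lambda> s)))"
    unfolding stieltjes_def ext_integral_def jump_set_interval_measure[OF T J] \<Lambda>_def ..
  have pos: "(\<Sum>s\<in>J. e2ennreal (ext_log (\<Lambda> s))) = ennreal (\<Sum>s\<in>J. if \<Lambda> s = 0 then 0 else max 0 (ln (\<Lambda> s)))"
    unfolding e2ennreal_ext_log by simp
  show ?thesis
  proof (cases "\<exists>s\<in>J. \<Lambda> s = 0")
    case True
    then obtain s where s: "s \<in> J" "\<Lambda> s = 0" by auto
    have "e2ennreal (- ext_log (\<Lambda> s)) \<le> (\<Sum>s\<in>J. e2ennreal (- ext_log (\<Lambda> s)))"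
      using fin s by (intro member_le_sum) auto
    then have "(\<Sum>s\<in>J. e2ennreal (- ext_log (\<Lambda> s))) = \<infinity>"
      using s by (simp add: ext_log_def top_unique)
    then have "stieltjes T u (\<lambda>t. ext_log (a * x t + l)) = - \<infinity>"
      unfolding st pos by (simp add: enn2ereal_ennreal sum_nonneg)
    moreover have "(\<Prod>s\<in>J. a * x s + l) = 0" using True fin by (auto simp: \<Lambda>_def)
    ultimately show ?thesis by (simp add: likelihood_def ext_exp_def)
  next
    case False
    have L: "\<Lambda> s > 0" if "s \<in> J" for s using lam[of s] that sub False by (force simp: \<Lambda>_def)
    have p: "(\<Sum>s\<in>J. e2ennreal (ext_log (\<Lambda> s))) = ennreal (\<Sum>s\<in>J. max 0 (ln (\<Lambda> s)))"
      unfolding pos using False by (intro arg_cong[where f=ennreal] sum.cong) auto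
    have n: "(\<Sum>s\<in>J. e2ennreal (- ext_log (\<Lambda> s))) = ennreal (\<Sum>s\<in>J. max 0 (- ln (\<Lambda> s)))"
      using False by (subst sum_ennreal[symmetric]) (auto intro!: sum.cong simp: e2ennreal_uminus_ext_log)
    have "(\<Sum>s\<in>J. max 0 (ln (\<Lambda> s))) - (\<Sum>s\<in>J. max 0 (- ln (\<Lambda> s))) = (\<Sum>s\<in>J. ln (\<Lambda> s))"
      unfolding sum_subtractf[symmetric] by (intro sum.cong) auto
    then have "stieltjes T u (\<lambda>t. ext_log (a * x t + l)) = ereal (\<Sum>s\<in>J. ln (\<Lambda> s))"
      unfolding st p n by (simp add: enn2ereal_ennreal sum_nonneg)
    then have "likelihood T a l x u = ennreal (exp ((\<Sum>s\<in>J. ln (\<Lambda> s)) + c))"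
      by (simp add: likelihood_def ext_exp_def c_def)
    also have "exp ((\<Sum>s\<in>J. ln (\<Lambda> s)) + c) = exp c * (\<Prod>s\<in>J. \<Lambda> s)"
      using L fin by (simp add: exp_add exp_sum)
    finally show ?thesis by (simp add: c_def \<Lambda>_def)
  qed
qed

section \<open>Discretisation of the likelihood\<close>

definition grid :: "real \<Rightarrow> nat \<Rightarrow> nat \<Rightarrow> real" where
  "grid T n j = real j * (T / real n)"

definition active_slots :: "real \<Rightarrow> nat \<Rightarrow> (real \<Rightarrow> real) \<Rightarrow> nat set" where
  "active_slots T n u = {j \<in> {..<n}. u (grid T n (Suc j)) \<noteq> u (grid T n j)}"

text \<open>The input is sampled at right end points, which tend to a jump time from the right.\<close>

definition slot_prob :: "real \<Rightarrow> real \<Rightarrow> real \<Rightarrow> nat \<Rightarrow> (real \<Rightarrow> real) \<Rightarrow> nat \<Rightarrow> real" where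
  "slot_prob T a l n x j = (T / real n) * (a * x (grid T n (Suc j)) + l)"

text \<open>The exact probability of a count of the unit-rate process in a slot, whereas
  \<open>slot_prob\<close> is linearised in the slot length in order to be affine in the input.
  Keeping the reference exact makes the slot pattern of a reference path have a known product
  law.\<close>

abbreviation ref_prob :: "real \<Rightarrow> nat \<Rightarrow> real" where
  "ref_prob T n \<equiv> 1 - exp (- (T / real n))"

text \<open>The density of the law of the linearised slot pattern with respect to that of the
  reference pattern, evaluated at the pattern of \<open>u\<close>.\<close>

definition slot_density :: "real \<Rightarrow> real \<Rightarrow> real \<Rightarrow> nat \<Rightarrow> (real \<Rightarrow> real) \<Rightarrow> (real \<Rightarrow> real) \<Rightarrow> real" where
  "slot_density T a l n x u =
     bprod {..<n} (slot_prob T a l n x) (active_slots T n u) / bprod {..<n} (\<lambda>_. ref_prob T n) (active_slots T n u)"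

text \<open>The index of the slot that contains \<open>s\<close>. Slots are open on the left and
  closed on the right, hence the ceiling minus 1.\<close>

definition slot :: "real \<Rightarrow> nat \<Rightarrow> real \<Rightarrow> nat" where
  "slot T n s = nat (\<lceil>s / (T / real n)\<rceil> - 1)"

lemma grid_range:
  assumes "0 < T" "j \<le> n" "0 < n"
  shows "grid T n j \<in> {0..T}"
proof -
  have "real j * T \<le> real n * T" using assms by (intro mult_right_mono) auto
  then show ?thesis using assms by (simp add: grid_def field_simps)
qed

lemma grid_Suc: "grid T n (Suc j) = grid T n j + T / n"
  by (simp add: grid_def algebra_simps add_divide_distrib)

lemma grid_mono: "0 < T \<Longrightarrow> i \<le> j \<Longrightarrow> grid T n i \<le> grid T n j"
  unfolding grid_def by (intro mult_right_mono) auto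

lemma slot_unique:
  assumes T: "0 < T" and n: "0 < n" and s: "grid T n j < s" "s \<le> grid T n (Suc j)"
  shows "slot T n s = j"
proof -
  have D: "0 < T / n" using T n by simp
  have "real j < s / (T / n)" "s / (T / n) \<le> real (Suc j)"
    using s D unfolding grid_def by (simp_all only: pos_less_divide_eq pos_divide_le_eq)
  then have "\<lceil>s / (T / n)\<rceil> = int (Suc j)" by (intro ceiling_unique) auto
  then show ?thesis by (simp add: slot_def)
qed

lemma slot_props:
  assumes T: "0 < T" and n: "0 < n" and s: "s \<in> {0<..T}"
  shows "slot T n s < n" "grid T n (slot T n s) < s" "s \<le> grid T n (Suc (slot T n s))"
proof -
  have D: "0 < T / n" using T n by simp
  define c where "c = \<lceil>s / (T / n)\<rceil>"
  have c: "of_int c - 1 < s / (T / n)" "s / (T / n) \<le> of_int c" unfolding c_def by linarith+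
  have "0 < s / (T / n)" using s T n by (intro divide_pos_pos) auto
  then have c1: "1 \<le> c" unfolding c_def by linarith
  then have sl: "real (slot T n s) = of_int c - 1" unfolding slot_def c_def[symmetric] by (simp add: of_nat_nat)
  show 1: "grid T n (slot T n s) < s" unfolding grid_def sl using c(1) D by (simp only: pos_less_divide_eq)
  have "real (Suc (slot T n s)) = of_int c" using sl by simp
  then show "s \<le> grid T n (Suc (slot T n s))" unfolding grid_def using c(2) D by (simp only: pos_divide_le_eq)
  have "grid T n n = T" using n by (simp add: grid_def)
  then show "slot T n s < n" using 1 s grid_mono[OF T, of n "slot T n s" n] by force
qed

lemma active_slots_eq:
  assumes T: "0 < T" and n: "0 < n" and J: "jump_set T u J"
  shows "active_slots T n u = slot T n ` J"
proof -
  have fin: "finite J" and sub: "J \<subseteq> {0<..T}" and u: "\<And>t. t \<in> {0..T} \<Longrightarrow> u t = card (J \<inter> {..t})"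
    using J by (auto simp: jump_set_def)
  have "u (grid T n (Suc j)) \<noteq> u (grid T n j) \<longleftrightarrow> J \<inter> {grid T n j <.. grid T n (Suc j)} \<noteq> {}" if j: "j < n" for j
  proof -
    have le: "grid T n j \<le> grid T n (Suc j)" using grid_mono[OF T] by simp
    have "J \<inter> {..grid T n (Suc j)} = (J \<inter> {..grid T n j}) \<union> (J \<inter> {grid T n j <.. grid T n (Suc j)})"
      using le by auto
    then have "card (J \<inter> {..grid T n (Suc j)}) = card (J \<inter> {..grid T n j}) + card (J \<inter> {grid T n j <.. grid T n (Suc j)})"
      using fin by (subst card_Un_disjoint[symmetric]) auto
    moreover have "u (grid T n (Suc j)) = card (J \<inter> {..grid T n (Suc j)})" "u (grid T n j) = card (J \<inter> {..grid T n j})"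
      using j n by (intro u grid_range[OF T]; simp)+
    ultimately show ?thesis using fin by simp
  qed
  moreover have "J \<inter> {grid T n j <.. grid T n (Suc j)} \<noteq> {} \<longleftrightarrow> j \<in> slot T n ` J" for j
  proof
    assume "J \<inter> {grid T n j <.. grid T n (Suc j)} \<noteq> {}"
    then obtain s where "s \<in> J" "grid T n j < s" "s \<le> grid T n (Suc j)" by auto
    then show "j \<in> slot T n ` J" using slot_unique[OF T n, of j s] by blast
  next
    assume "j \<in> slot T n ` J"
    then obtain s where s: "s \<in> J" "j = slot T n s" by auto
    then have "s \<in> {0<..T}" using sub by blast
    then have "s \<in> J \<inter> {grid T n j <.. grid T n (Suc j)}" using slot_props(2,3)[OF T n] s by simp
    then show "J \<inter> {grid T n j <.. grid T n (Suc j)} \<noteq> {}" by blast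
  qed
  moreover have "slot T n ` J \<subseteq> {..<n}" using slot_props(1)[OF T n] sub by auto
  ultimately show ?thesis unfolding active_slots_def by blast
qed

text \<open>All from \<open>exp t \<ge> 1 + t\<close>. The quotient measures the discrepancy between
  the linearised and the exact probability; it tends to 1, and it is at most 2 as soon as the mesh
  is at most 1.\<close>

lemma ref_prob_bounds:
  assumes "0 < T" "0 < n"
  shows "0 < ref_prob T n" "ref_prob T n < 1" "1 \<le> (T / n) / ref_prob T n" "(T / n) / ref_prob T n \<le> 1 + T / n"
proof -
  define D where "D = T / n"
  have D: "0 < D" using assms by (simp add: D_def)
  show q: "0 < ref_prob T n" "ref_prob T n < 1" using D by (auto simp: D_def)
  have "1 - D \<le> exp (- D)" using exp_ge_add_one_self[of "- D"] by simp
  then show "1 \<le> (T / n) / ref_prob T n" using q unfolding D_def[symmetric] by (simp add: pos_le_divide_eq)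
  have "1 + D \<le> exp D" using exp_ge_add_one_self[of D] by simp
  then have "exp (- D) * (1 + D) \<le> exp (- D) * exp D" by (intro mult_left_mono) auto
  also have "\<dots> = 1" by (simp add: exp_minus)
  finally have "D \<le> (1 + D) * (1 - exp (- D))" by (simp add: algebra_simps)
  then show "(T / n) / ref_prob T n \<le> 1 + T / n" using q unfolding D_def[symmetric] by (simp add: pos_divide_le_eq)
qed

lemma input_path_range: "x \<in> input_paths T \<Longrightarrow> t \<in> {0..T} \<Longrightarrow> x t \<in> {0..1}"
  by (auto simp: input_paths_def)

lemma slot_prob_bounds:
  assumes "0 < T" "0 < n" "x \<in> input_paths T" "0 \<le> a" "0 \<le> l" "j < n"
  shows "0 \<le> slot_prob T a l n x j" "slot_prob T a l n x j \<le> (T / n) * (a + l)"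
proof -
  have "x (grid T n (Suc j)) \<in> {0..1}" using assms by (intro input_path_range[of x T] grid_range) auto
  then have x: "0 \<le> x (grid T n (Suc j))" "x (grid T n (Suc j)) \<le> 1" by auto
  show "0 \<le> slot_prob T a l n x j" using x assms by (simp add: slot_prob_def)
  have "a * x (grid T n (Suc j)) \<le> a" using x assms by (intro mult_left_le)
  then show "slot_prob T a l n x j \<le> (T / n) * (a + l)" unfolding slot_prob_def
    using assms by (intro mult_left_mono) auto
qed

lemma input_path_grid_tendsto:
  assumes T: "0 < T" and x: "x \<in> input_paths T" and s: "s \<in> {0<..T}"
  shows "(\<lambda>n. x (grid T n (Suc (slot T n s)))) \<longlonglongrightarrow> x s"
proof (cases "s = T")
  \<comment> \<open>At \<open>T\<close> there is no right limit to use, but \<open>T\<close> is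
    itself the last grid point.\<close>
  case True
  have "x (grid T n (Suc (slot T n s))) = x s" if "n \<ge> 1" for n
  proof -
    have "Suc (slot T n s) \<le> n" using slot_props(1)[OF T _ s, of n] that by simp
    then have "grid T n (Suc (slot T n s)) \<le> T" using grid_range[OF T, of _ n] that by auto
    then show ?thesis using slot_props(3)[OF T _ s, of n] that True by force
  qed
  then show ?thesis by (intro tendsto_eventually eventually_sequentiallyI[of 1]) auto
next
  case False
  then have sT: "0 < s" "s < T" using s by auto
  then have lim: "(x \<longlongrightarrow> x s) (at_right s)" using x unfolding input_paths_def cadlag_on_def by auto
  show ?thesis
  proof (rule tendstoI)
    fix e :: real assume e: "0 < e"
    obtain b where b: "b > s" "\<And>y. s < y \<Longrightarrow> y < b \<Longrightarrow> dist (x y) (x s) < e"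
      using tendstoD[OF lim e] by (auto simp: eventually_at_right_field)
    have "(\<lambda>n. T / real n) \<longlonglongrightarrow> 0" by (rule lim_const_over_n)
    then have "eventually (\<lambda>n. T / real n < b - s) sequentially"
      using b(1) by (intro order_tendstoD(2)) auto
    then show "\<forall>\<^sub>F n in sequentially. dist (x (grid T n (Suc (slot T n s)))) (x s) < e"
      using eventually_ge_at_top[of 1]
    proof eventually_elim
      case (elim n)
      then have n: "0 < n" by simp
      have "grid T n (Suc (slot T n s)) < b" using slot_props(2)[OF T n s] elim(1) grid_Suc[of T n "slot T n s"] by linarith
      moreover have "s \<le> grid T n (Suc (slot T n s))" by (rule slot_props(3)[OF T n s])
      ultimately show ?case using b(2)[of "grid T n (Suc (slot T n s))"] e by (cases "s = grid T n (Suc (slot T n s))") auto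
    qed
  qed
qed

text \<open>The sums are integrals of the step functions \<open>h n\<close> that sample the path at
  right end points. Right continuity gives pointwise convergence, and boundedness of the input gives
  dominated convergence.\<close>

lemma riemann_sum_tendsto:
  assumes T: "0 < T" and x: "x \<in> input_paths T" and nn: "0 \<le> a" "0 \<le> l"
  shows "(\<lambda>n. \<Sum>j<n. (T / n) - slot_prob T a l n x j) \<longlonglongrightarrow> (LBINT t:{0<..T}. 1 - (a * x t + l))"
proof -
  define c where "c = (\<lambda>n j. 1 - (a * x (grid T n (Suc j)) + l))"
  define h where "h = (\<lambda>n t. \<Sum>j<n. c n j * indicator {grid T n j <.. grid T n (Suc j)} t)"
  define f where "f = (\<lambda>t. indicator {0<..T} t * (1 - (a * x t + l)))"
  have cb: "\<bar>c n j\<bar> \<le> 1 + a + l" if "0 < n" "j < n" for n j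
  proof -
    have "x (grid T n (Suc j)) \<in> {0..1}" using that T by (intro input_path_range[OF x] grid_range) auto
    then have x': "0 \<le> x (grid T n (Suc j))" "x (grid T n (Suc j)) \<le> 1" by auto
    have "a * x (grid T n (Suc j)) \<le> a" "0 \<le> a * x (grid T n (Suc j))" using x' nn by (auto intro: mult_left_le)
    then show ?thesis unfolding c_def using nn by (simp add: abs_le_iff)
  qed
  have h_in: "h n t = c n (slot T n t)" if "0 < n" "t \<in> {0<..T}" for n t
  proof -
    have "t \<in> {grid T n j <.. grid T n (Suc j)} \<longleftrightarrow> j = slot T n t" for j
      using slot_unique[OF T that(1), of j t] slot_props(2,3)[OF T that] by force
    then have "c n j * indicator {grid T n j <.. grid T n (Suc j)} t = (if j = slot T n t then c n (slot T n t) else 0)" for j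
      by (simp add: indicator_def del: greaterThanAtMost_iff)
    then show ?thesis unfolding h_def using slot_props(1)[OF T that] by (simp add: sum.delta)
  qed
  have h_out: "h n t = 0" if "0 < n" "t \<notin> {0<..T}" for n t
  proof -
    have "t \<notin> {grid T n j <.. grid T n (Suc j)}" if "j < n" for j
      using grid_range[OF T, of j n] grid_range[OF T, of "Suc j" n] that \<open>t \<notin> {0<..T}\<close> by auto
    then show ?thesis unfolding h_def by (intro sum.neutral) auto
  qed
  have lim: "(\<lambda>n. h n t) \<longlonglongrightarrow> f t" for t
  proof (cases "t \<in> {0<..T}")
    case True
    have "(\<lambda>n. c n (slot T n t)) \<longlonglongrightarrow> 1 - (a * x t + l)"
      unfolding c_def by (intro tendsto_intros input_path_grid_tendsto[OF T x True])
    moreover have "eventually (\<lambda>n. c n (slot T n t) = h n t) sequentially"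
      using eventually_gt_at_top[of 0] by eventually_elim (simp add: h_in[OF _ True])
    ultimately show ?thesis using True by (simp add: f_def) (rule Lim_transform_eventually)
  next
    case False
    have "eventually (\<lambda>n. h n t = f t) sequentially"
      using eventually_gt_at_top[of 0] by eventually_elim (use h_out False in \<open>auto simp: f_def\<close>)
    then show ?thesis by (rule tendsto_eventually)
  qed
  have hm [measurable]: "h n \<in> borel_measurable lborel" for n unfolding h_def by measurable
  \<comment> \<open>The path enters only as a pointwise limit of step functions, which provides the
    measurability of the integrand.\<close>
  have fm: "f \<in> borel_measurable lborel" by (rule borel_measurable_LIMSEQ_real[OF lim hm])
  have hb: "norm (h (Suc n) t) \<le> (1 + a + l) * indicator {0<..T} t" for n t
    using cb[of "Suc n" "slot T (Suc n) t"] slot_props(1)[OF T, of "Suc n" t] h_in[of "Suc n" t] h_out[of "Suc n" t]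
    by (cases "t \<in> {0<..T}") auto
  have "(\<lambda>n. \<integral>t. h (Suc n) t \<partial>lborel) \<longlonglongrightarrow> (\<integral>t. f t \<partial>lborel)"
    using LIMSEQ_Suc[OF lim] hb
    by (intro integral_dominated_convergence[OF fm, where w="\<lambda>t. (1 + a + l) * indicator {0<..T} t"])
      (use T in \<open>auto intro!: integrable_mult_right integrable_real_indicator\<close>)
  moreover have "(\<integral>t. h (Suc n) t \<partial>lborel) = (\<Sum>j<Suc n. (T / Suc n) - slot_prob T a l (Suc n) x j)" for n
  proof -
    have "(\<integral>t. h (Suc n) t \<partial>lborel) = (\<Sum>j<Suc n. c (Suc n) j * (T / Suc n))"
      unfolding h_def using T grid_mono[OF T, of _ "Suc _" "Suc n"]
      by (subst Bochner_Integration.integral_sum) (auto simp: grid_Suc intro!: integrable_mult_right integrable_real_indicator)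
    then show ?thesis by (simp add: c_def slot_prob_def algebra_simps)
  qed
  ultimately have "(\<lambda>n. \<Sum>j<Suc n. (T / Suc n) - slot_prob T a l (Suc n) x j) \<longlonglongrightarrow> (\<integral>t. f t \<partial>lborel)" by simp
  then have "(\<lambda>n. \<Sum>j<n. (T / n) - slot_prob T a l n x j) \<longlonglongrightarrow> (\<integral>t. f t \<partial>lborel)" by (rule LIMSEQ_imp_Suc)
  then show ?thesis by (simp add: f_def set_lebesgue_integral_def)
qed

text \<open>Up to an \<open>O(n\<^sup>-\<^sup>2)\<close> error the logarithm of a factor is
  \<open>T/n - slot_prob\<close>, and these terms form the Riemann sums above. The \<open>n\<close>
  errors add up to \<open>O(1/n)\<close>.\<close>

lemma survival_product_tendsto:
  assumes T: "0 < T" and x: "x \<in> input_paths T" and nn: "0 \<le> a" "0 \<le> l"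
  shows "(\<lambda>n. \<Prod>j<n. (1 - slot_prob T a l n x j) / (1 - ref_prob T n)) \<longlonglongrightarrow> exp (LBINT t:{0<..T}. 1 - (a * x t + l))"
proof -
  let ?s = "\<lambda>n j. slot_prob T a l n x j"
  have D0: "(\<lambda>n. (T / real n) * (a + l)) \<longlonglongrightarrow> 0"
    using tendsto_mult_left_zero[OF lim_const_over_n] by blast
  \<comment> \<open>The quadratic lower bound for \<open>ln (1 - s)\<close> used below is available
    for \<open>s \<le> 1/2\<close>.\<close>
  have ev: "eventually (\<lambda>n. 0 < n \<and> (T / real n) * (a + l) < 1/2) sequentially"
    using order_tendstoD(2)[OF D0 half_gt_zero[OF zero_less_one]] eventually_gt_at_top[of 0] by eventually_elim auto
  have err: "(\<lambda>n. \<Sum>j<n. ln (1 - ?s n j) + ?s n j) \<longlonglongrightarrow> 0"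
  proof (rule Lim_null_comparison)
    show "eventually (\<lambda>n. norm (\<Sum>j<n. ln (1 - ?s n j) + ?s n j) \<le> 2 * T * (a + l) * ((T / real n) * (a + l))) sequentially"
      using ev
    proof eventually_elim
      case (elim n)
      have b: "\<bar>ln (1 - ?s n j) + ?s n j\<bar> \<le> 2 * ((T / real n) * (a + l))\<^sup>2" if "j < n" for j
      proof -
        have s: "0 \<le> ?s n j" "?s n j \<le> (T / real n) * (a + l)" using slot_prob_bounds[OF T _ x nn that] elim by auto
        have s': "?s n j \<le> 1/2" using s elim by linarith
        have "- ?s n j - 2 * (?s n j)\<^sup>2 \<le> ln (1 - ?s n j)" by (rule ln_one_minus_pos_lower_bound) (use s s' in auto)
        moreover have "ln (1 - ?s n j) \<le> - ?s n j" using ln_le_minus_one[of "1 - ?s n j"] s' by simp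
        moreover have "(?s n j)\<^sup>2 \<le> ((T / real n) * (a + l))\<^sup>2" using s by (intro power_mono)
        ultimately show ?thesis by linarith
      qed
      have "norm (\<Sum>j<n. ln (1 - ?s n j) + ?s n j) \<le> (\<Sum>j<n. 2 * ((T / real n) * (a + l))\<^sup>2)"
        using b by (intro order_trans[OF norm_sum] sum_mono) auto
      also have "\<dots> = 2 * T * (a + l) * ((T / real n) * (a + l))"
        using elim by (simp add: power2_eq_square field_simps)
      finally show ?case .
    qed
    have "(\<lambda>n. 2 * T * (a + l) * ((T / real n) * (a + l))) \<longlonglongrightarrow> 2 * T * (a + l) * (0 * (a + l))"
      by (intro tendsto_intros lim_const_over_n)
    then show "(\<lambda>n. 2 * T * (a + l) * ((T / real n) * (a + l))) \<longlonglongrightarrow> 0" by simp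
  qed
  have "(\<lambda>n. exp ((\<Sum>j<n. ln (1 - ?s n j) + ?s n j) + (\<Sum>j<n. (T / n) - ?s n j))) \<longlonglongrightarrow>
      exp (0 + (LBINT t:{0<..T}. 1 - (a * x t + l)))"
    by (intro tendsto_intros err riemann_sum_tendsto assms)
  moreover have "eventually (\<lambda>n. exp ((\<Sum>j<n. ln (1 - ?s n j) + ?s n j) + (\<Sum>j<n. (T / n) - ?s n j)) =
      (\<Prod>j<n. (1 - ?s n j) / (1 - ref_prob T n))) sequentially"
    using ev
  proof eventually_elim
    case (elim n)
    have "0 < 1 - ?s n j" if "j < n" for j
      using slot_prob_bounds(2)[OF T _ x nn that] elim by linarith
    then have "exp (ln (1 - ?s n j) + T / n) = (1 - ?s n j) / (1 - ref_prob T n)" if "j < n" for j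
      using that by (simp add: exp_add exp_minus divide_inverse)
    then have "(\<Prod>j<n. (1 - ?s n j) / (1 - ref_prob T n)) = exp (\<Sum>j<n. ln (1 - ?s n j) + T / n)"
      by (simp add: exp_sum)
    then show ?case by (simp add: sum.distrib[symmetric])
  qed
  ultimately show ?thesis by (simp add: Lim_transform_eventually)
qed

lemma slot_density_prod:
  "slot_density T a l n x u =
    (\<Prod>j<n. if j \<in> active_slots T n u then slot_prob T a l n x j / ref_prob T n
      else (1 - slot_prob T a l n x j) / (1 - ref_prob T n))"
  unfolding slot_density_def bprod_def prod_dividef[symmetric] by (intro prod.cong) auto

text \<open>The density is written as if every slot were empty, which gives the exponential in the
  limit, times one correction factor \<open>r n s\<close> for each jump \<open>s\<close>. In a
  correction factor the slot length cancels against \<open>ref_prob\<close> and the empty-slot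
  factors tend to 1, so the rate at \<open>s\<close> remains.\<close>

lemma slot_density_tendsto:
  assumes T: "0 < T" and x: "x \<in> input_paths T" and nn: "0 \<le> a" "0 \<le> l" and J: "jump_set T u J"
  shows "(\<lambda>n. slot_density T a l n x u) \<longlonglongrightarrow>
    exp (LBINT t:{0<..T}. 1 - (a * x t + l)) * (\<Prod>s\<in>J. a * x s + l)"
proof -
  have fin: "finite J" and sub: "J \<subseteq> {0<..T}" using J by (auto simp: jump_set_def)
  let ?s = "\<lambda>n j. slot_prob T a l n x j"
  define r where "r = (\<lambda>n s. (?s n (slot T n s) / ref_prob T n) / ((1 - ?s n (slot T n s)) / (1 - ref_prob T n)))"
  have D: "(\<lambda>n. T / real n) \<longlonglongrightarrow> 0" by (rule lim_const_over_n)
  have D0: "(\<lambda>n. (T / real n) * (a + l)) \<longlonglongrightarrow> 0" using tendsto_mult_left_zero[OF D] by simp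
  have Dq: "(\<lambda>n. (T / n) / ref_prob T n) \<longlonglongrightarrow> 1"
  proof (rule tendsto_sandwich)
    show "eventually (\<lambda>n. 1 \<le> (T / n) / ref_prob T n) sequentially"
      "eventually (\<lambda>n. (T / n) / ref_prob T n \<le> 1 + T / n) sequentially"
      using eventually_gt_at_top[of 0] by (eventually_elim, use ref_prob_bounds[OF T] in blast)+
    show "(\<lambda>n. 1 + T / real n) \<longlonglongrightarrow> 1" using tendsto_add[OF tendsto_const D, of 1] by simp
  qed simp
  have rlim: "(\<lambda>n. r n s) \<longlonglongrightarrow> a * x s + l" if s: "s \<in> J" for s
  proof -
    have s': "s \<in> {0<..T}" using s sub by auto
    have L: "(\<lambda>n. a * x (grid T n (Suc (slot T n s))) + l) \<longlonglongrightarrow> a * x s + l"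
      by (intro tendsto_intros input_path_grid_tendsto[OF T x s'])
    have S: "(\<lambda>n. ?s n (slot T n s)) \<longlonglongrightarrow> 0"
      unfolding slot_prob_def using tendsto_mult[OF D L] by simp
    have "(\<lambda>n. (((T / n) / ref_prob T n) * (a * x (grid T n (Suc (slot T n s))) + l)) / ((1 - ?s n (slot T n s)) / exp (- (T / n))))
        \<longlonglongrightarrow> (1 * (a * x s + l)) / ((1 - 0) / exp (- 0))"
      by (intro tendsto_intros L S D Dq) auto
    then show ?thesis by (simp add: r_def slot_prob_def)
  qed
  \<comment> \<open>A lower bound for the distance between jumps. Once the mesh is smaller,
    different jumps fall into different slots, and the product over active slots becomes a product
    over jumps.\<close>
  obtain d where d: "d > 0" "\<And>s s'. s \<in> J \<Longrightarrow> s' \<in> J \<Longrightarrow> s \<noteq> s' \<Longrightarrow> d \<le> \<bar>s - s'\<bar>"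
  proof (cases "{\<bar>s - s'\<bar> |s s'. s \<in> J \<and> s' \<in> J \<and> s \<noteq> s'} = {}")
    case True
    then show thesis by (intro that[of 1]) auto
  next
    case False
    let ?A = "{\<bar>s - s'\<bar> |s s'. s \<in> J \<and> s' \<in> J \<and> s \<noteq> s'}"
    have "?A \<subseteq> (\<lambda>(s, s'). \<bar>s - s'\<bar>) ` (J \<times> J)" by auto
    then have A: "finite ?A" by (rule finite_subset) (use fin in auto)
    have "Min ?A \<in> ?A" using A False by (rule Min_in)
    then have "Min ?A > 0" by auto
    moreover have "Min ?A \<le> \<bar>s - s'\<bar>" if "s \<in> J" "s' \<in> J" "s \<noteq> s'" for s s'
      using A that by (intro Min_le) auto
    ultimately show thesis by (rule that)
  qed
  have "eventually (\<lambda>n. 0 < n \<and> T / real n < d \<and> (T / real n) * (a + l) < 1) sequentially"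
    using order_tendstoD(2)[OF D d(1)] order_tendstoD(2)[OF D0 zero_less_one] eventually_gt_at_top[of 0]
    by eventually_elim auto
  then have "eventually (\<lambda>n. (\<Prod>j<n. (1 - ?s n j) / (1 - ref_prob T n)) * (\<Prod>s\<in>J. r n s) = slot_density T a l n x u) sequentially"
  proof eventually_elim
    case (elim n)
    then have n: "0 < n" by simp
    have inj: "inj_on (slot T n) J"
    proof (rule inj_onI, rule ccontr)
      fix s s' assume ss: "s \<in> J" "s' \<in> J" "slot T n s = slot T n s'" "s \<noteq> s'"
      then have "s \<in> {0<..T}" "s' \<in> {0<..T}" using sub by auto
      from slot_props(2,3)[OF T n this(1)] slot_props(2,3)[OF T n this(2)] have "\<bar>s - s'\<bar> < T / n"
        unfolding ss(3) grid_Suc by linarith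
      then show False using d(2)[OF ss(1,2,4)] elim by linarith
    qed
    have act: "active_slots T n u = slot T n ` J" by (rule active_slots_eq[OF T n J])
    have subn: "slot T n ` J \<subseteq> {..<n}" using act by (auto simp: active_slots_def)
    have ne: "1 - ?s n j \<noteq> 0" if "j < n" for j
      using slot_prob_bounds(2)[OF T n x nn that] elim by linarith
    let ?g = "\<lambda>j. (1 - ?s n j) / (1 - ref_prob T n)"
    let ?r = "\<lambda>j. (?s n j / ref_prob T n) / ?g j"
    have "slot_density T a l n x u = (\<Prod>j<n. ?g j * (if j \<in> slot T n ` J then ?r j else 1))"
      unfolding slot_density_prod act using ne by (intro prod.cong) auto
    also have "\<dots> = (\<Prod>j<n. ?g j) * (\<Prod>j<n. if j \<in> slot T n ` J then ?r j else 1)"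
      by (rule prod.distrib)
    also have "(\<Prod>j<n. if j \<in> slot T n ` J then ?r j else 1) = (\<Prod>j\<in>slot T n ` J. ?r j)"
      using subn by (subst prod.inter_restrict[symmetric]) (auto simp: Int_absorb1)
    also have "\<dots> = (\<Prod>s\<in>J. r n s)" unfolding r_def by (subst prod.reindex[OF inj]) simp
    finally show ?case by simp
  qed
  moreover have "(\<lambda>n. (\<Prod>j<n. (1 - ?s n j) / (1 - ref_prob T n)) * (\<Prod>s\<in>J. r n s)) \<longlonglongrightarrow>
      exp (LBINT t:{0<..T}. 1 - (a * x t + l)) * (\<Prod>s\<in>J. a * x s + l)"
    by (intro tendsto_mult survival_product_tendsto tendsto_prod rlim assms)
  ultimately show ?thesis by (rule Lim_transform_eventually[rotated])
qed

text \<open>An empty slot contributes at most \<open>exp (T / n)\<close>, an active one at most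
  \<open>2 * (a + l)\<close>, where 2 bounds \<open>(T / n) / ref_prob T n\<close>. The added 1
  makes the base at least 1, so that the number of active slots may be replaced by the number
  \<open>u T\<close> of jumps. The bound depends neither on \<open>n\<close> nor on the
  input.\<close>

lemma slot_density_bounds:
  assumes T: "0 < T" and n: "0 < n" "T / n \<le> 1" "(T / n) * (a + l) \<le> 1"
    and x: "x \<in> input_paths T" and nn: "0 \<le> a" "0 \<le> l" and J: "jump_set T u J"
  shows "0 \<le> slot_density T a l n x u" "slot_density T a l n x u \<le> exp T * (2 * (a + l) + 1) ^ nat \<lfloor>u T\<rfloor>"
proof -
  have fin: "finite J" and sub: "J \<subseteq> {0<..T}" and u: "\<And>t. t \<in> {0..T} \<Longrightarrow> u t = card (J \<inter> {..t})"
    using J by (auto simp: jump_set_def)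
  let ?s = "slot_prob T a l n x"
  have s: "0 \<le> ?s j" "?s j \<le> 1" "?s j \<le> (T / n) * (a + l)" if "j < n" for j
    using slot_prob_bounds[OF T n(1) x nn that] n(3) by linarith+
  note q = ref_prob_bounds[OF T n(1)]
  define K where "K = 2 * (a + l) + 1"
  have K: "1 \<le> K" using nn by (simp add: K_def)
  let ?f = "\<lambda>j. if j \<in> active_slots T n u then ?s j / ref_prob T n else (1 - ?s j) / (1 - ref_prob T n)"
  have f0: "0 \<le> ?f j" if "j < n" for j using s[OF that] q by auto
  show "0 \<le> slot_density T a l n x u" unfolding slot_density_prod using f0 by (intro prod_nonneg) auto
  have f1: "?f j \<le> exp (T / n) * (if j \<in> active_slots T n u then K else 1)" if "j < n" for j
  proof (cases "j \<in> active_slots T n u")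
    case True
    have "?s j / ref_prob T n \<le> ((T / n) * (a + l)) / ref_prob T n" using s[OF that] q by (intro divide_right_mono) auto
    also have "\<dots> = (T / n) / ref_prob T n * (a + l)" by simp
    also have "\<dots> \<le> 2 * (a + l)" using q(4) n(2) nn by (intro mult_right_mono) auto
    also have "\<dots> \<le> 1 * K" by (simp add: K_def)
    also have "\<dots> \<le> exp (T / n) * K" using K T n by (intro mult_right_mono) auto
    finally show ?thesis using True by simp
  next
    case False
    have "(1 - ?s j) / (1 - ref_prob T n) \<le> 1 / (1 - ref_prob T n)" using s[OF that] q by (intro divide_right_mono) auto
    also have "\<dots> = exp (T / n)" by (simp add: exp_minus divide_inverse)
    finally show ?thesis using False by simp
  qed
  have act: "active_slots T n u = slot T n ` J" by (rule active_slots_eq[OF T n(1) J])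
  have "slot_density T a l n x u \<le> (\<Prod>j<n. exp (T / n) * (if j \<in> active_slots T n u then K else 1))"
    unfolding slot_density_prod using f0 f1 by (intro prod_mono) auto
  also have "\<dots> = exp T * (\<Prod>j<n. if j \<in> active_slots T n u then K else 1)"
    using n by (simp add: prod.distrib exp_of_nat_mult[symmetric])
  also have "(\<Prod>j<n. if j \<in> active_slots T n u then K else 1) = K ^ card (active_slots T n u)"
    by (subst prod.inter_restrict[symmetric]) (auto simp: active_slots_def Int_def)
  also have "\<dots> \<le> K ^ card J" unfolding act using K fin by (intro power_increasing card_image_le) auto
  also have "card J = nat \<lfloor>u T\<rfloor>"
  proof -
    have "J \<inter> {..T} = J" using sub by auto
    then show ?thesis using u[of T] T by simp
  qed
  finally show "slot_density T a l n x u \<le> exp T * (2 * (a + l) + 1) ^ nat \<lfloor>u T\<rfloor>" by (simp add: K_def mult_left_mono)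
qed

section \<open>The path spaces and the reference law\<close>

lemma space_skorohod_borel [simp]: "space (skorohod_borel T D) = D"
  unfolding skorohod_borel_def by (rule space_measure_of) (auto simp: skorohod_open_def)

lemma skorohod_open_measurable: "skorohod_open T D U \<Longrightarrow> U \<in> sets (skorohod_borel T D)"
  unfolding skorohod_borel_def by (subst sets_measure_of) (auto simp: skorohod_open_def)

lemma time_changes_props:
  assumes "0 < T" "\<tau> \<in> time_changes T"
  shows "\<tau> T = T" "t \<in> {0..T} \<Longrightarrow> \<tau> t \<in> {0..T}"
proof -
  have im: "\<tau> ` {0..T} = {0..T}" and mono: "strict_mono_on {0..T} \<tau>" using assms by (auto simp: time_changes_def)
  show 1: "\<tau> t \<in> {0..T}" if "t \<in> {0..T}" for t using im that by blast
  have "T \<in> \<tau> ` {0..T}" using im assms by simp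
  then obtain t where t: "t \<in> {0..T}" "\<tau> t = T" by auto
  have "\<tau> t \<le> \<tau> T" using mono t assms by (intro monotone_onD[OF strict_mono_on_imp_mono_on[OF mono]]) auto
  then show "\<tau> T = T" using t 1[of T] assms by auto
qed

lemma input_eval_measurable:
  assumes T: "0 < T" and t: "t \<in> {0..T}"
  shows "(\<lambda>x. x t) \<in> borel_measurable (input_space T)"
proof (rule borel_measurableI_greater)
  fix c
  show "{x \<in> space (input_space T). c < x t} \<in> sets (input_space T)"
  proof (cases "t = T")
    \<comment> \<open>Time changes fix \<open>T\<close>, so evaluation at \<open>T\<close> is
      continuous and the set is open.\<close>
    case True
    have "skorohod_open T (input_paths T) {x \<in> input_paths T. c < x t}"
      unfolding skorohod_open_def
    proof (intro conjI ballI)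
      fix x assume "x \<in> {x \<in> input_paths T. c < x t}"
      then have x: "c < x T" using True by simp
      show "\<exists>e>0. \<forall>y\<in>input_paths T. (\<exists>\<tau>\<in>time_changes T. \<forall>t\<in>{0..T}. \<bar>\<tau> t - t\<bar> < e \<and> dist (x t) (y (\<tau> t)) < e) \<longrightarrow>
          y \<in> {x \<in> input_paths T. c < x t}"
      proof (intro exI[of _ "x T - c"] conjI ballI impI)
        fix y assume y: "y \<in> input_paths T" "\<exists>\<tau>\<in>time_changes T. \<forall>t\<in>{0..T}. \<bar>\<tau> t - t\<bar> < x T - c \<and> dist (x t) (y (\<tau> t)) < x T - c"
        then obtain \<tau> where \<tau>: "\<tau> \<in> time_changes T" "dist (x T) (y (\<tau> T)) < x T - c" using T by force
        then have "c < y T" using time_changes_props(1)[OF T \<tau>(1)] unfolding dist_real_def by auto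
        then show "y \<in> {x \<in> input_paths T. c < x t}" using y True by simp
      qed (use x in simp)
    qed auto
    then show ?thesis by (simp add: skorohod_open_measurable)
  next
    case False
    then have t: "0 \<le> t" "t < T" using t by auto
    \<comment> \<open>Evaluation at \<open>t\<close> is not Skorohod continuous, but exceeding \<open>c\<close> somewhere on an open interval
      is an open condition, and \<open>x t\<close> is the limit of suprema over intervals to the right of \<open>t\<close>.\<close>
    define U where "U = (\<lambda>b c. {x \<in> input_paths T. \<exists>s\<in>{t<..<b} \<inter> {0..T}. c < x s})"
    have "skorohod_open T (input_paths T) (U b c)" for b c
      unfolding skorohod_open_def
    proof (intro conjI ballI)
      fix x assume "x \<in> U b c"
      then obtain s where s: "t < s" "s < b" "s \<in> {0..T}" "c < x s" by (auto simp: U_def)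
      define e where "e = min (x s - c) (min (s - t) (b - s))"
      have e: "0 < e" "e \<le> x s - c" "e \<le> s - t" "e \<le> b - s" using s by (auto simp: e_def)
      show "\<exists>e>0. \<forall>y\<in>input_paths T. (\<exists>\<tau>\<in>time_changes T. \<forall>t\<in>{0..T}. \<bar>\<tau> t - t\<bar> < e \<and> dist (x t) (y (\<tau> t)) < e) \<longrightarrow>
          y \<in> U b c"
      proof (intro exI[of _ e] conjI ballI impI e(1))
        fix y assume y: "y \<in> input_paths T" "\<exists>\<tau>\<in>time_changes T. \<forall>t\<in>{0..T}. \<bar>\<tau> t - t\<bar> < e \<and> dist (x t) (y (\<tau> t)) < e"
        then obtain \<tau> where \<tau>: "\<tau> \<in> time_changes T" "\<bar>\<tau> s - s\<bar> < e" "dist (x s) (y (\<tau> s)) < e" using s by blast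
        have "\<tau> s \<in> {0..T}" by (rule time_changes_props(2)[OF T \<tau>(1) s(3)])
        moreover have "t < \<tau> s" "\<tau> s < b" using \<tau>(2) e by linarith+
        moreover have "c < y (\<tau> s)" using \<tau>(3) e(2) unfolding dist_real_def by linarith
        ultimately show "y \<in> U b c" using y(1) by (auto simp: U_def)
      qed
    qed (auto simp: U_def)
    then have U: "U b c \<in> sets (input_space T)" for b c by (rule skorohod_open_measurable)
    \<comment> \<open>The margin \<open>1 / Suc k\<close> keeps the inequality strict in the limit:
      values above \<open>c\<close> arbitrarily close to \<open>t\<close> would only show
      \<open>c \<le> x t\<close>.\<close>
    have "{x \<in> input_paths T. c < x t} = (\<Union>k. \<Inter>n. U (t + 1 / Suc n) (c + 1 / Suc k))"
    proof (intro equalityI subsetI)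
      fix x assume "x \<in> {x \<in> input_paths T. c < x t}"
      then have x: "x \<in> input_paths T" "0 < x t - c" by auto
      obtain k :: nat where "1 / Suc k < x t - c" using reals_Archimedean[OF x(2)] by (auto simp: inverse_eq_divide)
      then have k: "c + 1 / Suc k < x t" by simp
      have "(x \<longlongrightarrow> x t) (at_right t)" using x t unfolding input_paths_def cadlag_on_def by auto
      from order_tendstoD(1)[OF this k] obtain b where b: "b > t" "\<And>y. t < y \<Longrightarrow> y < b \<Longrightarrow> c + 1 / Suc k < x y"
        by (auto simp: eventually_at_right_field)
      have "x \<in> U (t + 1 / Suc n) (c + 1 / Suc k)" for n
      proof -
        define m where "m = min b (min T (t + 1 / Suc n))"
        have "t < m" using b t by (simp add: m_def)
        then obtain s where s: "t < s" "s < m" using dense by blast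
        then have "s < b" "s < T" "s < t + 1 / Suc n" by (auto simp: m_def)
        then show ?thesis unfolding U_def using s b(2)[of s] t x(1) by force
      qed
      then show "x \<in> (\<Union>k. \<Inter>n. U (t + 1 / Suc n) (c + 1 / Suc k))" by blast
    next
      fix x assume "x \<in> (\<Union>k. \<Inter>n. U (t + 1 / Suc n) (c + 1 / Suc k))"
      then obtain k where k: "\<And>n. x \<in> U (t + 1 / Suc n) (c + 1 / Suc k)" by blast
      then have x: "x \<in> input_paths T" by (auto simp: U_def)
      have "c < x t"
      proof (rule ccontr)
        assume "\<not> c < x t"
        moreover have "0 < 1 / real (Suc k)" by simp
        ultimately have lt: "x t < c + 1 / Suc k" by linarith
        have "(x \<longlongrightarrow> x t) (at_right t)" using x t unfolding input_paths_def cadlag_on_def by auto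
        from order_tendstoD(2)[OF this lt] obtain b where b: "b > t" "\<And>y. t < y \<Longrightarrow> y < b \<Longrightarrow> x y < c + 1 / Suc k"
          by (auto simp: eventually_at_right_field)
        obtain n :: nat where "1 / Suc n < b - t" using b(1) reals_Archimedean[of "b - t"] by (auto simp: inverse_eq_divide)
        moreover obtain s where "t < s" "s < t + 1 / Suc n" "c + 1 / Suc k < x s" using k[of n] by (auto simp: U_def)
        ultimately show False using b(2)[of s] by linarith
      qed
      then show "x \<in> {x \<in> input_paths T. c < x t}" using x by simp
    qed
    moreover have "(\<Union>k. \<Inter>n. U (t + 1 / Suc n) (c + 1 / Suc k)) \<in> sets (input_space T)"
      by (intro sets.countable_UN sets.countable_INT image_subsetI U) auto
    ultimately show ?thesis by simp
  qed
qed

section \<open>Limits and bounds of \<open>hent\<close>\<close>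

text \<open>On nonnegative weights \<open>hent\<close> equals the sum of \<open>v i ln (v i)\<close>
  minus \<open>V ln V\<close> for the total weight \<open>V\<close>. This form has no quotient and
  is continuous also where weights vanish.\<close>

lemma hent_tendsto:
  assumes I: "finite I" and lim: "\<And>i. i \<in> I \<Longrightarrow> (\<lambda>n. v n i) \<longlonglongrightarrow> w i"
    and nn: "\<And>n i. i \<in> I \<Longrightarrow> 0 \<le> v n i"
  shows "(\<lambda>n. hent I (v n)) \<longlonglongrightarrow> hent I w"
proof -
  have w: "0 \<le> w i" if "i \<in> I" for i using LIMSEQ_le_const[OF lim[OF that]] nn[OF that] by blast
  have *: "hent I u = (\<Sum>i\<in>I. u i * ln (u i)) - sum u I * ln (sum u I)" if u: "\<And>i. i \<in> I \<Longrightarrow> 0 \<le> u i" for u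
  proof -
    have "u i * ln (u i / sum u I) = u i * ln (u i) - u i * ln (sum u I)" if i: "i \<in> I" for i
    proof (cases "u i = 0")
      case False
      then have "0 < u i" using u[OF i] by simp
      moreover have "u i \<le> sum u I" using u i I by (intro member_le_sum) auto
      ultimately show ?thesis by (simp add: ln_div algebra_simps)
    qed simp
    then show ?thesis by (simp add: hent_def sum_subtractf sum_distrib_right)
  qed
  have \<theta>: "(\<lambda>n. f n * ln (f n)) \<longlonglongrightarrow> l * ln l" if "f \<longlonglongrightarrow> l" "\<And>n. 0 \<le> f n" "0 \<le> l" for f :: "nat \<Rightarrow> real" and l
    using continuous_on_tendsto_compose[OF continuous_on_mult_ln that(1)] that(2,3) by simp
  have sm: "(\<lambda>n. sum (v n) I) \<longlonglongrightarrow> sum w I" by (intro tendsto_sum lim)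
  have "(\<lambda>n. (\<Sum>i\<in>I. v n i * ln (v n i)) - sum (v n) I * ln (sum (v n) I)) \<longlonglongrightarrow>
      (\<Sum>i\<in>I. w i * ln (w i)) - sum w I * ln (sum w I)"
    by (intro tendsto_diff tendsto_sum \<theta> lim nn w sum_nonneg sm)
  then show ?thesis using *[OF w] *[OF nn] by simp
qed

text \<open>The lower bound is \<open>ln (g / f) \<le> g / f - 1\<close>. As it is linear in
  \<open>g\<close>, integrability of densities passes to their entropy terms.\<close>

lemma ln_ratio_bounds:
  fixes f g :: real
  assumes "0 \<le> f" "f \<le> g"
  shows "f * ln (f / g) \<le> 0" "- g \<le> f * ln (f / g)"
proof -
  have "f * ln (f / g) \<le> 0 \<and> - g \<le> f * ln (f / g)"
  proof (cases "f = 0")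
    case False
    then have f: "0 < f" "0 < g" using assms by auto
    have "ln (f / g) \<le> 0" using f assms by simp
    then have 1: "f * ln (f / g) \<le> 0" using f by (simp add: mult_nonneg_nonpos)
    have "ln (g / f) \<le> g / f - 1" using f by (intro ln_le_minus_one) simp
    then have "f * ln (g / f) \<le> f * (g / f - 1)" using f by (intro mult_left_mono) auto
    also have "\<dots> = g - f" using f by (simp add: field_simps)
    finally have "f * ln (g / f) \<le> g" using f by simp
    moreover have "ln (f / g) = - ln (g / f)" using f by (simp add: ln_div)
    ultimately show ?thesis using 1 by simp
  qed (use assms in auto)
  then show "f * ln (f / g) \<le> 0" "- g \<le> f * ln (f / g)" by auto
qed

lemma hent_bounds:
  fixes v :: "'i \<Rightarrow> real"
  assumes I: "finite I" and v: "\<And>i. i \<in> I \<Longrightarrow> 0 \<le> v i"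
  shows "hent I v \<le> 0" "- (card I * sum v I) \<le> hent I v"
proof -
  have b: "v i * ln (v i / sum v I) \<le> 0 \<and> - sum v I \<le> v i * ln (v i / sum v I)" if "i \<in> I" for i
    using ln_ratio_bounds[OF v[OF that] member_le_sum[of i I v]] v that I by auto
  show "hent I v \<le> 0" unfolding hent_def using b by (intro sum_nonpos) auto
  have "(\<Sum>i\<in>I. - sum v I) \<le> hent I v" unfolding hent_def using b by (intro sum_mono) auto
  then show "- (card I * sum v I) \<le> hent I v" by simp
qed

section \<open>The unit-rate Poisson law\<close>

locale poisson_reference =
  fixes T :: real and Q :: "(real \<Rightarrow> real) measure"
  assumes T: "0 < T" and Q: "unit_poisson_law T Q"
begin

sublocale prob_space Q using Q by (simp add: unit_poisson_law_def)

lemma space_Q [simp]: "space Q = count_paths T" and sets_Q: "sets Q = sets (output_space T)"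
  using Q by (auto simp: unit_poisson_law_def)

lemma jump_set_ex:
  assumes "u \<in> space Q"
  obtains J where "jump_set T u J"
  using count_path_jump_set[OF T] assms by auto

text \<open>Measurability is part of the independence of the increments in the definition of the
  law. The single increment over \<open>[0,t]\<close> is the evaluation at \<open>t\<close>, because
  paths start at 0.\<close>

lemma eval_measurable: "t \<in> {0..T} \<Longrightarrow> (\<lambda>u. u t) \<in> borel_measurable Q"
proof -
  assume t: "t \<in> {0..T}"
  have "\<forall>(n::nat) (t::nat \<Rightarrow> real). 0 \<le> t 0 \<and> (\<forall>i<n. t i \<le> t (Suc i)) \<and> t n \<le> T \<longrightarrow>
        indep_vars (\<lambda>_. borel) (\<lambda>i u. u (t (Suc i)) - u (t i)) {..<n}"
    using Q by (simp add: unit_poisson_law_def)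
  from this[rule_format, of "\<lambda>i. if i = 0 then 0 else t" 1] t
  have "(\<lambda>u. u t - u 0) \<in> borel_measurable Q" by (simp add: indep_vars_def2)
  moreover have "u t - u 0 = u t" if "u \<in> space Q" for u using that by (simp add: count_paths_def)
  ultimately show ?thesis using measurable_cong[of Q "\<lambda>u. u t - u 0" "\<lambda>u. u t"] by blast
qed

lemma increment_distr:
  "0 \<le> s \<Longrightarrow> s < t \<Longrightarrow> t \<le> T \<Longrightarrow> distr Q borel (\<lambda>u. u t - u s) = distr (measure_pmf (poisson_pmf (t - s))) borel real"
  using Q by (simp add: unit_poisson_law_def)

lemma prob_no_increment:
  assumes st: "0 \<le> s" "s < t" "t \<le> T"
  shows "prob {u \<in> space Q. u t - u s = 0} = exp (- (t - s))"
proof -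
  have [measurable]: "(\<lambda>u. u t) \<in> borel_measurable Q" "(\<lambda>u. u s) \<in> borel_measurable Q"
    using st by (auto intro!: eval_measurable)
  have "prob {u \<in> space Q. u t - u s = 0} = measure (distr Q borel (\<lambda>u. u t - u s)) {0}"
    by (subst measure_distr) (auto intro!: arg_cong[where f=prob])
  also have "\<dots> = measure (measure_pmf (poisson_pmf (t - s))) {0}"
    unfolding increment_distr[OF st] by (subst measure_distr) (auto intro!: arg_cong2[where f=measure])
  also have "\<dots> = exp (- (t - s))" using st by (simp add: measure_pmf_single)
  finally show ?thesis .
qed

lemma grid_in: "0 < n \<Longrightarrow> j \<le> n \<Longrightarrow> grid T n j \<in> {0..T}"
  using grid_range[OF T] by blast

lemma active_slots_prob:
  assumes n: "0 < n" and S: "S \<subseteq> {..<n}"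
  shows "{u \<in> space Q. active_slots T n u = S} \<in> sets Q"
    "prob {u \<in> space Q. active_slots T n u = S} = bprod {..<n} (\<lambda>_. ref_prob T n) S"
proof -
  define X where "X = (\<lambda>j u. u (grid T n (Suc j)) - u (grid T n j) :: real)"
  define A where "A = (\<lambda>j. if j \<in> S then - {0::real} else {0})"
  have [measurable]: "X j \<in> borel_measurable Q" if "j < n" for j
    unfolding X_def using that n by (intro borel_measurable_diff eval_measurable grid_in) auto
  have eq: "{u \<in> space Q. active_slots T n u = S} = (\<Inter>j\<in>{..<n}. X j -` A j \<inter> space Q)"
  proof -
    have "active_slots T n u = S \<longleftrightarrow> (\<forall>j<n. X j u \<in> A j)" for u
      unfolding active_slots_def X_def A_def using S by auto
    then show ?thesis using n by auto
  qed
  show "{u \<in> space Q. active_slots T n u = S} \<in> sets Q"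
    unfolding eq using n by (intro sets.finite_INT measurable_sets[where A=borel]) (auto simp: A_def)
  have ind: "indep_vars (\<lambda>_. borel) X {..<n}"
  proof -
    have "\<forall>(n::nat) (t::nat \<Rightarrow> real). 0 \<le> t 0 \<and> (\<forall>i<n. t i \<le> t (Suc i)) \<and> t n \<le> T \<longrightarrow>
          indep_vars (\<lambda>_. borel) (\<lambda>i u. u (t (Suc i)) - u (t i)) {..<n}"
      using Q by (simp add: unit_poisson_law_def)
    from this[rule_format, of "grid T n" n] show ?thesis
      unfolding X_def using grid_in[OF n, of 0] grid_in[OF n, of n] grid_mono[OF T] by simp
  qed
  have "prob (\<Inter>j\<in>{..<n}. X j -` A j \<inter> space Q) = (\<Prod>j<n. prob (X j -` A j \<inter> space Q))"
  proof (rule indep_setsD[where I="{..<n}"])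
    show "indep_sets (\<lambda>i. {X i -` A \<inter> space Q |A. A \<in> sets borel}) {..<n}"
      using ind unfolding indep_vars_def2 by simp
    have "A j \<in> sets borel" for j by (simp add: A_def)
    then show "\<forall>j\<in>{..<n}. X j -` A j \<inter> space Q \<in> {X j -` A \<inter> space Q |A. A \<in> sets borel}" by blast
  qed (use n in auto)
  also have "\<dots> = bprod {..<n} (\<lambda>_. ref_prob T n) S"
    unfolding bprod_def
  proof (intro prod.cong refl)
    fix j assume "j \<in> {..<n}"
    then have j: "j < n" by simp
    have g: "0 \<le> grid T n j" "grid T n j < grid T n (Suc j)" "grid T n (Suc j) \<le> T"
      using grid_in[OF n, of j] grid_in[OF n, of "Suc j"] j T n by (auto simp: grid_Suc)
    have z: "prob (X j -` {0} \<inter> space Q) = exp (- (T / n))"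
      using prob_no_increment[OF g] by (simp add: X_def vimage_def Int_def conj_commute grid_Suc)
    have "X j -` (- {0}) \<inter> space Q = space Q - (X j -` {0} \<inter> space Q)" by auto
    then have "prob (X j -` (- {0}) \<inter> space Q) = 1 - exp (- (T / n))"
      using j by (simp only: z[symmetric]) (rule prob_compl, measurable)
    then show "prob (X j -` A j \<inter> space Q) = (if j \<in> S then ref_prob T n else 1 - ref_prob T n)"
      using z by (simp add: A_def)
  qed
  finally show "prob {u \<in> space Q. active_slots T n u = S} = bprod {..<n} (\<lambda>_. ref_prob T n) S"
    unfolding eq .
qed

lemma integral_active_slots:
  fixes F :: "nat set \<Rightarrow> real"
  assumes n: "0 < n"
  shows "(\<integral>u. F (active_slots T n u) \<partial>Q) = (\<Sum>S\<in>Pow {..<n}. F S * bprod {..<n} (\<lambda>_. ref_prob T n) S)"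
    "(\<lambda>u. F (active_slots T n u)) \<in> borel_measurable Q"
proof -
  let ?B = "\<lambda>S. {u \<in> space Q. active_slots T n u = S}"
  have m: "?B S \<in> sets Q" if "S \<in> Pow {..<n}" for S using active_slots_prob(1)[OF n] that by blast
  have eq: "F (active_slots T n u) = (\<Sum>S\<in>Pow {..<n}. F S * indicator (?B S) u)" if "u \<in> space Q" for u
  proof -
    have "F S * indicator (?B S) u = (if S = active_slots T n u then F (active_slots T n u) else 0)" for S
      using that by (auto simp: indicator_def)
    moreover have "active_slots T n u \<in> Pow {..<n}" by (auto simp: active_slots_def)
    ultimately show ?thesis by (simp add: sum.delta)
  qed
  have "(\<integral>u. F (active_slots T n u) \<partial>Q) = (\<integral>u. (\<Sum>S\<in>Pow {..<n}. F S * indicator (?B S) u) \<partial>Q)"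
    by (rule Bochner_Integration.integral_cong[OF refl eq])
  also have "\<dots> = (\<Sum>S\<in>Pow {..<n}. \<integral>u. F S * indicator (?B S) u \<partial>Q)"
    using m by (intro Bochner_Integration.integral_sum integrable_mult_right integrable_real_indicator) (auto simp: emeasure_eq_measure)
  also have "\<dots> = (\<Sum>S\<in>Pow {..<n}. F S * bprod {..<n} (\<lambda>_. ref_prob T n) S)"
  proof (intro sum.cong refl)
    fix S assume S: "S \<in> Pow {..<n}"
    have "?B S \<inter> space Q = ?B S" by auto
    then have "(\<integral>u. F S * indicator (?B S) u \<partial>Q) = F S * prob (?B S)"
      using m[OF S] by (simp del: space_Q)
    then show "(\<integral>u. F S * indicator (?B S) u \<partial>Q) = F S * bprod {..<n} (\<lambda>_. ref_prob T n) S"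
      using active_slots_prob(2)[OF n, of S] S by simp
  qed
  finally show "(\<integral>u. F (active_slots T n u) \<partial>Q) = (\<Sum>S\<in>Pow {..<n}. F S * bprod {..<n} (\<lambda>_. ref_prob T n) S)" .
  have "(\<lambda>u. \<Sum>S\<in>Pow {..<n}. F S * indicator (?B S) u) \<in> borel_measurable Q"
    using m by (intro borel_measurable_sum borel_measurable_times borel_measurable_indicator) auto
  then show "(\<lambda>u. F (active_slots T n u)) \<in> borel_measurable Q"
    using measurable_cong[where M=Q and M'=borel and f="\<lambda>u. F (active_slots T n u)"
        and g="\<lambda>u. \<Sum>S\<in>Pow {..<n}. F S * indicator (?B S) u", OF eq] by blast
qed

text \<open>The generating function of the Poisson distribution: the weights turn the sum of
  \<open>K ^ k\<close> into an exponential series, finite for every \<open>K\<close>. This makes the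
  uniform bound on the slot densities an integrable majorant.\<close>

lemma integrable_power_count:
  assumes K: "0 \<le> K"
  shows "integrable Q (\<lambda>u. exp T * K ^ nat \<lfloor>u T\<rfloor>)"
proof -
  have [measurable]: "(\<lambda>u. u T) \<in> borel_measurable Q" "(\<lambda>u. u 0) \<in> borel_measurable Q"
    using T by (auto intro!: eval_measurable)
  have [measurable]: "(\<lambda>r::real. K ^ nat \<lfloor>r\<rfloor>) \<in> borel_measurable borel"
    using measurable_compose[OF measurable_real_floor, of "\<lambda>i. K ^ nat i" borel] by simp
  have "(\<lambda>k. pmf (poisson_pmf T) k * K ^ k) = (\<lambda>k. exp (- T) * ((T * K) ^ k /\<^sub>R fact k))"
    using T by (auto simp: fun_eq_iff power_mult_distrib divide_inverse)
  moreover have "summable (\<lambda>k. (T * K) ^ k /\<^sub>R fact k)" by (rule summable_exp_generic)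
  ultimately have "summable (\<lambda>k. pmf (poisson_pmf T) k * K ^ k)" by (simp add: summable_mult)
  then have "integrable (count_space UNIV) (\<lambda>k. pmf (poisson_pmf T) k * K ^ k)"
    unfolding integrable_count_space_nat_iff using K by simp
  then have "integrable (measure_pmf (poisson_pmf T)) (\<lambda>k. K ^ k)"
    unfolding measure_pmf_eq_density by (subst integrable_density) auto
  then have "integrable (measure_pmf (poisson_pmf T)) (\<lambda>k. K ^ nat \<lfloor>real k\<rfloor>)" by simp
  then have "integrable (distr (measure_pmf (poisson_pmf T)) borel real) (\<lambda>r. K ^ nat \<lfloor>r\<rfloor>)"
    by (subst integrable_distr_eq) auto
  then have "integrable (distr Q borel (\<lambda>u. u T - u 0)) (\<lambda>r. K ^ nat \<lfloor>r\<rfloor>)"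
    using increment_distr[of 0 T] T by simp
  then have "integrable Q (\<lambda>u. K ^ nat \<lfloor>u T - u 0\<rfloor>)"
    by (subst (asm) integrable_distr_eq) auto
  then have "integrable Q (\<lambda>u. K ^ nat \<lfloor>u T\<rfloor>)"
    by (subst Bochner_Integration.integrable_cong[OF refl, where g="\<lambda>u. K ^ nat \<lfloor>u T - u 0\<rfloor>"]) (auto simp: count_paths_def)
  then show ?thesis by (rule integrable_mult_right)
qed

end

section \<open>Outputs under a random input\<close>

text \<open>Minus the entropy of the label given the pattern of the linearised slots: the integral
  is the joint weight of label \<open>i\<close> and pattern \<open>S\<close>.\<close>

definition slot_ent :: "real \<Rightarrow> real \<Rightarrow> real \<Rightarrow> nat \<Rightarrow> 'i set \<Rightarrow> ('i \<Rightarrow> (real \<Rightarrow> real) measure) \<Rightarrow> real" where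
  "slot_ent T a l n I \<rho> = (\<Sum>S\<in>Pow {..<n}. hent I (\<lambda>i. \<integral>x. bprod {..<n} (slot_prob T a l n x) S \<partial>\<rho> i))"

text \<open>Finite measures instead of probability measures, since \<open>\<rho> i\<close> is the
  law of the input restricted to the event of label \<open>i\<close>; its mass is the probability of
  that label.\<close>

definition input_measure :: "real \<Rightarrow> (real \<Rightarrow> real) measure \<Rightarrow> bool" where
  "input_measure T \<rho> \<longleftrightarrow> finite_measure \<rho> \<and> sets \<rho> = sets (input_space T)"

lemma input_measure_space: "input_measure T \<rho> \<Longrightarrow> space \<rho> = input_paths T"
  unfolding input_measure_def using sets_eq_imp_space_eq space_skorohod_borel by blast

locale poisson_channel = poisson_reference +
  fixes a l :: real
  assumes a: "0 \<le> a" and l: "0 \<le> l"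
begin

definition path_lik :: "(real \<Rightarrow> real) \<Rightarrow> (real \<Rightarrow> real) \<Rightarrow> real" where
  "path_lik x u = enn2real (likelihood T a l x u)"

definition lik_bound :: "(real \<Rightarrow> real) \<Rightarrow> real" where
  "lik_bound u = exp T * (2 * (a + l) + 1) ^ nat \<lfloor>u T\<rfloor>"

definition mesh_ok :: "nat \<Rightarrow> bool" where
  "mesh_ok n \<longleftrightarrow> 0 < n \<and> T / n \<le> 1 \<and> (T / n) * (a + l) \<le> 1"

lemma eventually_mesh_ok: "eventually mesh_ok sequentially"
proof -
  have D: "(\<lambda>n. T / real n) \<longlonglongrightarrow> 0" by (rule lim_const_over_n)
  have D0: "(\<lambda>n. (T / real n) * (a + l)) \<longlonglongrightarrow> 0" using tendsto_mult_left_zero[OF D] by simp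
  show ?thesis
    using order_tendstoD(2)[OF D zero_less_one] order_tendstoD(2)[OF D0 zero_less_one] eventually_gt_at_top[of 0]
    by eventually_elim (auto simp: mesh_ok_def)
qed

text \<open>Everything is read off from a jump set of \<open>u\<close>; the upper bound is inherited
  from the slot densities in the limit.\<close>

lemma
  assumes x: "x \<in> input_paths T" and u: "u \<in> space Q"
  shows likelihood_eq: "likelihood T a l x u = ennreal (path_lik x u)"
    and path_lik_nonneg: "0 \<le> path_lik x u"
    and slot_density_tendsto_path_lik: "(\<lambda>n. slot_density T a l n x u) \<longlonglongrightarrow> path_lik x u"
    and path_lik_le: "path_lik x u \<le> lik_bound u"
proof -
  obtain J where J: "jump_set T u J" using jump_set_ex[OF u] .
  have lam: "0 \<le> a * x t + l" if "t \<in> {0<..T}" for t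
    using input_path_range[OF x, of t] that a l by auto
  let ?p = "exp (LBINT t:{0<..T}. 1 - (a * x t + l)) * (\<Prod>s\<in>J. a * x s + l)"
  have p0: "0 \<le> ?p" using lam J by (intro mult_nonneg_nonneg prod_nonneg) (auto simp: jump_set_def)
  have L: "likelihood T a l x u = ennreal ?p" by (rule likelihood_jump_set[OF T J lam])
  then have P: "path_lik x u = ?p" using p0 by (simp add: path_lik_def)
  show "likelihood T a l x u = ennreal (path_lik x u)" unfolding P by (rule L)
  show "0 \<le> path_lik x u" unfolding P by (rule p0)
  show lim: "(\<lambda>n. slot_density T a l n x u) \<longlonglongrightarrow> path_lik x u"
    unfolding P by (rule slot_density_tendsto[OF T x a l J])
  have "eventually (\<lambda>n. slot_density T a l n x u \<le> lik_bound u) sequentially"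
    using eventually_mesh_ok by eventually_elim
      (use slot_density_bounds(2)[OF T _ _ _ x a l J] in \<open>auto simp: mesh_ok_def lik_bound_def\<close>)
  then show "path_lik x u \<le> lik_bound u" by (intro tendsto_upperbound[OF lim]) auto
qed

lemma
  assumes n: "mesh_ok n" and x: "x \<in> input_paths T" and u: "u \<in> space Q"
  shows slot_density_nonneg: "0 \<le> slot_density T a l n x u"
    and slot_density_le: "slot_density T a l n x u \<le> lik_bound u"
proof -
  obtain J where J: "jump_set T u J" using jump_set_ex[OF u] .
  show "0 \<le> slot_density T a l n x u" "slot_density T a l n x u \<le> lik_bound u"
    using slot_density_bounds[OF T _ _ _ x a l J] n by (auto simp: mesh_ok_def lik_bound_def)
qed

lemma integrable_lik_bound: "integrable Q lik_bound"
  using integrable_power_count[of "2 * (a + l) + 1"] a l unfolding lik_bound_def[abs_def] by simp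

lemma lik_bound_nonneg: "0 \<le> lik_bound u"
  using a l by (simp add: lik_bound_def)

lemma slot_prob_measurable:
  assumes "0 < n" "j < n"
  shows "(\<lambda>x. slot_prob T a l n x j) \<in> borel_measurable (input_space T)"
  unfolding slot_prob_def using assms
  by (intro borel_measurable_times borel_measurable_add borel_measurable_const input_eval_measurable T grid_in) auto

lemma slot_density_measurable:
  assumes n: "0 < n"
  shows "(\<lambda>(x, u). slot_density T a l n x u) \<in> borel_measurable (input_space T \<Otimes>\<^sub>M Q)"
proof -
  have "(\<lambda>p. if j \<in> active_slots T n (snd p) then slot_prob T a l n (fst p) j / ref_prob T n
      else (1 - slot_prob T a l n (fst p) j) / (1 - ref_prob T n)) \<in> borel_measurable (input_space T \<Otimes>\<^sub>M Q)" if j: "j < n" for j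
  proof -
    have [measurable]: "(\<lambda>x. slot_prob T a l n x j) \<in> borel_measurable (input_space T)"
      by (rule slot_prob_measurable[OF n j])
    have [measurable]: "(\<lambda>u. u (grid T n (Suc j))) \<in> borel_measurable Q" "(\<lambda>u. u (grid T n j)) \<in> borel_measurable Q"
      using n j by (auto intro!: eval_measurable grid_in)
    show ?thesis unfolding active_slots_def using j by simp measurable
  qed
  then have "(\<lambda>p. slot_density T a l n (fst p) (snd p)) \<in> borel_measurable (input_space T \<Otimes>\<^sub>M Q)"
    unfolding slot_density_prod by (intro borel_measurable_prod) auto
  then show ?thesis by (simp add: case_prod_unfold)
qed

text \<open>Joint measurability is obtained from the discretisation: a slot density depends on the
  two paths through finitely many evaluations, each of which is measurable.\<close>

lemma path_lik_measurable: "(\<lambda>(x, u). path_lik x u) \<in> borel_measurable (input_space T \<Otimes>\<^sub>M Q)"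
proof (rule borel_measurable_LIMSEQ_real)
  show "(\<lambda>n. case p of (x, u) \<Rightarrow> slot_density T a l (Suc n) x u) \<longlonglongrightarrow> (case p of (x, u) \<Rightarrow> path_lik x u)"
    if "p \<in> space (input_space T \<Otimes>\<^sub>M Q)" for p
    using that LIMSEQ_Suc[OF slot_density_tendsto_path_lik] by (auto simp: space_pair_measure)
  show "(\<lambda>(x, u). slot_density T a l (Suc n) x u) \<in> borel_measurable (input_space T \<Otimes>\<^sub>M Q)" for n
    by (rule slot_density_measurable) simp
qed

lemma likelihood_measurable: "(\<lambda>(x, u). likelihood T a l x u) \<in> borel_measurable (input_space T \<Otimes>\<^sub>M Q)"
proof -
  have "(\<lambda>p. ennreal (case p of (x, u) \<Rightarrow> path_lik x u)) \<in> borel_measurable (input_space T \<Otimes>\<^sub>M Q)"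
    using path_lik_measurable by (rule measurable_compose[OF _ measurable_ennreal])
  moreover have "ennreal (case p of (x, u) \<Rightarrow> path_lik x u) = (case p of (x, u) \<Rightarrow> likelihood T a l x u)"
    if "p \<in> space (input_space T \<Otimes>\<^sub>M Q)" for p
    using that likelihood_eq by (auto simp: space_pair_measure)
  ultimately show ?thesis using measurable_cong[where M="input_space T \<Otimes>\<^sub>M Q" and M'=borel
      and f="\<lambda>p. ennreal (case p of (x, u) \<Rightarrow> path_lik x u)" and g="\<lambda>(x, u). likelihood T a l x u"] by blast
qed

lemma section_measurable:
  assumes x: "x \<in> input_paths T"
  shows "path_lik x \<in> borel_measurable Q" "0 < n \<Longrightarrow> slot_density T a l n x \<in> borel_measurable Q"
  using measurable_compose[OF measurable_Pair1'[of x "input_space T" Q] path_lik_measurable]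
    measurable_compose[OF measurable_Pair1'[of x "input_space T" Q] slot_density_measurable, of n] x by simp_all

lemma bprod_ref_pos: "0 < n \<Longrightarrow> 0 < bprod {..<n} (\<lambda>_. ref_prob T n) S"
  unfolding bprod_def using ref_prob_bounds[OF T, of n] by (intro prod_pos) auto

lemma integral_slot_density:
  assumes n: "0 < n"
  shows "(\<integral>u. slot_density T a l n x u \<partial>Q) = 1"
proof -
  have "(\<integral>u. slot_density T a l n x u \<partial>Q) = (\<Sum>S\<in>Pow {..<n}. bprod {..<n} (slot_prob T a l n x) S)"
    unfolding slot_density_def using integral_active_slots(1)[OF n, of "\<lambda>S. bprod {..<n} (slot_prob T a l n x) S / bprod {..<n} (\<lambda>_. ref_prob T n) S"]
      bprod_ref_pos[OF n] by (simp add: less_imp_neq[symmetric])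
  then show ?thesis by (simp add: sum_bprod)
qed

text \<open>Dominated convergence with the majorant \<open>c * lik_bound\<close>. The bound is
  available for fine meshes only, hence the shift of the sequences by \<open>N\<close> in the
  proof.\<close>

lemma dominated_Q:
  assumes lim: "\<And>u. u \<in> space Q \<Longrightarrow> (\<lambda>n. f n u) \<longlonglongrightarrow> g u"
    and meas: "\<And>n. 0 < n \<Longrightarrow> f n \<in> borel_measurable Q"
    and bound: "\<And>n u. mesh_ok n \<Longrightarrow> u \<in> space Q \<Longrightarrow> \<bar>f n u\<bar> \<le> c * lik_bound u"
  shows "integrable Q g" "(\<lambda>n. \<integral>u. f n u \<partial>Q) \<longlonglongrightarrow> (\<integral>u. g u \<partial>Q)"
proof -
  obtain N where N: "\<And>n. N \<le> n \<Longrightarrow> mesh_ok n" using eventually_mesh_ok by (auto simp: eventually_sequentially)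
  have N0: "0 < n + N" for n using N[of "n + N"] by (simp add: mesh_ok_def)
  have lim': "(\<lambda>n. f (n + N) u) \<longlonglongrightarrow> g u" if "u \<in> space Q" for u by (rule LIMSEQ_ignore_initial_segment[OF lim[OF that]])
  have m: "f (n + N) \<in> borel_measurable Q" for n by (rule meas[OF N0])
  have gm: "g \<in> borel_measurable Q" by (rule borel_measurable_LIMSEQ_real[OF lim' m])
  have w: "integrable Q (\<lambda>u. c * lik_bound u)" by (intro integrable_mult_right integrable_lik_bound)
  have AE1: "AE u in Q. (\<lambda>n. f (n + N) u) \<longlonglongrightarrow> g u" using lim' by (intro AE_I2) auto
  have AE2: "AE u in Q. norm (f (n + N) u) \<le> c * lik_bound u" for n using bound[OF N[of "n + N"]] by (intro AE_I2) auto
  show "integrable Q g" by (rule integrable_dominated_convergence[OF gm m w AE1 AE2])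
  show "(\<lambda>n. \<integral>u. f n u \<partial>Q) \<longlonglongrightarrow> (\<integral>u. g u \<partial>Q)"
    by (rule LIMSEQ_offset[where k=N]) (rule integral_dominated_convergence[OF gm m w AE1 AE2])
qed

text \<open>The slot densities are normalised because the probabilities of all slot patterns add up
  to 1; dominated convergence transfers this to the likelihood, so every fixed input yields an
  output probability law.\<close>

lemma
  assumes x: "x \<in> input_paths T"
  shows integrable_path_lik: "integrable Q (path_lik x)" and integral_path_lik: "(\<integral>u. path_lik x u \<partial>Q) = 1"
proof -
  note * = dominated_Q[where f="\<lambda>n. slot_density T a l n x" and g="path_lik x" and c=1,
      OF slot_density_tendsto_path_lik[OF x] section_measurable(2)[OF x]]
  have b: "\<bar>slot_density T a l n x u\<bar> \<le> 1 * lik_bound u" if "mesh_ok n" "u \<in> space Q" for n u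
    using slot_density_nonneg[OF that(1) x that(2)] slot_density_le[OF that(1) x that(2)] by simp
  show "integrable Q (path_lik x)" using * b by blast
  have "(\<lambda>n. \<integral>u. slot_density T a l n x u \<partial>Q) \<longlonglongrightarrow> (\<integral>u. path_lik x u \<partial>Q)" using * b by blast
  moreover have "(\<lambda>n. \<integral>u. slot_density T a l n x u \<partial>Q) \<longlonglongrightarrow> 1"
    by (rule tendsto_eventually, rule eventually_mono[OF eventually_gt_at_top[of 0]]) (simp add: integral_slot_density)
  ultimately show "(\<integral>u. path_lik x u \<partial>Q) = 1" by (rule LIMSEQ_unique)
qed

lemma nn_integral_likelihood:
  assumes x: "x \<in> input_paths T"
  shows "(\<integral>\<^sup>+u. likelihood T a l x u \<partial>Q) = 1"
proof -
  have "(\<integral>\<^sup>+u. likelihood T a l x u \<partial>Q) = (\<integral>\<^sup>+u. ennreal (path_lik x u) \<partial>Q)"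
    using likelihood_eq[OF x] by (intro nn_integral_cong) auto
  also have "\<dots> = ennreal 1"
    using path_lik_nonneg[OF x] by (subst nn_integral_eq_integral[OF integrable_path_lik[OF x]]) (auto simp: integral_path_lik[OF x])
  finally show ?thesis by simp
qed

section \<open>Output densities under a random input\<close>

definition out_density :: "(real \<Rightarrow> real) measure \<Rightarrow> (real \<Rightarrow> real) \<Rightarrow> real" where
  "out_density \<rho> u = (\<integral>x. path_lik x u \<partial>\<rho>)"

definition out_density_n :: "nat \<Rightarrow> (real \<Rightarrow> real) measure \<Rightarrow> (real \<Rightarrow> real) \<Rightarrow> real" where
  "out_density_n n \<rho> u = (\<integral>x. slot_density T a l n x u \<partial>\<rho>)"

context
  fixes \<rho> assumes \<rho>: "input_measure T \<rho>"
begin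

interpretation \<rho>: finite_measure \<rho> using \<rho> by (simp add: input_measure_def)

lemma sets_input: "sets \<rho> = sets (input_space T)" using \<rho> by (simp add: input_measure_def)

lemma space_input: "space \<rho> = input_paths T" by (rule input_measure_space[OF \<rho>])

lemma swap_measurable:
  assumes "(\<lambda>(x, u). f x u) \<in> borel_measurable (input_space T \<Otimes>\<^sub>M Q)"
  shows "(\<lambda>(x, u). f x u) \<in> borel_measurable (\<rho> \<Otimes>\<^sub>M Q)" "(\<lambda>(u, x). f x u) \<in> borel_measurable (Q \<Otimes>\<^sub>M \<rho>)"
proof -
  show 1: "(\<lambda>(x, u). f x u) \<in> borel_measurable (\<rho> \<Otimes>\<^sub>M Q)"
    using assms measurable_cong_sets[OF sets_pair_measure_cong[OF sets_input refl] refl] by blast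
  show "(\<lambda>(u, x). f x u) \<in> borel_measurable (Q \<Otimes>\<^sub>M \<rho>)"
    using measurable_compose[OF measurable_pair_swap' 1] by (simp add: case_prod_unfold)
qed

lemma out_density_measurable: "out_density \<rho> \<in> borel_measurable Q"
  unfolding out_density_def[abs_def]
  by (rule \<rho>.borel_measurable_lebesgue_integral[OF swap_measurable(2)[OF path_lik_measurable]])

lemma out_density_n_measurable: "0 < n \<Longrightarrow> out_density_n n \<rho> \<in> borel_measurable Q"
  unfolding out_density_n_def[abs_def]
  by (rule \<rho>.borel_measurable_lebesgue_integral[OF swap_measurable(2)[OF slot_density_measurable]])

lemma section_x_measurable:
  assumes "u \<in> space Q"
  shows "(\<lambda>x. path_lik x u) \<in> borel_measurable \<rho>" "0 < n \<Longrightarrow> (\<lambda>x. slot_density T a l n x u) \<in> borel_measurable \<rho>"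
  using measurable_compose[OF measurable_Pair1'[OF assms] swap_measurable(2)[OF path_lik_measurable]]
    measurable_compose[OF measurable_Pair1'[OF assms] swap_measurable(2)[OF slot_density_measurable], of n] by simp_all

lemma out_density_bounds:
  assumes u: "u \<in> space Q"
  shows "0 \<le> out_density \<rho> u" "mesh_ok n \<Longrightarrow> 0 \<le> out_density_n n \<rho> u"
    "mesh_ok n \<Longrightarrow> out_density_n n \<rho> u \<le> measure \<rho> (space \<rho>) * lik_bound u"
proof -
  show "0 \<le> out_density \<rho> u" unfolding out_density_def
    using path_lik_nonneg[OF _ u] space_input by (intro integral_nonneg_AE AE_I2) auto
  assume n: "mesh_ok n"
  then have n0: "0 < n" by (simp add: mesh_ok_def)
  show "0 \<le> out_density_n n \<rho> u" unfolding out_density_n_def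
    using slot_density_nonneg[OF n _ u] space_input by (intro integral_nonneg_AE AE_I2) auto
  have "out_density_n n \<rho> u \<le> (\<integral>x. lik_bound u \<partial>\<rho>)" unfolding out_density_n_def
  proof (rule integral_mono_AE)
    show "integrable \<rho> (\<lambda>x. slot_density T a l n x u)"
      using slot_density_le[OF n _ u] slot_density_nonneg[OF n _ u] space_input
      by (intro \<rho>.integrable_const_bound[where B="lik_bound u"] AE_I2 section_x_measurable[OF u] n0) auto
    show "AE x in \<rho>. slot_density T a l n x u \<le> lik_bound u"
      using slot_density_le[OF n _ u] space_input by (intro AE_I2) auto
  qed simp
  then show "out_density_n n \<rho> u \<le> measure \<rho> (space \<rho>) * lik_bound u" by simp
qed

lemma out_density_tendsto:
  assumes u: "u \<in> space Q"
  shows "(\<lambda>n. out_density_n n \<rho> u) \<longlonglongrightarrow> out_density \<rho> u"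
proof -
  obtain N where N: "\<And>n. N \<le> n \<Longrightarrow> mesh_ok n" using eventually_mesh_ok by (auto simp: eventually_sequentially)
  have N0: "0 < n + N" for n using N[of "n + N"] by (simp add: mesh_ok_def)
  show ?thesis
    unfolding out_density_n_def out_density_def
  proof (rule LIMSEQ_offset[where k=N], rule integral_dominated_convergence)
    show "(\<lambda>x. path_lik x u) \<in> borel_measurable \<rho>" by (rule section_x_measurable(1)[OF u])
    show "(\<lambda>x. slot_density T a l (n + N) x u) \<in> borel_measurable \<rho>" for n by (rule section_x_measurable(2)[OF u N0])
    show "integrable \<rho> (\<lambda>x. lik_bound u)" by simp
    show "AE x in \<rho>. (\<lambda>n. slot_density T a l (n + N) x u) \<longlonglongrightarrow> path_lik x u"
      using LIMSEQ_ignore_initial_segment[OF slot_density_tendsto_path_lik[OF _ u]] space_input by (intro AE_I2) auto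
    show "AE x in \<rho>. norm (slot_density T a l (n + N) x u) \<le> lik_bound u" for n
      using slot_density_le[OF N[of "n + N"] _ u] slot_density_nonneg[OF N[of "n + N"] _ u] space_input by (intro AE_I2) auto
  qed
qed

lemma integrable_out_density: "integrable Q (out_density \<rho>)"
  using out_density_bounds
  by (intro dominated_Q(1)[where f="\<lambda>n. out_density_n n \<rho>" and c="measure \<rho> (space \<rho>)"] out_density_tendsto out_density_n_measurable) auto

text \<open>Fubini's theorem for the nonnegative likelihood, followed by the passage to real
  integrals, which the bound \<open>lik_bound\<close> makes finite.\<close>

lemma emeasure_cell:
  assumes C: "C \<in> sets Q"
  shows "(\<integral>\<^sup>+x. \<integral>\<^sup>+u. likelihood T a l x u * indicator C u \<partial>Q \<partial>\<rho>) = ennreal (\<integral>u. out_density \<rho> u * indicator C u \<partial>Q)"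
proof -
  interpret P: pair_sigma_finite \<rho> Q ..
  have m: "(\<lambda>(x, u). likelihood T a l x u * indicator C u) \<in> borel_measurable (\<rho> \<Otimes>\<^sub>M Q)"
    using swap_measurable(1)[OF likelihood_measurable] C by (simp add: case_prod_unfold) measurable
  have "(\<integral>\<^sup>+x. \<integral>\<^sup>+u. likelihood T a l x u * indicator C u \<partial>Q \<partial>\<rho>) = (\<integral>\<^sup>+u. \<integral>\<^sup>+x. likelihood T a l x u * indicator C u \<partial>\<rho> \<partial>Q)"
    by (rule P.Fubini'[OF m, symmetric])
  also have "\<dots> = (\<integral>\<^sup>+u. ennreal (out_density \<rho> u * indicator C u) \<partial>Q)"
  proof (rule nn_integral_cong)
    fix u assume u: "u \<in> space Q"
    have int: "integrable \<rho> (\<lambda>x. path_lik x u)"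
      using path_lik_le[OF _ u] path_lik_nonneg[OF _ u] space_input
      by (intro \<rho>.integrable_const_bound[where B="lik_bound u"] AE_I2 section_x_measurable[OF u]) auto
    have "(\<integral>\<^sup>+x. likelihood T a l x u * indicator C u \<partial>\<rho>) = (\<integral>\<^sup>+x. ennreal (path_lik x u) * indicator C u \<partial>\<rho>)"
      using likelihood_eq[OF _ u] space_input by (intro nn_integral_cong) auto
    also have "\<dots> = (\<integral>\<^sup>+x. ennreal (path_lik x u) \<partial>\<rho>) * indicator C u"
      using section_x_measurable(1)[OF u] by (intro nn_integral_multc) auto
    also have "(\<integral>\<^sup>+x. ennreal (path_lik x u) \<partial>\<rho>) = ennreal (out_density \<rho> u)"
      unfolding out_density_def using path_lik_nonneg[OF _ u] space_input by (intro nn_integral_eq_integral int AE_I2) auto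
    finally show "(\<integral>\<^sup>+x. likelihood T a l x u * indicator C u \<partial>\<rho>) = ennreal (out_density \<rho> u * indicator C u)"
      by (simp add: indicator_def)
  qed
  also have "\<dots> = ennreal (\<integral>u. out_density \<rho> u * indicator C u \<partial>Q)"
    using out_density_bounds(1) C
    by (intro nn_integral_eq_integral integrable_real_mult_indicator integrable_out_density AE_I2) (auto simp: indicator_def)
  finally show ?thesis .
qed

lemma integral_out_density: "(\<integral>u. out_density \<rho> u \<partial>Q) = measure \<rho> (space \<rho>)"
proof -
  have "ennreal (\<integral>u. out_density \<rho> u * indicator (space Q) u \<partial>Q) = (\<integral>\<^sup>+x. \<integral>\<^sup>+u. likelihood T a l x u * indicator (space Q) u \<partial>Q \<partial>\<rho>)"
    by (rule emeasure_cell[symmetric]) (rule sets.top)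
  also have "\<dots> = (\<integral>\<^sup>+x. \<integral>\<^sup>+u. likelihood T a l x u \<partial>Q \<partial>\<rho>)"
    by (intro nn_integral_cong) auto
  also have "\<dots> = (\<integral>\<^sup>+x. 1 \<partial>\<rho>)" using space_input by (intro nn_integral_cong) (auto simp: nn_integral_likelihood)
  also have "\<dots> = ennreal (measure \<rho> (space \<rho>))" by (simp add: \<rho>.emeasure_eq_measure)
  finally have "(\<integral>u. out_density \<rho> u * indicator (space Q) u \<partial>Q) = measure \<rho> (space \<rho>)"
    using out_density_bounds(1) by (subst (asm) ennreal_inj) (auto intro!: integral_nonneg_AE AE_I2)
  moreover have "(\<integral>u. out_density \<rho> u * indicator (space Q) u \<partial>Q) = (\<integral>u. out_density \<rho> u \<partial>Q)"
    by (intro Bochner_Integration.integral_cong) auto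
  ultimately show ?thesis by simp
qed

end

text \<open>Minus the entropy of the label given the whole output path, as an integral of posterior
  entropies over the reference law.\<close>

definition cond_ent :: "'i set \<Rightarrow> ('i \<Rightarrow> (real \<Rightarrow> real) measure) \<Rightarrow> real" where
  "cond_ent I \<rho> = (\<integral>u. hent I (\<lambda>i. out_density (\<rho> i) u) \<partial>Q)"

lemma hent_measurable:
  assumes "finite I" "\<And>i. i \<in> I \<Longrightarrow> (\<lambda>x. f x i) \<in> borel_measurable M"
  shows "(\<lambda>x. hent I (f x)) \<in> borel_measurable M"
  unfolding hent_def using assms
  by (intro borel_measurable_sum borel_measurable_times borel_measurable_ln borel_measurable_divide borel_measurable_sum) auto

text \<open>On a fixed slot pattern the discretised output density is the joint weight divided by
  the reference weight of the pattern. By homogeneity of \<open>hent\<close> the reference weight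
  cancels upon integration, so the integral is exactly \<open>slot_ent\<close>; the densities
  converge under the integrable majorant.\<close>

lemma
  assumes I: "finite I" and \<rho>: "\<And>i. i \<in> I \<Longrightarrow> input_measure T (\<rho> i)"
  shows slot_ent_tendsto: "(\<lambda>n. slot_ent T a l n I \<rho>) \<longlonglongrightarrow> cond_ent I \<rho>"
    and integrable_hent: "integrable Q (\<lambda>u. hent I (\<lambda>i. out_density (\<rho> i) u))"
proof -
  define M where "M = (\<Sum>i\<in>I. measure (\<rho> i) (space (\<rho> i)))"
  let ?f = "\<lambda>n u. hent I (\<lambda>i. out_density_n n (\<rho> i) u)"
  have lim: "(\<lambda>n. ?f n u) \<longlonglongrightarrow> hent I (\<lambda>i. out_density (\<rho> i) u)" if u: "u \<in> space Q" for u
  proof -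
    obtain N where N: "\<And>n. N \<le> n \<Longrightarrow> mesh_ok n" using eventually_mesh_ok by (auto simp: eventually_sequentially)
    show ?thesis
      by (rule LIMSEQ_offset[where k=N], rule hent_tendsto[OF I])
        (use out_density_tendsto[OF \<rho> u] out_density_bounds(2)[OF \<rho> u] N in \<open>auto intro: LIMSEQ_ignore_initial_segment\<close>)
  qed
  have meas: "?f n \<in> borel_measurable Q" if "0 < n" for n
    using that by (intro hent_measurable I out_density_n_measurable \<rho>)
  have bound: "\<bar>?f n u\<bar> \<le> (card I * M) * lik_bound u" if n: "mesh_ok n" and u: "u \<in> space Q" for n u
  proof -
    have "(\<Sum>i\<in>I. out_density_n n (\<rho> i) u) \<le> M * lik_bound u"
      unfolding M_def sum_distrib_right by (intro sum_mono out_density_bounds(3) \<rho> u n)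
    then have "card I * (\<Sum>i\<in>I. out_density_n n (\<rho> i) u) \<le> card I * (M * lik_bound u)" by (intro mult_left_mono) auto
    then show ?thesis
      using hent_bounds[OF I, of "\<lambda>i. out_density_n n (\<rho> i) u"] out_density_bounds(2)[OF \<rho> u n]
      by (simp add: mult.assoc abs_le_iff)
  qed
  note * = dominated_Q[where f="?f" and g="\<lambda>u. hent I (\<lambda>i. out_density (\<rho> i) u)", OF lim meas bound]
  show "integrable Q (\<lambda>u. hent I (\<lambda>i. out_density (\<rho> i) u))" by (rule *(1))
  have "(\<integral>u. ?f n u \<partial>Q) = slot_ent T a l n I \<rho>" if n: "0 < n" for n
  proof -
    let ?q = "bprod {..<n} (\<lambda>_. ref_prob T n)"
    let ?F = "\<lambda>S. hent I (\<lambda>i. (1 / ?q S) * (\<integral>x. bprod {..<n} (slot_prob T a l n x) S \<partial>\<rho> i))"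
    have "(\<integral>u. ?f n u \<partial>Q) = (\<integral>u. ?F (active_slots T n u) \<partial>Q)"
      by (simp add: out_density_n_def slot_density_def)
    also have "\<dots> = (\<Sum>S\<in>Pow {..<n}. ?F S * ?q S)" by (rule integral_active_slots(1)[OF n])
    also have "\<dots> = slot_ent T a l n I \<rho>"
      unfolding slot_ent_def using bprod_ref_pos[OF n]
      by (intro sum.cong refl) (subst hent_scale, auto simp: less_imp_le less_imp_neq[symmetric])
    finally show ?thesis .
  qed
  then have "eventually (\<lambda>n. (\<integral>u. ?f n u \<partial>Q) = slot_ent T a l n I \<rho>) sequentially"
    by (rule eventually_mono[OF eventually_gt_at_top[of 0]])
  with *(2) show "(\<lambda>n. slot_ent T a l n I \<rho>) \<longlonglongrightarrow> cond_ent I \<rho>"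
    unfolding cond_ent_def by (rule Lim_transform_eventually)
qed

end

text \<open>For each mesh the hybrid argument loses at most \<open>n\<close> times a term of order
  \<open>n\<^sup>-\<^sup>2\<close>, that is \<open>(T / n) * (T * C)\<close>, and this vanishes in
  the limit.\<close>

lemma cond_ent_mono:
  assumes y: "poisson_channel T Qy ay ly" and z: "poisson_channel T Qz az lz"
    and I: "finite I" and \<rho>: "\<And>i. i \<in> I \<Longrightarrow> input_measure T (\<rho> i)"
    and cvx: "convex_on {0..1} (\<lambda>x. phi ay ly x - phi az lz x)"
  shows "poisson_channel.cond_ent T Qz az lz I \<rho> \<le> poisson_channel.cond_ent T Qy ay ly I \<rho>"
proof -
  interpret y: poisson_channel T Qy ay ly by (rule y)
  interpret z: poisson_channel T Qz az lz by (rule z)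
  define C where "C = ((ay + ly)\<^sup>2 + (az + lz)\<^sup>2) * (\<Sum>i\<in>I. measure (\<rho> i) (space (\<rho> i)))"
  have ev: "eventually (\<lambda>n. slot_ent T az lz n I \<rho> \<le> slot_ent T ay ly n I \<rho> + (T / real n) * (T * C)) sequentially"
    using y.eventually_mesh_ok z.eventually_mesh_ok
  proof eventually_elim
    case (elim n)
    then have n: "0 < n" by (simp add: y.mesh_ok_def)
    have "T / real n > 0" using n y.T by simp
    have g: "grid T n (Suc j) \<in> {0..T}" if "j < n" for j using n that by (intro y.grid_in) auto
    \<comment> \<open>The value 0 beyond the last slot keeps \<open>X j\<close> measurable and
      within \<open>[0,1]\<close> for every index \<open>j\<close>.\<close>
    define X where "X = (\<lambda>j x. if j < n then x (grid T n (Suc j)) else 0 :: real)"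
    have X: "X j \<in> borel_measurable (\<rho> i)" if "i \<in> I" for i j
    proof -
      have "X j \<in> borel_measurable (input_space T)"
        unfolding X_def using input_eval_measurable[OF y.T g] by (cases "j < n") auto
      moreover have "sets (\<rho> i) = sets (input_space T)" using \<rho>[OF that] by (simp add: input_measure_def)
      ultimately show ?thesis using measurable_cong_sets[of "\<rho> i" "input_space T" borel borel] by blast
    qed
    have Xr: "X j x \<in> {0..1}" if "i \<in> I" "x \<in> space (\<rho> i)" for i j x
      using input_path_range[OF _ g] that input_measure_space[OF \<rho>] by (auto simp: X_def)
    have eq: "bprod {..<n} (\<lambda>j. (T / n) * (a * X j x + l)) S = bprod {..<n} (slot_prob T a l n x) S" for a l x S
      by (intro bprod_cong) (simp add: X_def slot_prob_def)
    have "slot_ent T az lz n I \<rho> \<le> slot_ent T ay ly n I \<rho> +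
      n * ((T / n)\<^sup>2 * ((ay + ly)\<^sup>2 + (az + lz)\<^sup>2) * (\<Sum>i\<in>I. measure (\<rho> i) (space (\<rho> i))))"
      unfolding slot_ent_def eq[symmetric]
      by (rule sum_hent_hybrid[OF I _ X Xr y.a y.l _ z.a z.l _ \<open>T / real n > 0\<close> cvx])
        (use elim \<rho> in \<open>auto simp: y.mesh_ok_def z.mesh_ok_def input_measure_def\<close>)
    also have "n * ((T / n)\<^sup>2 * ((ay + ly)\<^sup>2 + (az + lz)\<^sup>2) * (\<Sum>i\<in>I. measure (\<rho> i) (space (\<rho> i)))) = (T / real n) * (T * C)"
      using n by (simp add: C_def power2_eq_square)
    finally show ?case .
  qed
  have "(\<lambda>n. slot_ent T ay ly n I \<rho> + (T / real n) * (T * C)) \<longlonglongrightarrow> y.cond_ent I \<rho> + 0 * (T * C)"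
    by (intro tendsto_intros y.slot_ent_tendsto[OF I \<rho>] lim_const_over_n)
  from tendsto_le[OF _ this z.slot_ent_tendsto[OF I \<rho>] ev] show ?thesis by simp
qed

section \<open>Information of finite partitions\<close>

definition fin_parts :: "'a measure \<Rightarrow> 'a set set set" where
  "fin_parts M = {\<A>. finite \<A> \<and> \<A> \<subseteq> sets M \<and> partition_on (space M) \<A>}"

lemma sum_indicator_partition:
  assumes "finite \<A>" "partition_on X \<A>" "x \<in> X"
  shows "(\<Sum>A\<in>\<A>. indicator A x) = (1 :: real)"
proof -
  obtain B where B: "B \<in> \<A>" "x \<in> B" using assms by (auto simp: partition_on_def)
  have "indicator A x = (if A = B then 1 else 0 :: real)" if "A \<in> \<A>" for A
    using assms(2) that B by (auto simp: partition_on_def disjoint_def indicator_def)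
  then have "(\<Sum>A\<in>\<A>. indicator A x) = (\<Sum>A\<in>\<A>. if A = B then 1 else 0 :: real)" by (intro sum.cong) auto
  then show ?thesis using assms(1) B by simp
qed

lemma integrable_ln_ratio:
  fixes f g :: "'a \<Rightarrow> real"
  assumes f: "integrable M f" and g: "integrable M g"
    and fg: "\<And>x. x \<in> space M \<Longrightarrow> 0 \<le> f x \<and> f x \<le> g x"
  shows "integrable M (\<lambda>x. f x * ln (f x / g x))"
proof (rule Bochner_Integration.integrable_bound[OF g])
  have [measurable]: "f \<in> borel_measurable M" "g \<in> borel_measurable M" using f g by auto
  show "(\<lambda>x. f x * ln (f x / g x)) \<in> borel_measurable M" by measurable
  show "AE x in M. norm (f x * ln (f x / g x)) \<le> norm (g x)"
  proof (rule AE_I2)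
    fix x assume "x \<in> space M"
    then show "norm (f x * ln (f x / g x)) \<le> norm (g x)"
      using ln_ratio_bounds[of "f x" "g x"] fg[of x] by (simp add: abs_le_iff)
  qed
qed

text \<open>The log-sum inequality. With \<open>t = g * (A / B) / f\<close> the inequality
  \<open>ln t \<le> t - 1\<close> gives a pointwise lower bound for \<open>f ln (f / g)\<close> that
  is linear in \<open>f\<close> and \<open>g\<close>; on integration its last two terms
  cancel.\<close>

lemma log_sum_integral:
  fixes f g :: "'a \<Rightarrow> real"
  assumes f: "integrable M f" and g: "integrable M g"
    and fg: "\<And>x. x \<in> space M \<Longrightarrow> 0 \<le> f x \<and> f x \<le> g x"
  shows "(\<integral>x. f x \<partial>M) * ln ((\<integral>x. f x \<partial>M) / (\<integral>x. g x \<partial>M)) \<le> (\<integral>x. f x * ln (f x / g x) \<partial>M)"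
proof -
  define A where "A = (\<integral>x. f x \<partial>M)"
  define B where "B = (\<integral>x. g x \<partial>M)"
  have A: "0 \<le> A" unfolding A_def using fg by (intro integral_nonneg_AE AE_I2) auto
  have AB: "A \<le> B" unfolding A_def B_def using fg by (intro integral_mono_AE f g AE_I2) auto
  note int = integrable_ln_ratio[OF f g fg]
  show ?thesis
  proof (cases "A = 0")
    case True
    then have "AE x in M. f x = 0"
      using integral_nonneg_eq_0_iff_AE[OF f] fg unfolding A_def by (auto intro: AE_I2)
    then have "(\<integral>x. f x * ln (f x / g x) \<partial>M) = (\<integral>x. 0 \<partial>M)"
      using int by (intro integral_cong_AE) (auto elim!: eventually_mono)
    then show ?thesis using True by (simp add: A_def)
  next
    case False
    then have A0: "0 < A" "0 < B" using A AB by auto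
    have pt: "f x * ln (A / B) + f x - g x * (A / B) \<le> f x * ln (f x / g x)" if x: "x \<in> space M" for x
    proof (cases "f x = 0")
      case True
      then show ?thesis using fg[OF x] A0 by simp
    next
      case False
      then have fx: "0 < f x" "0 < g x" using fg[OF x] by auto
      have "ln ((g x * (A / B)) / f x) \<le> (g x * (A / B)) / f x - 1" using fx A0 by (intro ln_le_minus_one) simp
      then have "f x * ln ((g x * (A / B)) / f x) \<le> f x * ((g x * (A / B)) / f x - 1)" using fx by (intro mult_left_mono) auto
      also have "\<dots> = g x * (A / B) - f x" using fx by (simp add: field_simps)
      also have "ln ((g x * (A / B)) / f x) = ln (A / B) - ln (f x / g x)" using fx A0 by (simp add: ln_div ln_mult)
      finally show ?thesis by (simp add: algebra_simps)
    qed
    have "(\<integral>x. f x * ln (A / B) + f x - g x * (A / B) \<partial>M) \<le> (\<integral>x. f x * ln (f x / g x) \<partial>M)"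
      using pt f g int by (intro integral_mono_AE AE_I2) auto
    also have "(\<integral>x. f x * ln (A / B) + f x - g x * (A / B) \<partial>M) = A * ln (A / B) + A - B * (A / B)"
      using f g by (simp add: A_def B_def)
    finally show ?thesis using A0 by (simp add: A_def B_def)
  qed
qed

section \<open>Output partitions and the limit of their information\<close>

context poisson_channel
begin

definition cell :: "(real \<Rightarrow> real) measure \<Rightarrow> (real \<Rightarrow> real) set \<Rightarrow> real" where
  "cell \<rho> C = (\<integral>u. out_density \<rho> u * indicator C u \<partial>Q)"

text \<open>The term of a pair of partitions in the definition of mutual information:
  \<open>cell (\<rho> i) C\<close> is a joint probability, and the two factors in the denominator
  are the marginals.\<close>

definition pinfo :: "'i set \<Rightarrow> ('i \<Rightarrow> (real \<Rightarrow> real) measure) \<Rightarrow> (real \<Rightarrow> real) set set \<Rightarrow> real" where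
  "pinfo I \<rho> \<C> = (\<Sum>i\<in>I. \<Sum>C\<in>\<C>. cell (\<rho> i) C *
     ln (cell (\<rho> i) C / (measure (\<rho> i) (space (\<rho> i)) * (\<Sum>j\<in>I. cell (\<rho> j) C))))"

text \<open>Minus the entropy of the label. It depends on the input measures alone, so it is the
  same for both receivers and cancels in their comparison.\<close>

definition mass_ent :: "'i set \<Rightarrow> ('i \<Rightarrow> (real \<Rightarrow> real) measure) \<Rightarrow> real" where
  "mass_ent I \<rho> = (\<Sum>i\<in>I. measure (\<rho> i) (space (\<rho> i)) * ln (measure (\<rho> i) (space (\<rho> i))))"

lemma cell_integrable:
  assumes "input_measure T \<rho>" "C \<in> sets Q"
  shows "integrable Q (\<lambda>u. out_density \<rho> u * indicator C u)"
  by (intro integrable_real_mult_indicator integrable_out_density assms)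

lemma cell_nonneg: "input_measure T \<rho> \<Longrightarrow> 0 \<le> cell \<rho> C"
  unfolding cell_def using out_density_bounds(1) by (intro integral_nonneg_AE AE_I2 mult_nonneg_nonneg) auto

lemma cell_space: "input_measure T \<rho> \<Longrightarrow> cell \<rho> (space Q) = measure \<rho> (space \<rho>)"
  unfolding cell_def using integral_out_density[of \<rho>]
  by (subst Bochner_Integration.integral_cong[where g="out_density \<rho>"]) auto

lemma sum_cell:
  assumes \<rho>: "input_measure T \<rho>" and C: "\<C> \<in> fin_parts Q"
  shows "(\<Sum>C\<in>\<C>. cell \<rho> C) = measure \<rho> (space \<rho>)"
proof -
  have "(\<Sum>C\<in>\<C>. cell \<rho> C) = (\<integral>u. (\<Sum>C\<in>\<C>. out_density \<rho> u * indicator C u) \<partial>Q)"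
    unfolding cell_def using C by (intro Bochner_Integration.integral_sum[symmetric] cell_integrable[OF \<rho>]) (auto simp: fin_parts_def)
  also have "\<dots> = (\<integral>u. out_density \<rho> u \<partial>Q)"
    using sum_indicator_partition[of \<C> "space Q"] C
    by (intro Bochner_Integration.integral_cong) (auto simp: sum_distrib_left[symmetric] fin_parts_def)
  finally show ?thesis by (simp add: integral_out_density[OF \<rho>])
qed

lemma pinfo_eq:
  assumes I: "finite I" and \<rho>: "\<And>i. i \<in> I \<Longrightarrow> input_measure T (\<rho> i)" and C: "\<C> \<in> fin_parts Q"
  shows "pinfo I \<rho> \<C> = (\<Sum>C\<in>\<C>. hent I (\<lambda>i. cell (\<rho> i) C)) - mass_ent I \<rho>"
proof -
  have fin: "finite \<C>" using C by (simp add: fin_parts_def)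
  have *: "cell (\<rho> i) C * ln (cell (\<rho> i) C / (measure (\<rho> i) (space (\<rho> i)) * (\<Sum>j\<in>I. cell (\<rho> j) C))) =
      cell (\<rho> i) C * ln (cell (\<rho> i) C / (\<Sum>j\<in>I. cell (\<rho> j) C)) - cell (\<rho> i) C * ln (measure (\<rho> i) (space (\<rho> i)))"
    if i: "i \<in> I" and Cin: "C \<in> \<C>" for i C
  proof (cases "cell (\<rho> i) C = 0")
    case False
    then have p: "0 < cell (\<rho> i) C" using cell_nonneg[OF \<rho>[OF i], of C] by simp
    have "cell (\<rho> i) C \<le> measure (\<rho> i) (space (\<rho> i))"
      unfolding sum_cell[OF \<rho>[OF i] C, symmetric] using cell_nonneg[OF \<rho>[OF i]] Cin fin by (intro member_le_sum) auto
    moreover have "cell (\<rho> i) C \<le> (\<Sum>j\<in>I. cell (\<rho> j) C)"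
      using cell_nonneg[OF \<rho>] i I by (intro member_le_sum) auto
    ultimately have "0 < measure (\<rho> i) (space (\<rho> i))" "0 < (\<Sum>j\<in>I. cell (\<rho> j) C)" using p by linarith+
    then show ?thesis using p by (simp add: ln_div ln_mult algebra_simps)
  qed simp
  have "pinfo I \<rho> \<C> = (\<Sum>i\<in>I. \<Sum>C\<in>\<C>. cell (\<rho> i) C * ln (cell (\<rho> i) C / (\<Sum>j\<in>I. cell (\<rho> j) C))
      - cell (\<rho> i) C * ln (measure (\<rho> i) (space (\<rho> i))))"
    unfolding pinfo_def by (intro sum.cong refl *)
  also have "\<dots> = (\<Sum>i\<in>I. \<Sum>C\<in>\<C>. cell (\<rho> i) C * ln (cell (\<rho> i) C / (\<Sum>j\<in>I. cell (\<rho> j) C)))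
      - (\<Sum>i\<in>I. (\<Sum>C\<in>\<C>. cell (\<rho> i) C) * ln (measure (\<rho> i) (space (\<rho> i))))"
    by (simp add: sum_subtractf sum_distrib_right)
  also have "(\<Sum>i\<in>I. (\<Sum>C\<in>\<C>. cell (\<rho> i) C) * ln (measure (\<rho> i) (space (\<rho> i)))) = mass_ent I \<rho>"
    unfolding mass_ent_def using sum_cell[OF \<rho> C] by (intro sum.cong) auto
  also have "(\<Sum>i\<in>I. \<Sum>C\<in>\<C>. cell (\<rho> i) C * ln (cell (\<rho> i) C / (\<Sum>j\<in>I. cell (\<rho> j) C))) = (\<Sum>C\<in>\<C>. hent I (\<lambda>i. cell (\<rho> i) C))"
    unfolding hent_def by (rule sum.swap)
  finally show ?thesis .
qed

context
  fixes I :: "'i set" and \<rho> :: "'i \<Rightarrow> (real \<Rightarrow> real) measure"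
  assumes I: "finite I" and \<rho>: "\<And>i. i \<in> I \<Longrightarrow> input_measure T (\<rho> i)"
begin

abbreviation (input) "comp_dens \<equiv> \<lambda>i u. out_density (\<rho> i) u"
abbreviation (input) "total_dens \<equiv> \<lambda>u. \<Sum>i\<in>I. out_density (\<rho> i) u"

lemma comp_dens_le: "i \<in> I \<Longrightarrow> u \<in> space Q \<Longrightarrow> 0 \<le> comp_dens i u \<and> comp_dens i u \<le> total_dens u"
  using out_density_bounds(1)[OF \<rho>] I by (auto intro!: member_le_sum)

lemma integrable_total_dens: "integrable Q total_dens"
  by (intro Bochner_Integration.integrable_sum integrable_out_density \<rho>)

lemma integrable_comp_ln:
  assumes "i \<in> I"
  shows "integrable Q (\<lambda>u. comp_dens i u * ln (comp_dens i u / total_dens u))"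
  using comp_dens_le[OF assms] by (intro integrable_ln_ratio integrable_out_density \<rho> assms integrable_total_dens)

text \<open>Merging the outputs of a cell loses information, by the log-sum inequality in each cell
  and for each label.\<close>

lemma pinfo_le:
  assumes C: "\<C> \<in> fin_parts Q"
  shows "pinfo I \<rho> \<C> \<le> cond_ent I \<rho> - mass_ent I \<rho>"
proof -
  have fin: "finite \<C>" and sets: "\<And>C. C \<in> \<C> \<Longrightarrow> C \<in> sets Q" using C by (auto simp: fin_parts_def)
  have "hent I (\<lambda>i. cell (\<rho> i) C) \<le> (\<integral>u. hent I (\<lambda>i. comp_dens i u) * indicator C u \<partial>Q)" if Cin: "C \<in> \<C>" for C
  proof -
    have gC: "integrable Q (\<lambda>u. total_dens u * indicator C u)" by (intro integrable_real_mult_indicator integrable_total_dens sets Cin)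
    have sum: "(\<Sum>j\<in>I. cell (\<rho> j) C) = (\<integral>u. total_dens u * indicator C u \<partial>Q)"
      unfolding cell_def sum_distrib_right
      by (intro Bochner_Integration.integral_sum[symmetric] cell_integrable \<rho> sets Cin)
    have "cell (\<rho> i) C * ln (cell (\<rho> i) C / (\<Sum>j\<in>I. cell (\<rho> j) C)) \<le> (\<integral>u. comp_dens i u * ln (comp_dens i u / total_dens u) * indicator C u \<partial>Q)"
      if i: "i \<in> I" for i
    proof -
      have "cell (\<rho> i) C * ln (cell (\<rho> i) C / (\<Sum>j\<in>I. cell (\<rho> j) C)) \<le>
          (\<integral>u. (comp_dens i u * indicator C u) * ln ((comp_dens i u * indicator C u) / (total_dens u * indicator C u)) \<partial>Q)"
        unfolding sum unfolding cell_def
        by (rule log_sum_integral[OF cell_integrable[OF \<rho>[OF i] sets[OF Cin]] gC])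
          (use comp_dens_le[OF i] in \<open>auto simp: indicator_def\<close>)
      also have "\<dots> = (\<integral>u. comp_dens i u * ln (comp_dens i u / total_dens u) * indicator C u \<partial>Q)"
        by (intro Bochner_Integration.integral_cong) (auto simp: indicator_def)
      finally show ?thesis .
    qed
    then have "hent I (\<lambda>i. cell (\<rho> i) C) \<le> (\<Sum>i\<in>I. \<integral>u. comp_dens i u * ln (comp_dens i u / total_dens u) * indicator C u \<partial>Q)"
      unfolding hent_def by (intro sum_mono) auto
    also have "\<dots> = (\<integral>u. (\<Sum>i\<in>I. comp_dens i u * ln (comp_dens i u / total_dens u) * indicator C u) \<partial>Q)"
      by (intro Bochner_Integration.integral_sum[symmetric] integrable_real_mult_indicator integrable_comp_ln sets Cin)
    also have "\<dots> = (\<integral>u. hent I (\<lambda>i. comp_dens i u) * indicator C u \<partial>Q)"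
      by (simp add: hent_def sum_distrib_right)
    finally show ?thesis .
  qed
  then have "(\<Sum>C\<in>\<C>. hent I (\<lambda>i. cell (\<rho> i) C)) \<le> (\<Sum>C\<in>\<C>. \<integral>u. hent I (\<lambda>i. comp_dens i u) * indicator C u \<partial>Q)"
    by (intro sum_mono) auto
  also have "\<dots> = (\<integral>u. (\<Sum>C\<in>\<C>. hent I (\<lambda>i. comp_dens i u) * indicator C u) \<partial>Q)"
    by (intro Bochner_Integration.integral_sum[symmetric] integrable_real_mult_indicator integrable_hent I \<rho> sets)
  also have "\<dots> = cond_ent I \<rho>" unfolding cond_ent_def
    using sum_indicator_partition[of \<C> "space Q"] C
    by (intro Bochner_Integration.integral_cong) (auto simp: sum_distrib_left[symmetric] fin_parts_def)
  finally show ?thesis using pinfo_eq[where I=I and \<rho>=\<rho>, OF I \<rho> C] by simp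
qed

text \<open>On a cell all posteriors of a label lie in one interval of length \<open>1/N\<close>,
  and so does their average over the cell. By uniform continuity of \<open>t ln t\<close> on
  \<open>[0,1]\<close>, replacing the posterior by the average costs at most \<open>e'\<close> per
  unit of mass and label.\<close>

lemma pinfo_approx:
  assumes e: "0 < e"
  obtains \<C> where "\<C> \<in> fin_parts Q" "cond_ent I \<rho> - mass_ent I \<rho> \<le> pinfo I \<rho> \<C> + e"
proof -
  \<comment> \<open>The total cost is \<open>card I * e'\<close> times the total mass, hence at most
    \<open>e\<close> for \<open>e' = e / M\<close>; the added 1 ensures
    \<open>0 < M\<close>.\<close>
  define M where "M = card I * (\<integral>u. total_dens u \<partial>Q) + 1"
  have g0: "0 \<le> total_dens u" if "u \<in> space Q" for u using out_density_bounds(1)[OF \<rho> that] by (intro sum_nonneg) auto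
  have M: "0 < M" unfolding M_def using g0 by (intro add_nonneg_pos mult_nonneg_nonneg integral_nonneg_AE AE_I2) auto
  define e' where "e' = e / M"
  have e': "0 < e'" using e M by (simp add: e'_def)
  define \<theta> where "\<theta> = (\<lambda>t::real. t * ln t)"
  have "uniformly_continuous_on {0..1} \<theta>"
    unfolding \<theta>_def by (intro compact_uniformly_continuous continuous_on_subset[OF continuous_on_mult_ln]) auto
  then obtain d where d: "0 < d" "\<And>s t. s \<in> {0..1} \<Longrightarrow> t \<in> {0..1} \<Longrightarrow> \<bar>s - t\<bar> < d \<Longrightarrow> \<bar>\<theta> s - \<theta> t\<bar> < e'"
    using e' unfolding uniformly_continuous_on_def dist_real_def by meson
  obtain N0 :: nat where N0: "1 / Suc N0 < d" using reals_Archimedean[OF d(1)] by (auto simp: inverse_eq_divide)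
  define N where "N = Suc N0"
  have N: "0 < N" "1 / N < d" using N0 by (auto simp: N_def)
  define r where "r = (\<lambda>i u. comp_dens i u / total_dens u)"
  \<comment> \<open>partition the outputs according to the posterior of the label, rounded to multiples of \<open>1/N\<close>\<close>
  define \<kappa> where "\<kappa> = (\<lambda>u. \<lambda>i\<in>I. \<lfloor>N * r i u\<rfloor>)"
  define \<C> where "\<C> = (\<lambda>k. {u \<in> space Q. \<kappa> u = k}) ` (\<kappa> ` space Q)"
  have r01: "r i u \<in> {0..1}" if "i \<in> I" "u \<in> space Q" for i u
    unfolding r_def using comp_dens_le[OF that] by (auto simp: divide_le_eq_1)
  have fr: "comp_dens i u = total_dens u * r i u" if "i \<in> I" "u \<in> space Q" for i u
    unfolding r_def using comp_dens_le[OF that] by auto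
  have [measurable]: "r i \<in> borel_measurable Q" if "i \<in> I" for i
    unfolding r_def by (intro borel_measurable_divide borel_measurable_sum out_density_measurable \<rho> that)
  have sets: "{u \<in> space Q. \<kappa> u = k} \<in> sets Q" for k
  proof (cases "k \<in> extensional I")
    case True
    have "{u \<in> space Q. \<kappa> u = k} = {u \<in> space Q. \<forall>i\<in>I. \<lfloor>N * r i u\<rfloor> = k i}"
      using True by (auto simp: \<kappa>_def extensional_def fun_eq_iff)
    also have "\<dots> \<in> sets Q" using I by measurable
    finally show ?thesis .
  next
    case False
    then have "{u \<in> space Q. \<kappa> u = k} = {}" by (auto simp: \<kappa>_def)
    then show ?thesis by (simp only: sets.empty_sets)
  qed
  have "\<kappa> ` space Q \<subseteq> PiE I (\<lambda>_. {0..int N})"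
  proof (intro image_subsetI PiE_I)
    fix u i assume ui: "u \<in> space Q" "i \<in> I"
    have "0 \<le> N * r i u" "N * r i u \<le> N * 1" using r01[OF ui(2,1)] N by (auto intro!: mult_left_mono)
    then show "\<kappa> u i \<in> {0..int N}" using ui by (auto simp: \<kappa>_def) linarith
  qed (auto simp: \<kappa>_def)
  then have fin\<kappa>: "finite (\<kappa> ` space Q)" by (rule finite_subset) (intro finite_PiE I, auto)
  have fp: "\<C> \<in> fin_parts Q"
    using fin\<kappa> sets by (auto simp: fin_parts_def \<C>_def partition_on_def disjoint_def)
  have key: "(\<integral>u. comp_dens i u * ln (comp_dens i u / total_dens u) * indicator C u \<partial>Q) \<le>
      cell (\<rho> i) C * ln (cell (\<rho> i) C / (\<Sum>j\<in>I. cell (\<rho> j) C)) + e' * (\<integral>u. total_dens u * indicator C u \<partial>Q)"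
    if i: "i \<in> I" and C: "C \<in> \<C>" for i C
  proof -
    obtain u0 where u0: "u0 \<in> space Q" "C = {u \<in> space Q. \<kappa> u = \<kappa> u0}" using C by (auto simp: \<C>_def)
    define k where "k = real_of_int \<lfloor>N * r i u0\<rfloor>"
    have Cs: "C \<in> sets Q" using sets u0 by simp
    have gC: "integrable Q (\<lambda>u. total_dens u * indicator C u)" by (intro integrable_real_mult_indicator integrable_total_dens Cs)
    have fC: "integrable Q (\<lambda>u. comp_dens i u * indicator C u)" by (rule cell_integrable[OF \<rho>[OF i] Cs])
    define W where "W = (\<integral>u. total_dens u * indicator C u \<partial>Q)"
    have sum: "(\<Sum>j\<in>I. cell (\<rho> j) C) = W"
      unfolding cell_def W_def sum_distrib_right
      by (intro Bochner_Integration.integral_sum[symmetric] cell_integrable \<rho> Cs)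
    have W0: "0 \<le> W" unfolding W_def using g0 by (intro integral_nonneg_AE AE_I2 mult_nonneg_nonneg) auto
    have rC: "k / N \<le> r i u" "r i u \<le> (k + 1) / N" if "u \<in> C" for u
    proof -
      have "\<kappa> u i = \<kappa> u0 i" using that u0 by simp
      then have "real_of_int \<lfloor>N * r i u\<rfloor> = k" using i by (simp add: \<kappa>_def k_def)
      then have "k \<le> N * r i u" "N * r i u \<le> k + 1" by linarith+
      then show "k / N \<le> r i u" "r i u \<le> (k + 1) / N" using N by (simp_all add: field_simps)
    qed
    have lo: "(k / N) * W \<le> cell (\<rho> i) C"
    proof -
      have "(\<integral>u. (k / N) * (total_dens u * indicator C u) \<partial>Q) \<le> cell (\<rho> i) C"
        unfolding cell_def
      proof (intro integral_mono_AE AE_I2 integrable_mult_right gC fC)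
        fix u assume u: "u \<in> space Q"
        show "(k / N) * (total_dens u * indicator C u) \<le> comp_dens i u * indicator C u"
        proof (cases "u \<in> C")
          case True
          then show ?thesis using mult_right_mono[OF rC(1)[OF True] g0[OF u]] fr[OF i u] by (simp add: mult.commute)
        qed simp
      qed
      then show ?thesis using gC by (simp add: W_def)
    qed
    have up: "cell (\<rho> i) C \<le> ((k + 1) / N) * W"
    proof -
      have "cell (\<rho> i) C \<le> (\<integral>u. ((k + 1) / N) * (total_dens u * indicator C u) \<partial>Q)"
        unfolding cell_def
      proof (intro integral_mono_AE AE_I2 integrable_mult_right gC fC)
        fix u assume u: "u \<in> space Q"
        show "comp_dens i u * indicator C u \<le> ((k + 1) / N) * (total_dens u * indicator C u)"
        proof (cases "u \<in> C")
          case True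
          then show ?thesis using mult_right_mono[OF rC(2)[OF True] g0[OF u]] fr[OF i u] by (simp add: mult.commute)
        qed simp
      qed
      then show ?thesis using gC by (simp add: W_def)
    qed
    have cW: "cell (\<rho> i) C \<le> W"
      unfolding sum[symmetric] using cell_nonneg[OF \<rho>] i I by (intro member_le_sum) auto
    have c0: "0 \<le> cell (\<rho> i) C" by (rule cell_nonneg[OF \<rho>[OF i]])
    define b where "b = cell (\<rho> i) C / W"
    have Wb: "cell (\<rho> i) C = W * b" using cW c0 by (auto simp: b_def)
    have b01: "b \<in> {0..1}" unfolding b_def using c0 cW by (auto simp: divide_le_eq_1)
    show ?thesis
    proof (cases "W = 0")
      case True
      then have "cell (\<rho> i) C = 0" using c0 cW by simp
      moreover have "(\<integral>u. comp_dens i u * ln (comp_dens i u / total_dens u) * indicator C u \<partial>Q) \<le> (\<integral>u. 0 \<partial>Q)"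
        using ln_ratio_bounds(1) comp_dens_le[OF i]
        by (intro integral_mono_AE AE_I2 integrable_real_mult_indicator integrable_comp_ln Cs i) (auto simp: indicator_def)
      ultimately show ?thesis using True unfolding W_def by simp
    next
      case False
      then have Wp: "0 < W" using W0 by simp
      \<comment> \<open>The posterior \<open>b\<close> given the cell is the mean of
        \<open>r i\<close> over the cell, weighted with \<open>total_dens\<close>, and so obeys the
        same bounds.\<close>
      have bk: "k / N \<le> b" "b \<le> (k + 1) / N" using lo up Wp by (simp_all add: b_def pos_le_divide_eq pos_divide_le_eq)
      have close: "\<theta> (r i u) \<le> \<theta> b + e'" if u: "u \<in> C" for u
      proof -
        have "\<bar>r i u - b\<bar> \<le> 1 / N" using rC[OF u] bk by (simp add: abs_le_iff add_divide_distrib)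
        then have "\<bar>r i u - b\<bar> < d" using N by linarith
        then show ?thesis using d(2)[OF r01[OF i] b01, of u] u u0 by force
      qed
      have "(\<integral>u. comp_dens i u * ln (comp_dens i u / total_dens u) * indicator C u \<partial>Q) \<le> (\<integral>u. (\<theta> b + e') * (total_dens u * indicator C u) \<partial>Q)"
      proof (intro integral_mono_AE AE_I2 integrable_mult_right gC integrable_real_mult_indicator integrable_comp_ln Cs i)
        fix u assume u: "u \<in> space Q"
        show "comp_dens i u * ln (comp_dens i u / total_dens u) * indicator C u \<le> (\<theta> b + e') * (total_dens u * indicator C u)"
        proof (cases "u \<in> C")
          case True
          have "comp_dens i u * ln (comp_dens i u / total_dens u) = \<theta> (r i u) * total_dens u"
            using fr[OF i u] by (simp add: \<theta>_def r_def)
          then show ?thesis using True mult_right_mono[OF close[OF True] g0[OF u]] by simp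
        qed simp
      qed
      also have "\<dots> = (\<theta> b + e') * W" using gC by (simp add: W_def)
      also have "\<dots> = cell (\<rho> i) C * ln b + e' * W" by (simp add: \<theta>_def Wb algebra_simps)
      finally show ?thesis unfolding sum b_def W_def by simp
    qed
  qed
  have finC: "finite \<C>" using fp by (simp add: fin_parts_def)
  have setsC: "C \<in> sets Q" if "C \<in> \<C>" for C using fp that by (auto simp: fin_parts_def)
  have one: "(\<Sum>C\<in>\<C>. indicator C u) = (1::real)" if "u \<in> space Q" for u
    using fp that by (intro sum_indicator_partition) (auto simp: fin_parts_def)
  have "cond_ent I \<rho> = (\<integral>u. (\<Sum>C\<in>\<C>. \<Sum>i\<in>I. comp_dens i u * ln (comp_dens i u / total_dens u) * indicator C u) \<partial>Q)"
    unfolding cond_ent_def hent_def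
    by (intro Bochner_Integration.integral_cong refl, subst sum.swap)
      (simp add: sum_distrib_left[symmetric] one)
  also have "\<dots> = (\<Sum>C\<in>\<C>. \<Sum>i\<in>I. \<integral>u. comp_dens i u * ln (comp_dens i u / total_dens u) * indicator C u \<partial>Q)"
  proof -
    have int: "integrable Q (\<lambda>u. comp_dens i u * ln (comp_dens i u / total_dens u) * indicator C u)" if "C \<in> \<C>" "i \<in> I" for C i
      by (intro integrable_real_mult_indicator integrable_comp_ln setsC that)
    have "(\<integral>u. (\<Sum>C\<in>\<C>. \<Sum>i\<in>I. comp_dens i u * ln (comp_dens i u / total_dens u) * indicator C u) \<partial>Q) =
        (\<Sum>C\<in>\<C>. \<integral>u. (\<Sum>i\<in>I. comp_dens i u * ln (comp_dens i u / total_dens u) * indicator C u) \<partial>Q)"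
      by (intro Bochner_Integration.integral_sum Bochner_Integration.integrable_sum int)
    also have "\<dots> = (\<Sum>C\<in>\<C>. \<Sum>i\<in>I. \<integral>u. comp_dens i u * ln (comp_dens i u / total_dens u) * indicator C u \<partial>Q)"
      by (intro sum.cong refl Bochner_Integration.integral_sum int)
    finally show ?thesis .
  qed
  also have "\<dots> \<le> (\<Sum>C\<in>\<C>. \<Sum>i\<in>I. cell (\<rho> i) C * ln (cell (\<rho> i) C / (\<Sum>j\<in>I. cell (\<rho> j) C)) + e' * (\<integral>u. total_dens u * indicator C u \<partial>Q))"
    by (intro sum_mono key)
  also have "\<dots> = (\<Sum>C\<in>\<C>. hent I (\<lambda>i. cell (\<rho> i) C)) + card I * e' * (\<Sum>C\<in>\<C>. \<integral>u. total_dens u * indicator C u \<partial>Q)"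
    by (simp add: hent_def sum.distrib sum_distrib_left algebra_simps)
  also have "(\<Sum>C\<in>\<C>. \<integral>u. total_dens u * indicator C u \<partial>Q) = (\<integral>u. (\<Sum>C\<in>\<C>. total_dens u * indicator C u) \<partial>Q)"
    by (intro Bochner_Integration.integral_sum[symmetric] integrable_real_mult_indicator integrable_total_dens setsC)
  also have "\<dots> = (\<integral>u. total_dens u \<partial>Q)"
    by (intro Bochner_Integration.integral_cong refl) (simp add: sum_distrib_left[symmetric] one)
  also have "card I * e' * (\<integral>u. total_dens u \<partial>Q) = e' * (M - 1)" by (simp add: M_def)
  also have "\<dots> \<le> e" using e' M by (simp add: e'_def field_simps)
  finally have "cond_ent I \<rho> \<le> (\<Sum>C\<in>\<C>. hent I (\<lambda>i. cell (\<rho> i) C)) + e" by simp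
  then have "cond_ent I \<rho> - mass_ent I \<rho> \<le> pinfo I \<rho> \<C> + e" using pinfo_eq[where I=I and \<rho>=\<rho>, OF I \<rho> fp] by simp
  then show thesis by (rule that[OF fp])
qed

end

end

lemma pinfo_compare:
  assumes y: "poisson_channel T Qy ay ly" and z: "poisson_channel T Qz az lz"
    and I: "finite I" and \<rho>: "\<And>i. i \<in> I \<Longrightarrow> input_measure T (\<rho> i)"
    and cvx: "convex_on {0..1} (\<lambda>x. phi ay ly x - phi az lz x)"
    and C: "\<C> \<in> fin_parts Qz" and e: "0 < e"
  obtains \<D> where "\<D> \<in> fin_parts Qy"
    "poisson_channel.pinfo T Qz az lz I \<rho> \<C> \<le> poisson_channel.pinfo T Qy ay ly I \<rho> \<D> + e"
proof -
  interpret y: poisson_channel T Qy ay ly by (rule y)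
  interpret z: poisson_channel T Qz az lz by (rule z)
  obtain \<D> where D: "\<D> \<in> fin_parts Qy" "y.cond_ent I \<rho> - y.mass_ent I \<rho> \<le> y.pinfo I \<rho> \<D> + e"
    by (rule y.pinfo_approx[where I=I and \<rho>=\<rho>, OF I \<rho> e])
  have "z.pinfo I \<rho> \<C> \<le> z.cond_ent I \<rho> - z.mass_ent I \<rho>" by (rule z.pinfo_le[where I=I and \<rho>=\<rho>, OF I \<rho> C])
  also have "\<dots> \<le> y.cond_ent I \<rho> - y.mass_ent I \<rho>"
    using cond_ent_mono[where I=I and \<rho>=\<rho>, OF y z I \<rho> cvx] by (simp add: y.mass_ent_def z.mass_ent_def)
  finally show thesis using D that by fastforce
qed

section \<open>Mutual information of the channel\<close>

definition preim :: "'w measure \<Rightarrow> ('w \<Rightarrow> 's) \<Rightarrow> 's set \<Rightarrow> 'w set" where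
  "preim P A a = A -` a \<inter> space P"

lemma preim_inj:
  assumes "A ` space P = X"
  shows "inj_on (preim P A) (Pow X)"
proof (rule inj_onI)
  fix a b assume ab: "a \<in> Pow X" "b \<in> Pow X" "preim P A a = preim P A b"
  have "A ` preim P A c = c" if "c \<in> Pow X" for c using that assms by (auto simp: preim_def)
  then show "a = b" using ab by metis
qed

text \<open>Sets of the generated \<sigma>-field are preimages, and since \<open>A\<close> maps onto
  the value space, taking preimages is injective and preserves nonemptiness. Partitions of the
  sample space thus correspond to partitions of the value space.\<close>

lemma finite_partitions_eq:
  assumes surj: "A ` space P = space S"
  shows "finite_partitions P S A = (\<lambda>\<A>. preim P A ` \<A>) ` fin_parts S"
proof -
  have sets: "sets (vimage_algebra (space P) A S) = preim P A ` sets S"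
    using surj by (subst sets_vimage_algebra2) (auto simp: preim_def image_iff)
  show ?thesis
  proof (intro equalityI subsetI)
    fix \<A> assume "\<A> \<in> finite_partitions P S A"
    then have fin: "finite \<A>" and sub: "\<A> \<subseteq> preim P A ` sets S" and part: "partition_on (space P) \<A>"
      by (auto simp: finite_partitions_def sets)
    obtain \<B> where B: "\<B> \<subseteq> sets S" "finite \<B>" "\<A> = preim P A ` \<B>"
      using finite_subset_image[OF fin sub] by blast
    have "\<B> \<in> fin_parts S"
      unfolding fin_parts_def partition_on_def disjoint_def
    proof (intro CollectI conjI ballI impI B)
      show "\<Union>\<B> = space S"
      proof
        show "\<Union>\<B> \<subseteq> space S" using B(1) sets.sets_into_space by blast
        show "space S \<subseteq> \<Union>\<B>"
        proof
          fix s assume "s \<in> space S"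
          then have "s \<in> A ` space P" by (simp only: surj)
          then obtain w where w: "w \<in> space P" "A w = s" by auto
          have "w \<in> \<Union>\<A>" using partition_onD1[OF part] w(1) by simp
          then obtain b where "b \<in> \<B>" "w \<in> preim P A b" unfolding B(3) by blast
          then have "s \<in> b" "b \<in> \<B>" using w by (simp_all add: preim_def)
          then show "s \<in> \<Union>\<B>" by blast
        qed
      qed
      fix b c assume bc: "b \<in> \<B>" "c \<in> \<B>" "b \<noteq> c"
      have "b \<in> Pow (space S)" "c \<in> Pow (space S)" using bc B(1) sets.sets_into_space by blast+
      then have "preim P A b \<noteq> preim P A c" using inj_onD[OF preim_inj[OF surj]] bc(3) by blast
      moreover have "preim P A b \<in> \<A>" "preim P A c \<in> \<A>" using bc B(3) by auto
      ultimately have disj: "preim P A b \<inter> preim P A c = {}" using disjointD[OF partition_onD2[OF part]] by blast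
      show "b \<inter> c = {}"
      proof (rule ccontr)
        assume "b \<inter> c \<noteq> {}"
        then obtain s where s: "s \<in> b" "s \<in> c" by blast
        then have "s \<in> space S" using \<open>b \<in> Pow (space S)\<close> by blast
        then have "s \<in> A ` space P" by (simp only: surj)
        then obtain w where "w \<in> space P" "A w = s" by auto
        then have "w \<in> preim P A b \<inter> preim P A c" using s by (simp add: preim_def)
        then show False using disj by simp
      qed
    next
      show "{} \<notin> \<B>"
      proof
        assume "{} \<in> \<B>"
        then have "preim P A {} \<in> \<A>" unfolding B(3) by (rule imageI)
        then show False using partition_onD3[OF part] by (simp add: preim_def)
      qed
    qed
    then show "\<A> \<in> (\<lambda>\<A>. preim P A ` \<A>) ` fin_parts S" using B(3) by blast
  next
    fix \<A> assume "\<A> \<in> (\<lambda>\<A>. preim P A ` \<A>) ` fin_parts S"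
    then obtain \<B> where B: "finite \<B>" "\<B> \<subseteq> sets S" "partition_on (space S) \<B>" "\<A> = preim P A ` \<B>"
      by (auto simp: fin_parts_def)
    have ne: "preim P A b \<noteq> {}" if b: "b \<in> \<B>" for b
    proof -
      obtain s where "s \<in> b" using b partition_onD3[OF B(3)] by (cases "b = {}") auto
      moreover have "b \<subseteq> A ` space P" using b B(2) sets.sets_into_space unfolding surj by blast
      ultimately obtain w where "w \<in> space P" "A w \<in> b" by blast
      then have "w \<in> preim P A b" by (simp add: preim_def)
      then show ?thesis by blast
    qed
    have "w \<in> \<Union>\<A>" if w: "w \<in> space P" for w
    proof -
      have "A w \<in> \<Union>\<B>" using w surj partition_onD1[OF B(3)] by auto
      then show ?thesis using w unfolding B(4) preim_def by blast
    qed
    moreover have "\<Union>\<A> \<subseteq> space P" unfolding B(4) preim_def by blast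
    ultimately have "space P = \<Union>\<A>" by blast
    moreover have "disjoint \<A>"
    proof (rule disjointI)
      fix a' b' assume "a' \<in> \<A>" "b' \<in> \<A>" and ne: "a' \<noteq> b'"
      then obtain a b where ab: "a \<in> \<B>" "b \<in> \<B>" "a' = preim P A a" "b' = preim P A b" unfolding B(4) by blast
      then have "a \<inter> b = {}" using disjointD[OF partition_onD2[OF B(3)]] ne by blast
      then show "a' \<inter> b' = {}" unfolding ab preim_def by blast
    qed
    moreover have "{} \<notin> \<A>" using ne B(4) by auto
    ultimately have "partition_on (space P) \<A>" unfolding partition_on_def by simp
    moreover have "\<A> \<subseteq> preim P A ` sets S" using B(2,4) by blast
    ultimately show "\<A> \<in> finite_partitions P S A"
      unfolding finite_partitions_def sets using B(1,4) by simp
  qed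
qed

lemma mutual_info_eq:
  assumes A: "A ` space P = space S" and C: "C ` space P = space R"
  shows "mutual_info P S A R C = (SUP (\<A>, \<C>) \<in> fin_parts S \<times> fin_parts R.
    ereal (\<Sum>a\<in>\<A>. \<Sum>c\<in>\<C>. measure P (preim P A a \<inter> preim P C c) *
      ln (measure P (preim P A a \<inter> preim P C c) / (measure P (preim P A a) * measure P (preim P C c)))))"
proof -
  define t where "t = (\<lambda>\<A> \<C>. ereal (\<Sum>a\<in>\<A>. \<Sum>c\<in>\<C>. measure P (a \<inter> c) * ln (measure P (a \<inter> c) / (measure P a * measure P c))))"
  have inj: "inj_on (preim P A) \<A>" if "\<A> \<in> fin_parts S" for \<A>
    using that sets.sets_into_space by (intro inj_on_subset[OF preim_inj[OF A]]) (auto simp: fin_parts_def)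
  have inj': "inj_on (preim P C) \<C>" if "\<C> \<in> fin_parts R" for \<C>
    using that sets.sets_into_space by (intro inj_on_subset[OF preim_inj[OF C]]) (auto simp: fin_parts_def)
  have "mutual_info P S A R C = (SUP p \<in> ((\<lambda>\<A>. preim P A ` \<A>) ` fin_parts S) \<times> ((\<lambda>\<C>. preim P C ` \<C>) ` fin_parts R). t (fst p) (snd p))"
    unfolding mutual_info_def finite_partitions_eq[OF A] finite_partitions_eq[OF C] t_def by (simp add: case_prod_unfold)
  also have "((\<lambda>\<A>. preim P A ` \<A>) ` fin_parts S) \<times> ((\<lambda>\<C>. preim P C ` \<C>) ` fin_parts R) =
      (\<lambda>p. (preim P A ` fst p, preim P C ` snd p)) ` (fin_parts S \<times> fin_parts R)" by force
  also have "(SUP p \<in> \<dots>. t (fst p) (snd p)) = (SUP p \<in> fin_parts S \<times> fin_parts R. t (preim P A ` fst p) (preim P C ` snd p))"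
    by (simp add: image_comp comp_def)
  also have "\<dots> = (SUP p \<in> fin_parts S \<times> fin_parts R.
    ereal (\<Sum>a\<in>fst p. \<Sum>c\<in>snd p. measure P (preim P A a \<inter> preim P C c) *
      ln (measure P (preim P A a \<inter> preim P C c) / (measure P (preim P A a) * measure P (preim P C c)))))"
  proof (intro SUP_cong refl)
    fix p assume "p \<in> fin_parts S \<times> fin_parts R"
    then have p: "fst p \<in> fin_parts S" "snd p \<in> fin_parts R" by auto
    show "t (preim P A ` fst p) (preim P C ` snd p) = ereal (\<Sum>a\<in>fst p. \<Sum>c\<in>snd p. measure P (preim P A a \<inter> preim P C c) *
      ln (measure P (preim P A a \<inter> preim P C c) / (measure P (preim P A a) * measure P (preim P C c))))"
      unfolding t_def by (simp only: sum.reindex[OF inj[OF p(1)]] sum.reindex[OF inj'[OF p(2)]] comp_def)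
  qed
  finally show ?thesis by (simp add: case_prod_unfold)
qed

context poisson_channel
begin

text \<open>The labels are the cells \<open>a\<close> of the first partition, and
  \<open>\<rho> a\<close> is the law of the input on the event that the first object lies in
  \<open>a\<close>. Both the message and the input itself can play the role of \<open>A\<close>;
  only the joint probabilities with the output have to be supplied.\<close>

lemma mutual_info_pinfo:
  assumes P: "prob_space P" and A: "A ` space P = space S" "A \<in> P \<rightarrow>\<^sub>M S"
    and C: "C ` space P = count_paths T" "C \<in> P \<rightarrow>\<^sub>M output_space T"
    and \<rho>: "\<And>a. a \<in> sets S \<Longrightarrow> input_measure T (\<rho> a)"
    and joint: "\<And>a c. a \<in> sets S \<Longrightarrow> c \<in> sets Q \<Longrightarrow> measure P (preim P A a \<inter> preim P C c) = cell (\<rho> a) c"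
  shows "mutual_info P S A (output_space T) C = (SUP (\<A>, \<C>) \<in> fin_parts S \<times> fin_parts Q. ereal (pinfo \<A> \<rho> \<C>))"
proof -
  interpret P: prob_space P by (rule P)
  have fpQ: "fin_parts (output_space T) = fin_parts Q" by (simp add: fin_parts_def sets_Q)
  have mA: "measure P (preim P A a) = measure (\<rho> a) (space (\<rho> a))" if a: "a \<in> sets S" for a
  proof -
    have "preim P C (space Q) = space P" using C(1) by (auto simp: preim_def)
    then have "preim P A a = preim P A a \<inter> preim P C (space Q)" by (auto simp: preim_def)
    then show ?thesis using joint[OF a sets.top] cell_space[OF \<rho>[OF a]] by simp
  qed
  have mC: "measure P (preim P C c) = (\<Sum>a\<in>\<A>. cell (\<rho> a) c)" if \<A>: "\<A> \<in> fin_parts S" and c: "c \<in> sets Q" for \<A> c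
  proof -
    have fin: "finite \<A>" and s: "\<A> \<subseteq> sets S" and p: "partition_on (space S) \<A>" using \<A> by (auto simp: fin_parts_def)
    have eq: "preim P C c = (\<Union>a\<in>\<A>. preim P A a \<inter> preim P C c)"
    proof -
      have "w \<in> (\<Union>a\<in>\<A>. preim P A a)" if w: "w \<in> space P" for w
      proof -
        have "A w \<in> \<Union>\<A>" using w A(1) partition_onD1[OF p] by auto
        then show ?thesis using w unfolding preim_def by blast
      qed
      moreover have "preim P C c \<subseteq> space P" by (auto simp: preim_def)
      ultimately show ?thesis by blast
    qed
    have "measure P (\<Union>a\<in>\<A>. preim P A a \<inter> preim P C c) = (\<Sum>a\<in>\<A>. measure P (preim P A a \<inter> preim P C c))"
    proof (rule P.finite_measure_finite_Union[OF fin])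
      show "(\<lambda>a. preim P A a \<inter> preim P C c) ` \<A> \<subseteq> sets P"
      proof (rule image_subsetI)
        fix a assume "a \<in> \<A>"
        then have "a \<in> sets S" using s by blast
        then show "preim P A a \<inter> preim P C c \<in> sets P"
          using measurable_sets[OF A(2)] measurable_sets[OF C(2), of c] c sets_Q by (auto simp: preim_def)
      qed
      show "disjoint_family_on (\<lambda>a. preim P A a \<inter> preim P C c) \<A>"
        unfolding disjoint_family_on_def
      proof (intro ballI impI)
        fix a b assume "a \<in> \<A>" "b \<in> \<A>" "a \<noteq> b"
        then have "a \<inter> b = {}" using disjointD[OF partition_onD2[OF p]] by blast
        then show "(preim P A a \<inter> preim P C c) \<inter> (preim P A b \<inter> preim P C c) = {}" by (auto simp: preim_def)
      qed
    qed
    also have "\<dots> = (\<Sum>a\<in>\<A>. cell (\<rho> a) c)" using s c by (intro sum.cong joint) auto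
    finally show ?thesis using eq by simp
  qed
  have C1: "C ` space P = space (output_space T)" using C(1) by simp
  show ?thesis
    unfolding mutual_info_eq[OF A(1) C1] fpQ
  proof (intro SUP_cong refl)
    fix p assume p: "p \<in> fin_parts S \<times> fin_parts Q"
    then obtain \<A> \<C> where AC: "p = (\<A>, \<C>)" "\<A> \<in> fin_parts S" "\<C> \<in> fin_parts Q" by auto
    have "(\<Sum>a\<in>\<A>. \<Sum>c\<in>\<C>. measure P (preim P A a \<inter> preim P C c) *
      ln (measure P (preim P A a \<inter> preim P C c) / (measure P (preim P A a) * measure P (preim P C c)))) = pinfo \<A> \<rho> \<C>"
      unfolding pinfo_def
    proof (intro sum.cong refl)
      fix a c assume ac: "a \<in> \<A>" "c \<in> \<C>"
      then have a: "a \<in> sets S" and c: "c \<in> sets Q" using AC by (auto simp: fin_parts_def)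
      show "measure P (preim P A a \<inter> preim P C c) *
          ln (measure P (preim P A a \<inter> preim P C c) / (measure P (preim P A a) * measure P (preim P C c))) =
        cell (\<rho> a) c * ln (cell (\<rho> a) c / (measure (\<rho> a) (space (\<rho> a)) * (\<Sum>j\<in>\<A>. cell (\<rho> j) c)))"
        by (simp only: joint[OF a c] mA[OF a] mC[OF AC(2) c])
    qed
    then show "(case p of (\<A>, \<C>) \<Rightarrow> ereal (\<Sum>a\<in>\<A>. \<Sum>c\<in>\<C>. measure P (preim P A a \<inter> preim P C c) *
      ln (measure P (preim P A a \<inter> preim P C c) / (measure P (preim P A a) * measure P (preim P C c))))) =
      (case p of (\<A>, \<C>) \<Rightarrow> ereal (pinfo \<A> \<rho> \<C>))" by (simp add: AC(1))
  qed
qed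

definition out_prob :: "(real \<Rightarrow> real) \<Rightarrow> (real \<Rightarrow> real) set \<Rightarrow> ennreal" where
  "out_prob x c = (\<integral>\<^sup>+u. likelihood T a l x u * indicator c u \<partial>Q)"

lemma out_prob_space: "x \<in> input_paths T \<Longrightarrow> out_prob x (space Q) = 1"
proof -
  assume x: "x \<in> input_paths T"
  from nn_integral_likelihood[OF this] show ?thesis
    unfolding out_prob_def by (subst nn_integral_cong[where v="likelihood T a l x"]) auto
qed

lemma likelihood_indicator_measurable:
  assumes "c \<in> sets Q"
  shows "(\<lambda>(x, u). likelihood T a l x u * indicator c u) \<in> borel_measurable (input_space T \<Otimes>\<^sub>M Q)"
proof -
  have [measurable]: "(\<lambda>p. likelihood T a l (fst p) (snd p)) \<in> borel_measurable (input_space T \<Otimes>\<^sub>M Q)"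
    using likelihood_measurable by (simp add: case_prod_unfold)
  show ?thesis using assms by (simp add: case_prod_unfold)
qed

lemma out_prob_measurable: "c \<in> sets Q \<Longrightarrow> (\<lambda>x. out_prob x c) \<in> borel_measurable (input_space T)"
  unfolding out_prob_def
  using borel_measurable_nn_integral_fst[OF likelihood_indicator_measurable] by simp

lemma cell_eq_out_prob:
  assumes \<rho>: "input_measure T \<rho>" and c: "c \<in> sets Q"
  shows "(\<integral>\<^sup>+x. out_prob x c \<partial>\<rho>) = ennreal (cell \<rho> c)"
  unfolding out_prob_def cell_def by (rule emeasure_cell[OF \<rho> c])

end

section \<open>The channel with two receivers and its marginals\<close>

locale two_receivers = y: poisson_channel T Qy ay ly + z: poisson_channel T Qz az lz
  for T Qy Qz ay ly az lz
begin

abbreviation chan :: "(real \<Rightarrow> real) measure \<Rightarrow> ((real \<Rightarrow> real) \<times> (real \<Rightarrow> real) \<times> (real \<Rightarrow> real)) measure" where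
  "chan \<equiv> channel_law T ay ly az lz Qy Qz"

abbreviation outs :: "((real \<Rightarrow> real) \<times> (real \<Rightarrow> real)) measure" where
  "outs \<equiv> output_space T \<Otimes>\<^sub>M output_space T"

lemma sets_Qyz: "sets (Qy \<Otimes>\<^sub>M Qz) = sets outs"
  by (rule sets_pair_measure_cong[OF y.sets_Q z.sets_Q])

lemma sets_chan:
  assumes "sets \<rho> = sets (input_space T)"
  shows "sets (chan \<rho>) = sets (input_space T \<Otimes>\<^sub>M outs)"
  unfolding channel_law_def sets_density by (rule sets_pair_measure_cong[OF assms sets_Qyz])

lemma space_chan:
  assumes "sets \<rho> = sets (input_space T)"
  shows "space (chan \<rho>) = input_paths T \<times> count_paths T \<times> count_paths T"
  using sets_eq_imp_space_eq[OF sets_chan[OF assms]] by (simp add: space_pair_measure)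

lemma lik_measurable:
  assumes "sets \<rho> = sets (input_space T)"
  shows "(\<lambda>(x, y, z). likelihood T ay ly x y * likelihood T az lz x z) \<in> borel_measurable (\<rho> \<Otimes>\<^sub>M (Qy \<Otimes>\<^sub>M Qz))"
proof -
  have s: "sets (\<rho> \<Otimes>\<^sub>M (Qy \<Otimes>\<^sub>M Qz)) = sets (input_space T \<Otimes>\<^sub>M (Qy \<Otimes>\<^sub>M Qz))"
    by (rule sets_pair_measure_cong[OF assms refl])
  have "(\<lambda>p. (\<lambda>(x, u). likelihood T ay ly x u) (fst p, fst (snd p)) * (\<lambda>(x, u). likelihood T az lz x u) (fst p, snd (snd p)))
      \<in> borel_measurable (input_space T \<Otimes>\<^sub>M (Qy \<Otimes>\<^sub>M Qz))"
    by (intro borel_measurable_times_ennreal measurable_compose[OF _ y.likelihood_measurable]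
        measurable_compose[OF _ z.likelihood_measurable]) measurable
  then show ?thesis unfolding measurable_cong_sets[OF s refl] by (simp add: case_prod_unfold)
qed

text \<open>Given the input, the density is a product in the two outputs, so the inner integral
  factors: the outputs are conditionally independent.\<close>

lemma emeasure_chan_rect:
  assumes \<rho>: "sets \<rho> = sets (input_space T)"
    and b: "b \<in> sets (input_space T)" and c: "c \<in> sets Qy" and d: "d \<in> sets Qz"
  shows "emeasure (chan \<rho>) (b \<times> c \<times> d) = (\<integral>\<^sup>+x. indicator b x * (y.out_prob x c * z.out_prob x d) \<partial>\<rho>)"
proof -
  have [measurable]: "b \<in> sets \<rho>" using b \<rho> by simp
  note [measurable] = c d
  have sp: "space \<rho> = input_paths T" using sets_eq_imp_space_eq[OF \<rho>] by simp
  interpret yz: pair_sigma_finite Qy Qz ..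
  have L: "(\<lambda>(x, y, z). likelihood T ay ly x y * likelihood T az lz x z) \<in> borel_measurable (\<rho> \<Otimes>\<^sub>M (Qy \<Otimes>\<^sub>M Qz))"
    by (rule lik_measurable[OF \<rho>])
  let ?F = "\<lambda>p. (case p of (x, y, z) \<Rightarrow> likelihood T ay ly x y * likelihood T az lz x z) * indicator (b \<times> c \<times> d) p"
  have "emeasure (chan \<rho>) (b \<times> c \<times> d) = (\<integral>\<^sup>+p. ?F p \<partial>(\<rho> \<Otimes>\<^sub>M (Qy \<Otimes>\<^sub>M Qz)))"
    unfolding channel_law_def by (rule emeasure_density[OF L]) measurable
  also have "\<dots> = (\<integral>\<^sup>+x. \<integral>\<^sup>+q. ?F (x, q) \<partial>(Qy \<Otimes>\<^sub>M Qz) \<partial>\<rho>)"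
  proof (rule yz.nn_integral_fst[symmetric])
    have [measurable]: "b \<times> c \<times> d \<in> sets (\<rho> \<Otimes>\<^sub>M (Qy \<Otimes>\<^sub>M Qz))" by measurable
    show "?F \<in> borel_measurable (\<rho> \<Otimes>\<^sub>M (Qy \<Otimes>\<^sub>M Qz))"
      by (intro borel_measurable_times_ennreal L) measurable
  qed
  also have "\<dots> = (\<integral>\<^sup>+x. indicator b x * (y.out_prob x c * z.out_prob x d) \<partial>\<rho>)"
  proof (rule nn_integral_cong)
    fix x assume "x \<in> space \<rho>"
    then have x: "x \<in> space (input_space T)" using sp by simp
    have ym: "(\<lambda>u. likelihood T ay ly x u * indicator c u) \<in> borel_measurable Qy"
      using measurable_compose[OF measurable_Pair1'[OF x] y.likelihood_indicator_measurable[OF c]] by simp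
    have zm: "(\<lambda>u. likelihood T az lz x u * indicator d u) \<in> borel_measurable Qz"
      using measurable_compose[OF measurable_Pair1'[OF x] z.likelihood_indicator_measurable[OF d]] by simp
    let ?G = "\<lambda>q. indicator b x * ((likelihood T ay ly x (fst q) * indicator c (fst q)) * (likelihood T az lz x (snd q) * indicator d (snd q)))"
    have "(\<integral>\<^sup>+q. ?F (x, q) \<partial>(Qy \<Otimes>\<^sub>M Qz)) = (\<integral>\<^sup>+q. ?G q \<partial>(Qy \<Otimes>\<^sub>M Qz))"
      by (intro nn_integral_cong) (auto simp: indicator_def)
    also have "\<dots> = (\<integral>\<^sup>+u. \<integral>\<^sup>+v. ?G (u, v) \<partial>Qz \<partial>Qy)"
    proof (rule z.nn_integral_fst[symmetric])
      show "?G \<in> borel_measurable (Qy \<Otimes>\<^sub>M Qz)"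
        by (intro borel_measurable_times_ennreal borel_measurable_const measurable_compose[OF measurable_fst ym] measurable_compose[OF measurable_snd zm])
    qed
    also have "\<dots> = (\<integral>\<^sup>+u. indicator b x * ((likelihood T ay ly x u * indicator c u) * z.out_prob x d) \<partial>Qy)"
      using zm by (simp add: z.out_prob_def nn_integral_cmult)
    also have "\<dots> = indicator b x * (y.out_prob x c * z.out_prob x d)"
      using ym by (simp add: y.out_prob_def nn_integral_cmult nn_integral_multc)
    finally show "(\<integral>\<^sup>+q. ?F (x, q) \<partial>(Qy \<Otimes>\<^sub>M Qz)) = indicator b x * (y.out_prob x c * z.out_prob x d)" .
  qed
  finally show ?thesis .
qed

text \<open>The likelihood of the receiver that is not observed integrates to 1 for every input, so
  each receiver has its own marginal channel.\<close>

lemma emeasure_chan: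
  assumes \<rho>: "sets \<rho> = sets (input_space T)" and b: "b \<in> sets (input_space T)"
  shows "c \<in> sets Qy \<Longrightarrow> emeasure (chan \<rho>) (b \<times> c \<times> count_paths T) = (\<integral>\<^sup>+x. indicator b x * y.out_prob x c \<partial>\<rho>)"
    "d \<in> sets Qz \<Longrightarrow> emeasure (chan \<rho>) (b \<times> count_paths T \<times> d) = (\<integral>\<^sup>+x. indicator b x * z.out_prob x d \<partial>\<rho>)"
proof -
  have sp: "space \<rho> = input_paths T" using sets_eq_imp_space_eq[OF \<rho>] by simp
  have "count_paths T \<in> sets Qy" "count_paths T \<in> sets Qz" using sets.top[of Qy] sets.top[of Qz] by simp_all
  then show "c \<in> sets Qy \<Longrightarrow> emeasure (chan \<rho>) (b \<times> c \<times> count_paths T) = (\<integral>\<^sup>+x. indicator b x * y.out_prob x c \<partial>\<rho>)"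
    "d \<in> sets Qz \<Longrightarrow> emeasure (chan \<rho>) (b \<times> count_paths T \<times> d) = (\<integral>\<^sup>+x. indicator b x * z.out_prob x d \<partial>\<rho>)"
    using emeasure_chan_rect[OF \<rho> b] y.out_prob_space z.out_prob_space sp by (auto intro!: nn_integral_cong)
qed

lemma prob_space_chan:
  assumes "\<rho> \<in> space (prob_algebra (input_space T))"
  shows "prob_space (chan \<rho>)"
proof (rule prob_spaceI)
  have \<rho>: "sets \<rho> = sets (input_space T)" "prob_space \<rho>" using assms by (auto simp: space_prob_algebra)
  interpret r: prob_space \<rho> by (rule \<rho>(2))
  have sp: "space \<rho> = input_paths T" using sets_eq_imp_space_eq[OF \<rho>(1)] by simp
  have top: "input_paths T \<in> sets (input_space T)" using sets.top[of "input_space T"] by simp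
  have "count_paths T \<in> sets Qy" using sets.top[of Qy] by simp
  note e = emeasure_chan(1)[OF \<rho>(1) top this]
  have "(\<integral>\<^sup>+x. indicator (input_paths T) x * y.out_prob x (count_paths T) \<partial>\<rho>) = (\<integral>\<^sup>+x. 1 \<partial>\<rho>)"
    using y.out_prob_space by (intro nn_integral_cong) (simp add: sp)
  then show "emeasure (chan \<rho>) (space (chan \<rho>)) = 1"
    unfolding space_chan[OF \<rho>(1)] e by (simp only: nn_integral_const r.emeasure_space_1 mult_1)
qed

end

text \<open>Shows that there is an input at all, without which the projections to the output
  components would not be onto.\<close>

lemma zero_input_path: "0 < T \<Longrightarrow> (\<lambda>t\<in>{0..T}. 0) \<in> input_paths T"
proof -
  assume T: "0 < T"
  have "((\<lambda>t\<in>{0..T}. 0) \<longlongrightarrow> (0::real)) (at_right t)" if "t \<in> {0..<T}" for t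
  proof (rule tendsto_eventually)
    have "eventually (\<lambda>s. s \<in> {t<..<T}) (at_right t)" using that by (intro eventually_at_rightI[of _ T]) auto
    then show "eventually (\<lambda>s. (\<lambda>t\<in>{0..T}. 0) s = (0::real)) (at_right t)" by eventually_elim (use that in auto)
  qed
  moreover have "((\<lambda>t\<in>{0..T}. 0) \<longlongrightarrow> (0::real)) (at_left t)" if "t \<in> {0<..T}" for t
  proof (rule tendsto_eventually)
    have "eventually (\<lambda>s. s \<in> {0<..<t}) (at_left t)" using that by (intro eventually_at_leftI[of 0]) auto
    then show "eventually (\<lambda>s. (\<lambda>t\<in>{0..T}. 0) s = (0::real)) (at_left t)" by eventually_elim (use that in auto)
  qed
  ultimately show ?thesis unfolding input_paths_def cadlag_on_def by fastforce
qed

context two_receivers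
begin

lemma paths_nonempty: "\<exists>x. x \<in> input_paths T" "\<exists>u. u \<in> count_paths T"
  using zero_input_path[OF y.T] y.not_empty by auto

lemma measure_cell_eqI:
  "emeasure P X = ennreal (y.cell \<rho> c) \<Longrightarrow> input_measure T \<rho> \<Longrightarrow> measure P X = y.cell \<rho> c"
  "emeasure P X = ennreal (z.cell \<rho> c) \<Longrightarrow> input_measure T \<rho> \<Longrightarrow> measure P X = z.cell \<rho> c"
  by (simp_all add: measure_def y.cell_nonneg z.cell_nonneg)

lemma input_measure_density:
  assumes \<rho>: "\<rho> \<in> space (prob_algebra (input_space T))" and a: "a \<in> sets (input_space T)"
  shows "input_measure T (density \<rho> (indicator a))"
proof -
  have r: "sets \<rho> = sets (input_space T)" "prob_space \<rho>" using \<rho> by (auto simp: space_prob_algebra)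
  interpret r: prob_space \<rho> by (rule r(2))
  have "emeasure (density \<rho> (indicator a)) (space \<rho>) = emeasure \<rho> (a \<inter> space \<rho>)"
    using a r(1) by (subst emeasure_density) (auto simp: nn_integral_indicator Int_commute indicator_inter_arith[symmetric] intro!: nn_integral_cong)
  then show ?thesis unfolding input_measure_def using r(1) by (auto intro!: finite_measureI)
qed

lemma mutual_info_chan:
  assumes \<rho>: "\<rho> \<in> space (prob_algebra (input_space T))"
  shows "mutual_info (chan \<rho>) (input_space T) (\<lambda>(x, y, z). x) (output_space T) (\<lambda>(x, y, z). y) =
      (SUP (\<A>, \<C>) \<in> fin_parts (input_space T) \<times> fin_parts Qy. ereal (y.pinfo \<A> (\<lambda>a. density \<rho> (indicator a)) \<C>))"
    "mutual_info (chan \<rho>) (input_space T) (\<lambda>(x, y, z). x) (output_space T) (\<lambda>(x, y, z). z) =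
      (SUP (\<A>, \<C>) \<in> fin_parts (input_space T) \<times> fin_parts Qz. ereal (z.pinfo \<A> (\<lambda>a. density \<rho> (indicator a)) \<C>))"
proof -
  have r: "sets \<rho> = sets (input_space T)" using \<rho> by (auto simp: space_prob_algebra)
  have dens: "(\<integral>\<^sup>+x. h x \<partial>density \<rho> (indicator a)) = (\<integral>\<^sup>+x. indicator a x * h x \<partial>\<rho>)"
    if "a \<in> sets (input_space T)" "h \<in> borel_measurable (input_space T)" for a and h :: "(real \<Rightarrow> real) \<Rightarrow> ennreal"
    using that r measurable_cong_sets[OF r refl, of borel] by (subst nn_integral_density) auto
  note sp = space_chan[OF r] and st = sets_chan[OF r]
  have mx: "(\<lambda>(x, y, z). x) \<in> chan \<rho> \<rightarrow>\<^sub>M input_space T"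
    and my: "(\<lambda>(x, y, z). y) \<in> chan \<rho> \<rightarrow>\<^sub>M output_space T"
    and mz: "(\<lambda>(x, y, z). z) \<in> chan \<rho> \<rightarrow>\<^sub>M output_space T"
    unfolding measurable_cong_sets[OF st refl] by measurable
  have ix: "(\<lambda>(x, y, z). x) ` space (chan \<rho>) = space (input_space T)"
    and iy: "(\<lambda>(x, y, z). y) ` space (chan \<rho>) = count_paths T"
    and iz: "(\<lambda>(x, y, z). z) ` space (chan \<rho>) = count_paths T"
    unfolding sp using paths_nonempty by force+
  have sub: "b \<subseteq> input_paths T" if "b \<in> sets (input_space T)" for b using sets.sets_into_space[OF that] by simp
  show "mutual_info (chan \<rho>) (input_space T) (\<lambda>(x, y, z). x) (output_space T) (\<lambda>(x, y, z). y) =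
      (SUP (\<A>, \<C>) \<in> fin_parts (input_space T) \<times> fin_parts Qy. ereal (y.pinfo \<A> (\<lambda>a. density \<rho> (indicator a)) \<C>))"
  proof (rule y.mutual_info_pinfo[OF prob_space_chan[OF \<rho>] ix mx iy my input_measure_density[OF \<rho>]])
    fix a c assume a: "a \<in> sets (input_space T)" and c: "c \<in> sets Qy"
    have "c \<subseteq> count_paths T" using sets.sets_into_space[OF c] by simp
    then have eq: "preim (chan \<rho>) (\<lambda>(x, y, z). x) a \<inter> preim (chan \<rho>) (\<lambda>(x, y, z). y) c = a \<times> c \<times> count_paths T"
      using sub[OF a] unfolding preim_def sp by auto
    show "measure (chan \<rho>) (preim (chan \<rho>) (\<lambda>(x, y, z). x) a \<inter> preim (chan \<rho>) (\<lambda>(x, y, z). y) c) = y.cell (density \<rho> (indicator a)) c"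
      unfolding eq
      by (intro measure_cell_eqI(1) input_measure_density \<rho> a)
        (simp only: emeasure_chan(1)[OF r a c] dens[OF a y.out_prob_measurable[OF c], symmetric]
        y.cell_eq_out_prob[OF input_measure_density[OF \<rho> a] c, symmetric])
  qed
  show "mutual_info (chan \<rho>) (input_space T) (\<lambda>(x, y, z). x) (output_space T) (\<lambda>(x, y, z). z) =
      (SUP (\<A>, \<C>) \<in> fin_parts (input_space T) \<times> fin_parts Qz. ereal (z.pinfo \<A> (\<lambda>a. density \<rho> (indicator a)) \<C>))"
  proof (rule z.mutual_info_pinfo[OF prob_space_chan[OF \<rho>] ix mx iz mz input_measure_density[OF \<rho>]])
    fix a c assume a: "a \<in> sets (input_space T)" and c: "c \<in> sets Qz"
    have "c \<subseteq> count_paths T" using sets.sets_into_space[OF c] by simp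
    then have eq: "preim (chan \<rho>) (\<lambda>(x, y, z). x) a \<inter> preim (chan \<rho>) (\<lambda>(x, y, z). z) c = a \<times> count_paths T \<times> c"
      using sub[OF a] unfolding preim_def sp by auto
    show "measure (chan \<rho>) (preim (chan \<rho>) (\<lambda>(x, y, z). x) a \<inter> preim (chan \<rho>) (\<lambda>(x, y, z). z) c) = z.cell (density \<rho> (indicator a)) c"
      unfolding eq
      by (intro measure_cell_eqI(2) input_measure_density \<rho> a)
        (simp only: emeasure_chan(2)[OF r a c] dens[OF a z.out_prob_measurable[OF c], symmetric]
        z.cell_eq_out_prob[OF input_measure_density[OF \<rho> a] c, symmetric])
  qed
qed

text \<open>The monadic bind in the joint law is a genuine mixture only for a measurable kernel.
  Measurability reduces by Tonelli's theorem to integrating a fixed measurable function of the input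
  against \<open>\<mu> m\<close>.\<close>

lemma chan_kernel:
  assumes \<mu>: "\<mu> \<in> \<nu> \<rightarrow>\<^sub>M prob_algebra (input_space T)"
  shows "(\<lambda>m. chan (\<mu> m)) \<in> \<nu> \<rightarrow>\<^sub>M subprob_algebra (input_space T \<Otimes>\<^sub>M outs)"
proof (rule measurable_subprob_algebra)
  interpret yz: pair_sigma_finite Qy Qz ..
  have \<mu>m: "\<mu> m \<in> space (prob_algebra (input_space T))" if "m \<in> space \<nu>" for m using measurable_space[OF \<mu> that] .
  then have s: "sets (\<mu> m) = sets (input_space T)" if "m \<in> space \<nu>" for m using that by (auto simp: space_prob_algebra)
  fix m assume m: "m \<in> space \<nu>"
  show "subprob_space (chan (\<mu> m))" by (intro prob_space_imp_subprob_space prob_space_chan \<mu>m m)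
  show "sets (chan (\<mu> m)) = sets (input_space T \<Otimes>\<^sub>M outs)" by (rule sets_chan[OF s[OF m]])
next
  interpret yz: pair_sigma_finite Qy Qz ..
  have \<mu>m: "\<mu> m \<in> space (prob_algebra (input_space T))" if "m \<in> space \<nu>" for m using measurable_space[OF \<mu> that] .
  then have s: "sets (\<mu> m) = sets (input_space T)" if "m \<in> space \<nu>" for m using that by (auto simp: space_prob_algebra)
  fix A assume A: "A \<in> sets (input_space T \<Otimes>\<^sub>M outs)"
  let ?F = "\<lambda>p. (case p of (x, y, z) \<Rightarrow> likelihood T ay ly x y * likelihood T az lz x z) * indicator A p"
  have A': "A \<in> sets (\<rho> \<Otimes>\<^sub>M (Qy \<Otimes>\<^sub>M Qz))" if "sets \<rho> = sets (input_space T)" for \<rho>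
    using A sets_pair_measure_cong[OF that sets_Qyz] by simp
  have F: "?F \<in> borel_measurable (\<rho> \<Otimes>\<^sub>M (Qy \<Otimes>\<^sub>M Qz))" if "sets \<rho> = sets (input_space T)" for \<rho>
    by (intro borel_measurable_times_ennreal lik_measurable[OF that] borel_measurable_indicator A'[OF that])
  have eq: "emeasure (chan (\<mu> m)) A = (\<integral>\<^sup>+x. \<integral>\<^sup>+q. ?F (x, q) \<partial>(Qy \<Otimes>\<^sub>M Qz) \<partial>\<mu> m)" if m: "m \<in> space \<nu>" for m
  proof -
    have "emeasure (chan (\<mu> m)) A = (\<integral>\<^sup>+p. ?F p \<partial>(\<mu> m \<Otimes>\<^sub>M (Qy \<Otimes>\<^sub>M Qz)))"
      unfolding channel_law_def by (rule emeasure_density[OF lik_measurable[OF s[OF m]] A'[OF s[OF m]]])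
    then show ?thesis using yz.nn_integral_fst[OF F[OF s[OF m]]] by simp
  qed
  have "(\<lambda>x. \<integral>\<^sup>+q. ?F (x, q) \<partial>(Qy \<Otimes>\<^sub>M Qz)) \<in> borel_measurable (input_space T)"
    by (rule yz.borel_measurable_nn_integral_fst[OF F[OF refl]])
  then have "(\<lambda>m. \<integral>\<^sup>+x. \<integral>\<^sup>+q. ?F (x, q) \<partial>(Qy \<Otimes>\<^sub>M Qz) \<partial>\<mu> m) \<in> borel_measurable \<nu>"
    by (intro measurable_compose[OF measurable_prob_algebraD[OF \<mu>]] nn_integral_measurable_subprob_algebra)
  then show "(\<lambda>m. emeasure (chan (\<mu> m)) A) \<in> borel_measurable \<nu>"
    using measurable_cong[where M=\<nu> and M'=borel and f="\<lambda>m. emeasure (chan (\<mu> m)) A"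
        and g="\<lambda>m. \<integral>\<^sup>+x. \<integral>\<^sup>+q. ?F (x, q) \<partial>(Qy \<Otimes>\<^sub>M Qz) \<partial>\<mu> m", OF eq] by blast
qed

section \<open>Mutual information between a message and an output\<close>

abbreviation joint :: "'m measure \<Rightarrow> ('m \<Rightarrow> (real \<Rightarrow> real) measure) \<Rightarrow> ('m \<times> (real \<Rightarrow> real) \<times> (real \<Rightarrow> real) \<times> (real \<Rightarrow> real)) measure" where
  "joint \<equiv> joint_law T ay ly az lz Qy Qz"

context
  fixes \<nu> :: "'m measure" and \<mu>
  assumes \<nu>: "prob_space \<nu>" and \<mu>: "\<mu> \<in> \<nu> \<rightarrow>\<^sub>M prob_algebra (input_space T)"
begin

interpretation \<nu>: prob_space \<nu> by (rule \<nu>)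

text \<open>The (sub-probability) law of the input on the event that the message lies in \<open>a\<close>.\<close>

definition message_input :: "'m set \<Rightarrow> (real \<Rightarrow> real) measure" where
  "message_input a = density \<nu> (indicator a) \<bind> \<mu>"

lemma kernel_in: "m \<in> space \<nu> \<Longrightarrow> \<mu> m \<in> space (prob_algebra (input_space T))"
  using measurable_space[OF \<mu>] .

lemma sets_kernel: "m \<in> space \<nu> \<Longrightarrow> sets (\<mu> m) = sets (input_space T)"
  using kernel_in by (auto simp: space_prob_algebra)

lemma kernel_density: "\<mu> \<in> density \<nu> f \<rightarrow>\<^sub>M subprob_algebra (input_space T)"
  using measurable_prob_algebraD[OF \<mu>] by simp

lemma nn_integral_message_input:
  assumes a: "a \<in> sets \<nu>" and h: "h \<in> borel_measurable (input_space T)"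
  shows "(\<integral>\<^sup>+x. h x \<partial>message_input a) = (\<integral>\<^sup>+m. indicator a m * (\<integral>\<^sup>+x. h x \<partial>\<mu> m) \<partial>\<nu>)"
proof -
  have "(\<lambda>m. \<integral>\<^sup>+x. h x \<partial>\<mu> m) \<in> borel_measurable \<nu>"
    by (intro measurable_compose[OF measurable_prob_algebraD[OF \<mu>]] nn_integral_measurable_subprob_algebra h)
  then show ?thesis
    unfolding message_input_def nn_integral_bind[OF h kernel_density] using a by (subst nn_integral_density) auto
qed

lemma input_measure_message_input:
  assumes a: "a \<in> sets \<nu>"
  shows "input_measure T (message_input a)"
proof -
  have s: "sets (message_input a) = sets (input_space T)"
    unfolding message_input_def using sets_kernel \<nu>.not_empty by (intro sets_bind) auto
  have "emeasure (message_input a) (space (message_input a)) = (\<integral>\<^sup>+x. 1 \<partial>message_input a)" by simp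
  also have "\<dots> = (\<integral>\<^sup>+m. indicator a m * (\<integral>\<^sup>+x. 1 \<partial>\<mu> m) \<partial>\<nu>)" by (rule nn_integral_message_input[OF a]) simp
  also have "\<dots> \<le> (\<integral>\<^sup>+m. 1 \<partial>\<nu>)"
  proof (rule nn_integral_mono)
    fix m assume "m \<in> space \<nu>"
    then have "prob_space (\<mu> m)" using kernel_in by (simp add: space_prob_algebra)
    then have "(\<integral>\<^sup>+x. 1 \<partial>\<mu> m) = 1" by (simp add: prob_space.emeasure_space_1)
    then show "indicator a m * (\<integral>\<^sup>+x. 1 \<partial>\<mu> m) \<le> 1" by (simp only:) (simp add: indicator_def)
  qed
  also have "\<dots> < \<infinity>" by (simp add: \<nu>.emeasure_space_1)
  finally show ?thesis unfolding input_measure_def using s by (auto intro!: finite_measureI)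
qed

lemma joint_kernel:
  "(\<lambda>m. distr (chan (\<mu> m)) (\<nu> \<Otimes>\<^sub>M (input_space T \<Otimes>\<^sub>M outs)) (\<lambda>(x, y, z). (m, x, y, z))) \<in>
    \<nu> \<rightarrow>\<^sub>M subprob_algebra (\<nu> \<Otimes>\<^sub>M (input_space T \<Otimes>\<^sub>M outs))"
  by (rule measurable_distr2[OF _ chan_kernel[OF \<mu>]]) (simp add: case_prod_unfold)

lemma sets_joint: "sets (joint \<nu> \<mu>) = sets (\<nu> \<Otimes>\<^sub>M (input_space T \<Otimes>\<^sub>M outs))"
  unfolding joint_law_def using \<nu>.not_empty by (intro sets_bind) auto

lemma space_joint: "space (joint \<nu> \<mu>) = space \<nu> \<times> input_paths T \<times> count_paths T \<times> count_paths T"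
  using sets_eq_imp_space_eq[OF sets_joint] by (simp add: space_pair_measure)

lemma emeasure_joint:
  assumes a: "a \<in> sets \<nu>" and B: "B \<in> sets (input_space T \<Otimes>\<^sub>M outs)"
  shows "emeasure (joint \<nu> \<mu>) (a \<times> B) = (\<integral>\<^sup>+m. indicator a m * emeasure (chan (\<mu> m)) B \<partial>\<nu>)"
proof -
  have aB: "a \<times> B \<in> sets (\<nu> \<Otimes>\<^sub>M (input_space T \<Otimes>\<^sub>M outs))" using a B by simp
  have "emeasure (joint \<nu> \<mu>) (a \<times> B) = (\<integral>\<^sup>+m. emeasure (distr (chan (\<mu> m)) (\<nu> \<Otimes>\<^sub>M (input_space T \<Otimes>\<^sub>M outs)) (\<lambda>(x, y, z). (m, x, y, z))) (a \<times> B) \<partial>\<nu>)"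
    unfolding joint_law_def by (rule emeasure_bind[OF \<nu>.not_empty joint_kernel aB])
  also have "\<dots> = (\<integral>\<^sup>+m. indicator a m * emeasure (chan (\<mu> m)) B \<partial>\<nu>)"
  proof (rule nn_integral_cong)
    fix m assume m: "m \<in> space \<nu>"
    have eq: "(\<lambda>(x, y, z). (m, x, y, z)) = Pair m" by (auto simp: fun_eq_iff)
    have "Pair m \<in> chan (\<mu> m) \<rightarrow>\<^sub>M (\<nu> \<Otimes>\<^sub>M (input_space T \<Otimes>\<^sub>M outs))"
      unfolding measurable_cong_sets[OF sets_chan[OF sets_kernel[OF m]] refl] by (rule measurable_Pair1'[OF m])
    then have "emeasure (distr (chan (\<mu> m)) (\<nu> \<Otimes>\<^sub>M (input_space T \<Otimes>\<^sub>M outs)) (Pair m)) (a \<times> B) =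
        emeasure (chan (\<mu> m)) (Pair m -` (a \<times> B) \<inter> space (chan (\<mu> m)))" by (rule emeasure_distr[OF _ aB])
    also have "Pair m -` (a \<times> B) \<inter> space (chan (\<mu> m)) = (if m \<in> a then B else {})"
      using sets.sets_into_space[OF B] sets_eq_imp_space_eq[OF sets_chan[OF sets_kernel[OF m]]] by auto
    finally show "emeasure (distr (chan (\<mu> m)) (\<nu> \<Otimes>\<^sub>M (input_space T \<Otimes>\<^sub>M outs)) (\<lambda>(x, y, z). (m, x, y, z))) (a \<times> B) =
        indicator a m * emeasure (chan (\<mu> m)) B" unfolding eq by simp
  qed
  finally show ?thesis .
qed

text \<open>The Markov property: given the input, the message has no further influence on the
  output, so the event that it lies in \<open>a\<close> matters only through
  \<open>message_input a\<close>.\<close>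

lemma emeasure_joint_cell:
  assumes a: "a \<in> sets \<nu>"
  shows "c \<in> sets Qy \<Longrightarrow> emeasure (joint \<nu> \<mu>) (a \<times> input_paths T \<times> c \<times> count_paths T) = ennreal (y.cell (message_input a) c)"
    "d \<in> sets Qz \<Longrightarrow> emeasure (joint \<nu> \<mu>) (a \<times> input_paths T \<times> count_paths T \<times> d) = ennreal (z.cell (message_input a) d)"
proof -
  have tx: "input_paths T \<in> sets (input_space T)" using sets.top[of "input_space T"] by simp
  have tu: "count_paths T \<in> sets (output_space T)" using sets.top[of "output_space T"] by simp
  have red: "emeasure (joint \<nu> \<mu>) (a \<times> B) = (\<integral>\<^sup>+x. h x \<partial>message_input a)"
    if B: "B \<in> sets (input_space T \<Otimes>\<^sub>M outs)" and h: "h \<in> borel_measurable (input_space T)"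
      and e: "\<And>m. m \<in> space \<nu> \<Longrightarrow> emeasure (chan (\<mu> m)) B = (\<integral>\<^sup>+x. indicator (input_paths T) x * h x \<partial>\<mu> m)" for B h
    unfolding emeasure_joint[OF a B] nn_integral_message_input[OF a h]
  proof (rule nn_integral_cong)
    fix m assume m: "m \<in> space \<nu>"
    have "space (\<mu> m) = input_paths T" using sets_eq_imp_space_eq[OF sets_kernel[OF m]] by simp
    then have "emeasure (chan (\<mu> m)) B = (\<integral>\<^sup>+x. h x \<partial>\<mu> m)"
      unfolding e[OF m] by (intro nn_integral_cong) simp
    then show "indicator a m * emeasure (chan (\<mu> m)) B = indicator a m * (\<integral>\<^sup>+x. h x \<partial>\<mu> m)" by simp
  qed
  show "emeasure (joint \<nu> \<mu>) (a \<times> input_paths T \<times> c \<times> count_paths T) = ennreal (y.cell (message_input a) c)"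
    if c: "c \<in> sets Qy"
    unfolding y.cell_eq_out_prob[OF input_measure_message_input[OF a] c, symmetric]
  proof (rule red)
    show "input_paths T \<times> c \<times> count_paths T \<in> sets (input_space T \<Otimes>\<^sub>M outs)" using tx tu c y.sets_Q by simp
  qed (use y.out_prob_measurable[OF c] emeasure_chan(1)[OF sets_kernel tx c] in auto)
  show "emeasure (joint \<nu> \<mu>) (a \<times> input_paths T \<times> count_paths T \<times> d) = ennreal (z.cell (message_input a) d)"
    if d: "d \<in> sets Qz"
    unfolding z.cell_eq_out_prob[OF input_measure_message_input[OF a] d, symmetric]
  proof (rule red)
    show "input_paths T \<times> count_paths T \<times> d \<in> sets (input_space T \<Otimes>\<^sub>M outs)" using tx tu d z.sets_Q by simp
  qed (use z.out_prob_measurable[OF d] emeasure_chan(2)[OF sets_kernel tx d] in auto)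
qed

lemma prob_space_joint: "prob_space (joint \<nu> \<mu>)"
proof (rule prob_spaceI)
  have B: "space (input_space T \<Otimes>\<^sub>M outs) \<in> sets (input_space T \<Otimes>\<^sub>M outs)" by (rule sets.top)
  have "emeasure (joint \<nu> \<mu>) (space (joint \<nu> \<mu>)) = (\<integral>\<^sup>+m. indicator (space \<nu>) m * emeasure (chan (\<mu> m)) (space (input_space T \<Otimes>\<^sub>M outs)) \<partial>\<nu>)"
    using emeasure_joint[OF sets.top B] sets_eq_imp_space_eq[OF sets_joint] by (simp add: space_pair_measure)
  also have "\<dots> = (\<integral>\<^sup>+m. 1 \<partial>\<nu>)"
  proof (rule nn_integral_cong)
    fix m assume m: "m \<in> space \<nu>"
    have "space (input_space T \<Otimes>\<^sub>M outs) = space (chan (\<mu> m))"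
      using sets_eq_imp_space_eq[OF sets_chan[OF sets_kernel[OF m]]] by simp
    then show "indicator (space \<nu>) m * emeasure (chan (\<mu> m)) (space (input_space T \<Otimes>\<^sub>M outs)) = 1"
      using m prob_space.emeasure_space_1[OF prob_space_chan[OF kernel_in[OF m]]] by simp
  qed
  finally show "emeasure (joint \<nu> \<mu>) (space (joint \<nu> \<mu>)) = 1" by (simp add: \<nu>.emeasure_space_1)
qed

lemma mutual_info_joint:
  "mutual_info (joint \<nu> \<mu>) \<nu> (\<lambda>(m, x, y, z). m) (output_space T) (\<lambda>(m, x, y, z). y) =
      (SUP (\<A>, \<C>) \<in> fin_parts \<nu> \<times> fin_parts Qy. ereal (y.pinfo \<A> message_input \<C>))"
  "mutual_info (joint \<nu> \<mu>) \<nu> (\<lambda>(m, x, y, z). m) (output_space T) (\<lambda>(m, x, y, z). z) =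
      (SUP (\<A>, \<C>) \<in> fin_parts \<nu> \<times> fin_parts Qz. ereal (z.pinfo \<A> message_input \<C>))"
proof -
  let ?P = "joint \<nu> \<mu>"
  have mm: "(\<lambda>(m, x, y, z). m) \<in> ?P \<rightarrow>\<^sub>M \<nu>"
    and my: "(\<lambda>(m, x, y, z). y) \<in> ?P \<rightarrow>\<^sub>M output_space T"
    and mz: "(\<lambda>(m, x, y, z). z) \<in> ?P \<rightarrow>\<^sub>M output_space T"
    unfolding measurable_cong_sets[OF sets_joint refl] by measurable
  have im: "(\<lambda>(m, x, y, z). m) ` space ?P = space \<nu>"
    and iy: "(\<lambda>(m, x, y, z). y) ` space ?P = count_paths T"
    and iz: "(\<lambda>(m, x, y, z). z) ` space ?P = count_paths T"
    unfolding space_joint using paths_nonempty \<nu>.not_empty by force+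
  show "mutual_info ?P \<nu> (\<lambda>(m, x, y, z). m) (output_space T) (\<lambda>(m, x, y, z). y) =
      (SUP (\<A>, \<C>) \<in> fin_parts \<nu> \<times> fin_parts Qy. ereal (y.pinfo \<A> message_input \<C>))"
  proof (rule y.mutual_info_pinfo[OF prob_space_joint im mm iy my input_measure_message_input])
    fix a c assume a: "a \<in> sets \<nu>" and c: "c \<in> sets Qy"
    have eq: "preim ?P (\<lambda>(m, x, y, z). m) a \<inter> preim ?P (\<lambda>(m, x, y, z). y) c = a \<times> input_paths T \<times> c \<times> count_paths T"
      using sets.sets_into_space[OF a] sets.sets_into_space[OF c] unfolding preim_def space_joint by auto
    show "measure ?P (preim ?P (\<lambda>(m, x, y, z). m) a \<inter> preim ?P (\<lambda>(m, x, y, z). y) c) = y.cell (message_input a) c"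
      unfolding eq by (intro measure_cell_eqI(1) input_measure_message_input emeasure_joint_cell(1) a c)
  qed
  show "mutual_info ?P \<nu> (\<lambda>(m, x, y, z). m) (output_space T) (\<lambda>(m, x, y, z). z) =
      (SUP (\<A>, \<C>) \<in> fin_parts \<nu> \<times> fin_parts Qz. ereal (z.pinfo \<A> message_input \<C>))"
  proof (rule z.mutual_info_pinfo[OF prob_space_joint im mm iz mz input_measure_message_input])
    fix a c assume a: "a \<in> sets \<nu>" and c: "c \<in> sets Qz"
    have eq: "preim ?P (\<lambda>(m, x, y, z). m) a \<inter> preim ?P (\<lambda>(m, x, y, z). z) c = a \<times> input_paths T \<times> count_paths T \<times> c"
      using sets.sets_into_space[OF a] sets.sets_into_space[OF c] unfolding preim_def space_joint by auto
    show "measure ?P (preim ?P (\<lambda>(m, x, y, z). m) a \<inter> preim ?P (\<lambda>(m, x, y, z). z) c) = z.cell (message_input a) c"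
      unfolding eq by (intro measure_cell_eqI(2) input_measure_message_input emeasure_joint_cell(2) a c)
  qed
qed

end

section \<open>Sufficiency of convexity\<close>

text \<open>The partition on the message side is kept and the output partition of receiver 2 is
  replaced by one of receiver 1, at an arbitrarily small loss. The claims for messages and for
  inputs are its instances for two families \<open>\<rho>\<close>.\<close>

lemma SUP_pinfo_mono:
  assumes \<rho>: "\<And>a. a \<in> sets S \<Longrightarrow> input_measure T (\<rho> a)"
    and cvx: "convex_on {0..1} (\<lambda>x. phi ay ly x - phi az lz x)"
  shows "(SUP (\<A>, \<C>) \<in> fin_parts S \<times> fin_parts Qz. ereal (z.pinfo \<A> \<rho> \<C>)) \<le>
    (SUP (\<A>, \<C>) \<in> fin_parts S \<times> fin_parts Qy. ereal (y.pinfo \<A> \<rho> \<C>))"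
proof (rule SUP_least)
  fix p assume "p \<in> fin_parts S \<times> fin_parts Qz"
  then obtain \<A> \<C> where p: "p = (\<A>, \<C>)" "\<A> \<in> fin_parts S" "\<C> \<in> fin_parts Qz" by auto
  have I: "finite \<A>" and \<rho>': "\<And>a. a \<in> \<A> \<Longrightarrow> input_measure T (\<rho> a)" using p(2) \<rho> by (auto simp: fin_parts_def)
  have "ereal (z.pinfo \<A> \<rho> \<C>) \<le> (SUP (\<A>, \<C>) \<in> fin_parts S \<times> fin_parts Qy. ereal (y.pinfo \<A> \<rho> \<C>))"
  proof (rule ereal_le_epsilon)
    fix e :: ereal assume e: "0 < e"
    obtain r where r: "0 < r" "ereal r \<le> e" using e by (cases e) (auto intro: that[of 1])
    obtain \<D> where D: "\<D> \<in> fin_parts Qy" "z.pinfo \<A> \<rho> \<C> \<le> y.pinfo \<A> \<rho> \<D> + r"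
      by (rule pinfo_compare[where I=\<A> and \<rho>=\<rho>, OF y.poisson_channel_axioms z.poisson_channel_axioms I \<rho>' cvx p(3) r(1)])
    have "ereal (z.pinfo \<A> \<rho> \<C>) \<le> ereal (y.pinfo \<A> \<rho> \<D>) + ereal r" using D(2) by simp
    also have "\<dots> \<le> (SUP (\<A>, \<C>) \<in> fin_parts S \<times> fin_parts Qy. ereal (y.pinfo \<A> \<rho> \<C>)) + e"
      using p(2) D(1) r(2) by (intro add_mono SUP_upper2[of "(\<A>, \<D>)"]) auto
    finally show "ereal (z.pinfo \<A> \<rho> \<C>) \<le> (SUP (\<A>, \<C>) \<in> fin_parts S \<times> fin_parts Qy. ereal (y.pinfo \<A> \<rho> \<C>)) + e" .
  qed
  then show "(case p of (\<A>, \<C>) \<Rightarrow> ereal (z.pinfo \<A> \<rho> \<C>)) \<le> (SUP (\<A>, \<C>) \<in> fin_parts S \<times> fin_parts Qy. ereal (y.pinfo \<A> \<rho> \<C>))"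
    by (simp add: p(1))
qed

lemma convex_imp_less_noisy:
  assumes "convex_on {0..1} (\<lambda>x. phi ay ly x - phi az lz x)"
  shows "less_noisy TYPE('m) T ay ly az lz Qy Qz"
  unfolding less_noisy_def Let_def
  using SUP_pinfo_mono[OF input_measure_message_input assms] by (auto simp: mutual_info_joint)

lemma convex_imp_more_capable:
  assumes "convex_on {0..1} (\<lambda>x. phi ay ly x - phi az lz x)"
  shows "more_capable T ay ly az lz Qy Qz"
  unfolding more_capable_def Let_def
  using SUP_pinfo_mono[OF input_measure_density assms] by (auto simp: mutual_info_chan)

end

section \<open>Two-point inputs\<close>

text \<open>Chain rule over the slots, for an input that is determined by the label: a slot adds at
  most the information that it carries alone, because averaging over the previous outcomes can only
  decrease a Jensen gap of the convex \<open>\<phi>\<close>.\<close>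

lemma sum_hent_upper:
  assumes I: "finite I" and p: "\<And>i. i \<in> I \<Longrightarrow> 0 \<le> p i" and x: "\<And>i j. i \<in> I \<Longrightarrow> x j i \<in> {0..1}"
    and c: "0 \<le> a" "0 \<le> l" "0 < d" "d * (a + l) \<le> 1"
  shows "(\<Sum>S\<in>Pow {..<n}. hent I (\<lambda>i. p i * bprod {..<n} (\<lambda>j. d * (a * x j i + l)) S)) \<le>
    hent I p + (\<Sum>j<n. d * jgap I p (x j) (phi a l) + sum p I * (d * (a + l))\<^sup>2)"
proof (induction n)
  case 0
  then show ?case by (simp add: bprod_def)
next
  case (Suc n)
  have K: "finite {..<n}" "n \<notin> {..<n}" "{..<Suc n} = insert n {..<n}" by auto
  have rate: "d * (a * x j i + l) \<in> {0..1}" if "i \<in> I" for i j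
    using rate_range(3)[OF x[OF that]] c by simp
  define v where "v = (\<lambda>S i. p i * bprod {..<n} (\<lambda>j. d * (a * x j i + l)) S)"
  have v0: "0 \<le> v S i" if "i \<in> I" for S i
    unfolding v_def using p[OF that] bprod_bounds(1)[of "{..<n}" "\<lambda>j. d * (a * x j i + l)"] rate[OF that] by simp
  define V where "V = (\<lambda>S. sum (v S) I)"
  define m where "m = (\<lambda>S. (\<Sum>i\<in>I. v S i * x n i) / V S)"
  have V0: "0 \<le> V S" for S unfolding V_def using v0 by (intro sum_nonneg)
  have Vm: "V S * m S = (\<Sum>i\<in>I. v S i * x n i)" for S
  proof (cases "V S = 0")
    case True
    then have "\<And>i. i \<in> I \<Longrightarrow> v S i = 0" using I v0 by (simp add: V_def sum_nonneg_eq_0_iff)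
    then show ?thesis using True by simp
  qed (simp add: m_def)
  have sv: "(\<Sum>S\<in>Pow {..<n}. v S i) = p i" for i
    unfolding v_def by (simp add: sum_distrib_left[symmetric] sum_bprod)
  have svf: "(\<Sum>S\<in>Pow {..<n}. \<Sum>i\<in>I. v S i * f i) = (\<Sum>i\<in>I. p i * f i)" for f
    by (subst sum.swap) (simp add: sum_distrib_right[symmetric] sv)
  have sV: "(\<Sum>S\<in>Pow {..<n}. V S) = sum p I" unfolding V_def using svf[of "\<lambda>_. 1"] by simp
  have "0 \<le> jgap (Pow {..<n}) V m (phi a l)"
  proof (rule jgap_convex)
    show "convex_on {0..1} (phi a l)" by (rule convex_on_phi[OF c(1,2)])
    show "m S \<in> {0..1}" for S unfolding m_def V_def by (intro weighted_mean_range I v0 x)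
  qed (simp_all add: V0)
  moreover have "(\<Sum>S\<in>Pow {..<n}. V S * m S) = (\<Sum>i\<in>I. p i * x n i)" unfolding Vm by (rule svf)
  ultimately have conv: "sum p I * phi a l ((\<Sum>i\<in>I. p i * x n i) / sum p I) \<le> (\<Sum>S\<in>Pow {..<n}. V S * phi a l (m S))"
    unfolding jgap_def sV by simp
  \<comment> \<open>averaged over the outputs, the posterior Jensen gap is at most the prior one\<close>
  have jg: "(\<Sum>S\<in>Pow {..<n}. jgap I (v S) (x n) (phi a l)) \<le> jgap I p (x n) (phi a l)"
    using conv svf[of "\<lambda>i. phi a l (x n i)"] by (simp add: jgap_def sum_subtractf m_def V_def)
  have "(\<Sum>S\<in>Pow {..<Suc n}. hent I (\<lambda>i. p i * bprod {..<Suc n} (\<lambda>j. d * (a * x j i + l)) S)) =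
     (\<Sum>S\<in>Pow {..<n}. hent I (\<lambda>i. v S i * (1 - d * (a * x n i + l))) + hent I (\<lambda>i. v S i * (d * (a * x n i + l))))"
    unfolding K(3) sum_Pow_insert[OF K(1,2)]
    by (intro sum.cong refl arg_cong2[where f="(+)"] hent_cong) (auto simp: bprod_insert[OF K(1,2)] v_def)
  also have "\<dots> \<le> (\<Sum>S\<in>Pow {..<n}. hent I (v S) + d * jgap I (v S) (x n) (phi a l) + V S * (d * (a + l))\<^sup>2)"
  proof (rule sum_mono)
    fix S
    show "hent I (\<lambda>i. v S i * (1 - d * (a * x n i + l))) + hent I (\<lambda>i. v S i * (d * (a * x n i + l))) \<le>
      hent I (v S) + d * jgap I (v S) (x n) (phi a l) + V S * (d * (a + l))\<^sup>2"
      using hent_bernoulli[OF I, of "v S" "x n", OF v0 x c]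
        jgap_remainder[OF I, of "v S" "x n", OF v0 x c(1,2) less_imp_le[OF c(3)] c(4)]
      unfolding V_def by linarith
  qed
  also have "\<dots> = (\<Sum>S\<in>Pow {..<n}. hent I (v S)) + d * (\<Sum>S\<in>Pow {..<n}. jgap I (v S) (x n) (phi a l)) + sum p I * (d * (a + l))\<^sup>2"
    by (simp add: sum.distrib sum_distrib_left sV[symmetric] sum_distrib_right)
  also have "\<dots> \<le> (hent I p + (\<Sum>j<n. d * jgap I p (x j) (phi a l) + sum p I * (d * (a + l))\<^sup>2)) + d * jgap I p (x n) (phi a l) + sum p I * (d * (a + l))\<^sup>2"
    using Suc.IH mult_left_mono[OF jg less_imp_le[OF c(3)]] unfolding v_def by linarith
  finally show ?case by (simp add: algebra_simps)
qed

text \<open>The slots from \<open>m\<close> on are summed out: a new slot splits each term into the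
  parts \<open>s\<close> and \<open>1 - s\<close>.\<close>

lemma sum_bprod_survival:
  assumes "m \<le> n"
  shows "(\<Sum>S\<in>Pow {..<n}. if S \<inter> {..<m} = {} then bprod {..<n} s S else 0) = (\<Prod>j<m. 1 - s j)"
  using assms
proof (induction rule: dec_induct)
  case base
  have "(\<Sum>S\<in>Pow {..<m}. if S \<inter> {..<m} = {} then bprod {..<m} s S else 0) = (\<Sum>S\<in>Pow {..<m}. if S = {} then bprod {..<m} s {} else 0)"
    by (intro sum.cong) auto
  then show ?case by (simp add: bprod_def)
next
  case (step n)
  have K: "finite {..<n}" "n \<notin> {..<n}" "{..<Suc n} = insert n {..<n}" by auto
  have "(\<Sum>S\<in>Pow {..<Suc n}. if S \<inter> {..<m} = {} then bprod {..<Suc n} s S else 0) =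
    (\<Sum>S\<in>Pow {..<n}. if S \<inter> {..<m} = {} then bprod {..<n} s S else 0)"
    unfolding K(3) sum_Pow_insert[OF K(1,2)] using step.hyps
    by (intro sum.cong refl) (auto simp: bprod_insert[OF K(1,2)] algebra_simps)
  then show ?case using step.IH by simp
qed

text \<open>The log-sum inequality for weights \<open>w\<close>, by the same linear lower bound as
  for integrals. It expresses that merging labels loses information.\<close>

lemma log_sum_finite:
  fixes w f :: "'b \<Rightarrow> real"
  assumes "finite B" "\<And>b. b \<in> B \<Longrightarrow> 0 \<le> w b" "\<And>b. b \<in> B \<Longrightarrow> 0 \<le> f b" and c: "0 < c"
  shows "(\<Sum>b\<in>B. w b * f b) * ln ((\<Sum>b\<in>B. w b * f b) / (sum w B * c)) \<le> (\<Sum>b\<in>B. w b * (f b * ln (f b / c)))"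
proof -
  define A where "A = (\<Sum>b\<in>B. w b * f b)"
  have A0: "0 \<le> A" unfolding A_def using assms by (intro sum_nonneg) auto
  show ?thesis
  proof (cases "A = 0")
    case True
    then have "\<And>b. b \<in> B \<Longrightarrow> w b * f b = 0" using assms unfolding A_def by (subst (asm) sum_nonneg_eq_0_iff) auto
    then have "(\<Sum>b\<in>B. w b * (f b * ln (f b / c))) = 0" by (intro sum.neutral) force
    then show ?thesis using True by (simp add: A_def)
  next
    case False
    then have A: "0 < A" using A0 by simp
    have "0 \<le> sum w B" using assms by (intro sum_nonneg)
    moreover have "sum w B \<noteq> 0"
    proof
      assume "sum w B = 0"
      then have "\<And>b. b \<in> B \<Longrightarrow> w b = 0" using assms by (simp add: sum_nonneg_eq_0_iff)
      then have "A = 0" unfolding A_def by (intro sum.neutral) auto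
      then show False using A by simp
    qed
    ultimately have W: "0 < sum w B" by simp
    define r where "r = A / (sum w B * c)"
    have r: "0 < r" using A W c by (simp add: r_def)
    have pt: "w b * f b * ln r + w b * f b - w b * (c * r) \<le> w b * (f b * ln (f b / c))" if b: "b \<in> B" for b
    proof (cases "f b = 0")
      case True
      then show ?thesis using assms(2)[OF b] c r by simp
    next
      case False
      then have f: "0 < f b" using assms(3)[OF b] by simp
      have "ln ((c * r) / f b) \<le> (c * r) / f b - 1" using f c r by (intro ln_le_minus_one) simp
      then have "f b * ln ((c * r) / f b) \<le> f b * ((c * r) / f b - 1)" using f by (intro mult_left_mono) auto
      also have "\<dots> = c * r - f b" using f by (simp add: field_simps)
      also have "ln ((c * r) / f b) = ln r - ln (f b / c)" using f c r by (simp add: ln_div ln_mult)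
      finally have "f b * ln r + f b - c * r \<le> f b * ln (f b / c)" by (simp add: algebra_simps)
      then have "w b * (f b * ln r + f b - c * r) \<le> w b * (f b * ln (f b / c))" using assms(2)[OF b] by (intro mult_left_mono)
      then show ?thesis by (simp add: algebra_simps)
    qed
    have "(\<Sum>b\<in>B. w b * f b * ln r + w b * f b - w b * (c * r)) = A * ln r + A - sum w B * (c * r)"
      by (simp add: A_def sum.distrib sum_subtractf sum_distrib_right)
    also have "sum w B * (c * r) = A" using W c by (simp add: r_def)
    finally have "(\<Sum>b\<in>B. w b * f b * ln r + w b * f b - w b * (c * r)) = A * ln r" by simp
    moreover have "(\<Sum>b\<in>B. w b * f b * ln r + w b * f b - w b * (c * r)) \<le> (\<Sum>b\<in>B. w b * (f b * ln (f b / c)))"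
      by (rule sum_mono[OF pt])
    ultimately show ?thesis unfolding A_def[symmetric] r_def[symmetric] by simp
  qed
qed

definition switch_path :: "real \<Rightarrow> real \<Rightarrow> real \<Rightarrow> real \<Rightarrow> real" where
  "switch_path T \<delta> v = (\<lambda>t\<in>{0..T}. if t < \<delta> then v else 0)"

lemma switch_path_input:
  assumes T: "0 < T" and v: "v \<in> {0..1}"
  shows "switch_path T \<delta> v \<in> input_paths T"
  unfolding input_paths_def cadlag_on_def
proof (intro CollectI conjI ballI)
  show "switch_path T \<delta> v \<in> {0..T} \<rightarrow>\<^sub>E {0..1}" using v by (auto simp: switch_path_def)
  fix t assume t: "t \<in> {0..<T}"
  show "(switch_path T \<delta> v \<longlongrightarrow> switch_path T \<delta> v t) (at_right t)"
  proof (rule tendsto_eventually)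
    define b where "b = (if t < \<delta> then min \<delta> T else T)"
    have "t < b" using t by (auto simp: b_def)
    then have "eventually (\<lambda>s. s \<in> {t<..<b}) (at_right t)" by (intro eventually_at_rightI[of _ b]) auto
    then show "eventually (\<lambda>s. switch_path T \<delta> v s = switch_path T \<delta> v t) (at_right t)"
      by eventually_elim (use t in \<open>auto simp: switch_path_def b_def split: if_splits\<close>)
  qed
next
  fix t assume t: "t \<in> {0<..T}"
  have "(switch_path T \<delta> v \<longlongrightarrow> (if t \<le> \<delta> then v else 0)) (at_left t)"
  proof (rule tendsto_eventually)
    define b where "b = (if t \<le> \<delta> then 0 else max \<delta> 0)"
    have "b < t" using t by (auto simp: b_def)
    then have "eventually (\<lambda>s. s \<in> {b<..<t}) (at_left t)" by (intro eventually_at_leftI[of b]) auto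
    then show "eventually (\<lambda>s. switch_path T \<delta> v s = (if t \<le> \<delta> then v else 0)) (at_left t)"
      by eventually_elim (use t in \<open>auto simp: switch_path_def b_def split: if_splits\<close>)
  qed
  then show "\<exists>l. (switch_path T \<delta> v \<longlongrightarrow> l) (at_left t)" by blast
qed

context poisson_channel
begin

definition out_prob_real :: "(real \<Rightarrow> real) \<Rightarrow> (real \<Rightarrow> real) set \<Rightarrow> real" where
  "out_prob_real x c = (\<integral>u. path_lik x u * indicator c u \<partial>Q)"

lemma out_prob_eq:
  assumes x: "x \<in> input_paths T" and c: "c \<in> sets Q"
  shows "out_prob x c = ennreal (out_prob_real x c)" "0 \<le> out_prob_real x c"
proof -
  show "0 \<le> out_prob_real x c" unfolding out_prob_real_def using path_lik_nonneg[OF x] by (intro integral_nonneg_AE AE_I2) auto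
  have "out_prob x c = (\<integral>\<^sup>+u. ennreal (path_lik x u * indicator c u) \<partial>Q)"
    unfolding out_prob_def using likelihood_eq[OF x] by (intro nn_integral_cong) (auto simp: indicator_def)
  also have "\<dots> = ennreal (out_prob_real x c)" unfolding out_prob_real_def
    using path_lik_nonneg[OF x] c integrable_path_lik[OF x]
    by (intro nn_integral_eq_integral integrable_real_mult_indicator AE_I2) auto
  finally show "out_prob x c = ennreal (out_prob_real x c)" .
qed

lemma out_prob_real_space: "x \<in> input_paths T \<Longrightarrow> out_prob_real x (space Q) = 1"
  unfolding out_prob_real_def using integral_path_lik[of x]
  by (subst Bochner_Integration.integral_cong[where g="path_lik x"]) auto

lemma out_prob_real_compl:
  assumes x: "x \<in> input_paths T" and c: "c \<in> sets Q"
  shows "out_prob_real x (space Q - c) = 1 - out_prob_real x c"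
proof -
  have int: "integrable Q (\<lambda>u. path_lik x u * indicator c u)" if "c \<in> sets Q" for c
    by (intro integrable_real_mult_indicator integrable_path_lik x that)
  have "out_prob_real x (space Q - c) = (\<integral>u. path_lik x u * indicator (space Q) u - path_lik x u * indicator c u \<partial>Q)"
    unfolding out_prob_real_def by (intro Bochner_Integration.integral_cong) (auto simp: indicator_def)
  also have "\<dots> = out_prob_real x (space Q) - out_prob_real x c"
    unfolding out_prob_real_def using int[OF c] int[OF sets.top] by (rule Bochner_Integration.integral_diff[rotated])
  finally show ?thesis using out_prob_real_space[OF x] by simp
qed

definition wpoint :: "real \<Rightarrow> (real \<Rightarrow> real) \<Rightarrow> (real \<Rightarrow> real) measure" where
  "wpoint p x = density (return (input_space T) x) (\<lambda>_. ennreal p)"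

lemma
  assumes x: "x \<in> input_paths T" and p: "0 \<le> p"
  shows input_measure_wpoint: "input_measure T (wpoint p x)"
    and measure_wpoint: "measure (wpoint p x) (space (wpoint p x)) = p"
    and integral_wpoint: "f \<in> borel_measurable (input_space T) \<Longrightarrow> (\<integral>y. f y \<partial>wpoint p x) = p * f x"
    and cell_wpoint: "c \<in> sets Q \<Longrightarrow> cell (wpoint p x) c = p * out_prob_real x c"
proof -
  interpret r: prob_space "return (input_space T) x" using x by (intro prob_space_return) simp
  have em: "emeasure (wpoint p x) (space (wpoint p x)) = ennreal p"
  proof -
    have "(\<integral>\<^sup>+y. 1 \<partial>wpoint p x) = (\<integral>\<^sup>+y. ennreal p * 1 \<partial>return (input_space T) x)"
      unfolding wpoint_def by (rule nn_integral_density) auto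
    also have "\<dots> = ennreal p" by (simp only: mult_1_right nn_integral_const r.emeasure_space_1)
    finally show ?thesis by simp
  qed
  show im: "input_measure T (wpoint p x)"
    unfolding input_measure_def using em by (auto intro!: finite_measureI simp: wpoint_def)
  show "measure (wpoint p x) (space (wpoint p x)) = p" using em p by (simp add: measure_def)
  show int: "f \<in> borel_measurable (input_space T) \<Longrightarrow> (\<integral>y. f y \<partial>wpoint p x) = p * f x" for f :: "_ \<Rightarrow> real"
    unfolding wpoint_def using p x by (subst integral_density) (auto simp: integral_return)
  assume c: "c \<in> sets Q"
  have "ennreal (cell (wpoint p x) c) = (\<integral>\<^sup>+y. out_prob y c \<partial>wpoint p x)" by (rule cell_eq_out_prob[OF im c, symmetric])
  also have "\<dots> = (\<integral>\<^sup>+y. ennreal p * out_prob y c \<partial>return (input_space T) x)"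
    unfolding wpoint_def using out_prob_measurable[OF c] by (subst nn_integral_density) auto
  also have "\<dots> = ennreal p * out_prob x c"
    using out_prob_measurable[OF c] x by (subst nn_integral_return) auto
  also have "\<dots> = ennreal (p * out_prob_real x c)" using out_prob_eq[OF x c] p by (simp add: ennreal_mult)
  finally show "cell (wpoint p x) c = p * out_prob_real x c"
    using cell_nonneg[OF im] out_prob_eq(2)[OF x c] p by (subst (asm) ennreal_inj) auto
qed

text \<open>Only slots whose sampling point lies before \<open>\<delta>\<close> have a nonzero prior
  gap; there are at most \<open>\<delta>\<close> divided by the slot length of them, each
  contributing the slot length times the gap at \<open>v\<close>. The quadratic remainders vanish in
  the limit.\<close>

lemma two_point_upper:
  fixes p v :: "bool \<Rightarrow> real"
  assumes p: "\<And>b. 0 < p b" "sum p UNIV = 1" and v: "\<And>b. v b \<in> {0..1}" and \<delta>: "0 < \<delta>"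
  defines "\<rho> \<equiv> \<lambda>b. wpoint (p b) (switch_path T \<delta> (v b))"
  shows "cond_ent UNIV \<rho> - mass_ent UNIV \<rho> \<le> \<delta> * jgap UNIV p v (phi a l)"
proof -
  define x where "x = (\<lambda>b. switch_path T \<delta> (v b))"
  have x: "x b \<in> input_paths T" for b unfolding x_def by (rule switch_path_input[OF T v])
  have \<rho>: "\<rho> b = wpoint (p b) (x b)" for b by (simp add: \<rho>_def x_def)
  have p0: "0 \<le> p b" for b using p(1)[of b] by simp
  define G where "G = jgap UNIV p v (phi a l)"
  have G0: "0 \<le> G" unfolding G_def
    by (rule jgap_convex) (use p0 v convex_on_phi[OF a l] in auto)
  have me: "mass_ent UNIV \<rho> = hent UNIV p"
    unfolding mass_ent_def hent_def p(2) using measure_wpoint[OF x p0] by (simp add: \<rho>)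
  have bound: "slot_ent T a l n UNIV \<rho> \<le> hent UNIV p + (\<delta> * G + T / n * (T * (a + l)\<^sup>2))" if n: "mesh_ok n" for n
  proof -
    have n0: "0 < n" using n by (simp add: mesh_ok_def)
    define \<Delta> where "\<Delta> = T / n"
    have \<Delta>: "0 < \<Delta>" "\<Delta> * (a + l) \<le> 1" using n T by (auto simp: mesh_ok_def \<Delta>_def)
    define y where "y = (\<lambda>j b. if j < n then x b (grid T n (Suc j)) else 0)"
    have y: "y j b \<in> {0..1}" for j b
      unfolding y_def using input_path_range[OF x grid_in[OF n0]] by auto
    have "slot_ent T a l n UNIV \<rho> = (\<Sum>S\<in>Pow {..<n}. hent UNIV (\<lambda>b. p b * bprod {..<n} (\<lambda>j. \<Delta> * (a * y j b + l)) S))"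
      unfolding slot_ent_def
    proof (intro sum.cong refl hent_cong)
      fix S b
      have "(\<lambda>x. bprod {..<n} (slot_prob T a l n x) S) \<in> borel_measurable (input_space T)"
        using slot_prob_measurable[OF n0] by (intro bprod_measurable) auto
      from integral_wpoint[OF x p0 this]
      have "(\<integral>x. bprod {..<n} (slot_prob T a l n x) S \<partial>\<rho> b) = p b * bprod {..<n} (slot_prob T a l n (x b)) S" unfolding \<rho> .
      also have "bprod {..<n} (slot_prob T a l n (x b)) S = bprod {..<n} (\<lambda>j. \<Delta> * (a * y j b + l)) S"
        by (rule bprod_cong) (simp add: slot_prob_def y_def \<Delta>_def)
      finally show "(\<integral>x. bprod {..<n} (slot_prob T a l n x) S \<partial>\<rho> b) = p b * bprod {..<n} (\<lambda>j. \<Delta> * (a * y j b + l)) S" .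
    qed
    also have "\<dots> \<le> hent UNIV p + (\<Sum>j<n. \<Delta> * jgap UNIV p (y j) (phi a l) + sum p UNIV * (\<Delta> * (a + l))\<^sup>2)"
      by (rule sum_hent_upper) (use p0 y a l \<Delta> in auto)
    also have "(\<Sum>j<n. \<Delta> * jgap UNIV p (y j) (phi a l) + sum p UNIV * (\<Delta> * (a + l))\<^sup>2) =
        (\<Sum>j<n. \<Delta> * jgap UNIV p (y j) (phi a l)) + n * (\<Delta> * (a + l))\<^sup>2"
      by (simp add: sum.distrib p(2))
    also have "n * (\<Delta> * (a + l))\<^sup>2 = T / n * (T * (a + l)\<^sup>2)"
      using n0 by (simp add: \<Delta>_def power2_eq_square)
    also have "(\<Sum>j<n. \<Delta> * jgap UNIV p (y j) (phi a l)) \<le> \<delta> * G"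
    proof -
      \<comment> \<open>From \<open>\<delta>\<close> on both labels have input 0, and a constant has
        no Jensen gap.\<close>
      have jg: "jgap UNIV p (y j) (phi a l) = (if grid T n (Suc j) < \<delta> then G else 0)" if "j < n" for j
      proof -
        have "grid T n (Suc j) \<in> {0..T}" using that n0 by (intro grid_in) auto
        then have "y j = (if grid T n (Suc j) < \<delta> then v else (\<lambda>_. 0))"
          using that by (auto simp: y_def x_def switch_path_def fun_eq_iff)
        then show ?thesis by (simp add: G_def jgap_def p(2) sum_distrib_right[symmetric])
      qed
      define M where "M = {j \<in> {..<n}. grid T n (Suc j) < \<delta>}"
      have "(\<Sum>j<n. \<Delta> * jgap UNIV p (y j) (phi a l)) = (\<Sum>j<n. if grid T n (Suc j) < \<delta> then \<Delta> * G else 0)"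
        using jg by (intro sum.cong) auto
      also have "\<dots> = (\<Sum>j\<in>M. \<Delta> * G)" unfolding M_def by (rule sum.inter_filter[symmetric]) simp
      also have "\<dots> = (card M * \<Delta>) * G" by simp
      also have "card M * \<Delta> \<le> \<delta>"
      proof -
        have "M \<subseteq> {..<nat \<lfloor>\<delta> / \<Delta>\<rfloor>}"
        proof
          fix j assume "j \<in> M"
          then have "real (Suc j) * \<Delta> < \<delta>" by (simp add: M_def grid_def \<Delta>_def)
          then have "real (Suc j) < \<delta> / \<Delta>" using \<Delta> by (simp only: pos_less_divide_eq)
          then have "int (Suc j) \<le> \<lfloor>\<delta> / \<Delta>\<rfloor>" by linarith
          then show "j \<in> {..<nat \<lfloor>\<delta> / \<Delta>\<rfloor>}" by simp
        qed
        then have "card M \<le> nat \<lfloor>\<delta> / \<Delta>\<rfloor>" using card_mono[of "{..<nat \<lfloor>\<delta> / \<Delta>\<rfloor>}" M] by simp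
        moreover have "0 < \<delta> / \<Delta>" using \<delta> \<Delta> by simp
        ultimately have "real (card M) \<le> \<delta> / \<Delta>" by linarith
        then show ?thesis using \<Delta> by (simp add: pos_le_divide_eq)
      qed
      then have "(card M * \<Delta>) * G \<le> \<delta> * G" using G0 by (intro mult_right_mono)
      finally show ?thesis .
    qed
    finally show ?thesis by simp
  qed
  have "(\<lambda>n. slot_ent T a l n UNIV \<rho>) \<longlonglongrightarrow> cond_ent UNIV \<rho>"
    by (rule slot_ent_tendsto) (simp_all add: \<rho> input_measure_wpoint[OF x p0])
  moreover have "(\<lambda>n. hent UNIV p + (\<delta> * G + T / real n * (T * (a + l)\<^sup>2))) \<longlonglongrightarrow> hent UNIV p + (\<delta> * G + 0 * (T * (a + l)\<^sup>2))"
    by (intro tendsto_intros lim_const_over_n)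
  moreover have "eventually (\<lambda>n. slot_ent T a l n UNIV \<rho> \<le> hent UNIV p + (\<delta> * G + T / real n * (T * (a + l)\<^sup>2))) sequentially"
    using eventually_mesh_ok by eventually_elim (rule bound)
  ultimately have "cond_ent UNIV \<rho> \<le> hent UNIV p + (\<delta> * G + 0 * (T * (a + l)\<^sup>2))"
    by (intro tendsto_le[OF sequentially_bot])
  then show ?thesis by (simp add: me G_def)
qed

end

section \<open>Information in the absence of counts\<close>

context poisson_channel
begin

lemma no_count_measurable: "t \<in> {0..T} \<Longrightarrow> {u \<in> space Q. u t = 0} \<in> sets Q"
  using measurable_sets[OF eval_measurable, of t "{0}"] by (simp add: vimage_def Int_def conj_commute)

lemma no_count_iff_inactive:
  assumes u: "u \<in> space Q" and M: "M \<le> n" "0 < n"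
  shows "u (grid T n M) = 0 \<longleftrightarrow> active_slots T n u \<inter> {..<M} = {}"
proof
  obtain J where J: "jump_set T u J" using jump_set_ex[OF u] .
  have fin: "finite J" and uJ: "\<And>t. t \<in> {0..T} \<Longrightarrow> u t = card (J \<inter> {..t})" using J by (auto simp: jump_set_def)
  assume "u (grid T n M) = 0"
  then have empty: "J \<inter> {..grid T n M} = {}" using uJ[OF grid_in[OF M(2,1)]] fin by simp
  have z: "u (grid T n j) = 0" if "j \<le> M" for j
  proof -
    have "J \<inter> {..grid T n j} \<subseteq> J \<inter> {..grid T n M}" using grid_mono[OF T that, of n] by auto
    then have "J \<inter> {..grid T n j} = {}" using empty by simp
    then show ?thesis using uJ[OF grid_in[OF M(2), of j]] that M by simp
  qed
  then show "active_slots T n u \<inter> {..<M} = {}" by (auto simp: active_slots_def)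
next
  assume inact: "active_slots T n u \<inter> {..<M} = {}"
  have "u (grid T n j) = 0" if "j \<le> M" for j
    using that
  proof (induction j)
    case 0
    then show ?case using u by (simp add: grid_def count_paths_def)
  next
    case (Suc j)
    then have "j \<notin> active_slots T n u" using inact by auto
    then have "u (grid T n (Suc j)) = u (grid T n j)" using Suc.prems M by (simp add: active_slots_def)
    then show ?case using Suc by simp
  qed
  then show "u (grid T n M) = 0" by simp
qed

text \<open>The void probability of a Poisson process with constant rate. As the output law is given
  by a density, it is computed from the discretisation: in slots, the event is that the first ones
  are all empty, whose probability is a product that tends to an exponential.\<close>

lemma survival_prob:
  assumes N: "0 < N" and v: "v \<in> {0..1}"
  shows "out_prob_real (switch_path T (T / real N) v) {u \<in> space Q. u (T / real N) = 0} = exp (- ((a * v + l) * (T / real N)))"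
proof -
  define \<delta> where "\<delta> = T / real N"
  define x where "x = switch_path T \<delta> v"
  define C where "C = {u \<in> space Q. u \<delta> = 0}"
  have \<delta>: "0 < \<delta>" "\<delta> \<le> T" using T N by (auto simp: \<delta>_def field_simps)
  have x: "x \<in> input_paths T" unfolding x_def by (rule switch_path_input[OF T v])
  have C: "C \<in> sets Q" unfolding C_def using \<delta> by (intro no_count_measurable) auto
  have lim: "(\<lambda>n. \<integral>u. slot_density T a l n x u * indicator C u \<partial>Q) \<longlonglongrightarrow> out_prob_real x C"
    unfolding out_prob_real_def
  proof (rule dominated_Q(2)[where c=1])
    show "(\<lambda>n. slot_density T a l n x u * indicator C u) \<longlonglongrightarrow> path_lik x u * indicator C u" if "u \<in> space Q" for u
      by (intro tendsto_intros slot_density_tendsto_path_lik x that)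
    show "(\<lambda>u. slot_density T a l n x u * indicator C u) \<in> borel_measurable Q" if "0 < n" for n
      by (intro borel_measurable_times section_measurable(2)[OF x that] borel_measurable_indicator C)
    show "\<bar>slot_density T a l n x u * indicator C u\<bar> \<le> 1 * lik_bound u" if "mesh_ok n" "u \<in> space Q" for n u
      using slot_density_nonneg[OF that(1) x that(2)] slot_density_le[OF that(1) x that(2)] lik_bound_nonneg[of u]
      by (simp add: indicator_def)
  qed
  define r where "r = a * v + l"
  have fin: "(\<integral>u. slot_density T a l (N * Suc m) x u * indicator C u \<partial>Q) =
      (1 - (\<delta> / Suc m) * r) ^ m * (1 - (\<delta> / Suc m) * l)" for m
  proof -
    \<comment> \<open>For multiples of \<open>N\<close> the time \<open>\<delta> = T / N\<close> is
      a grid point, namely the right end of slot \<open>m\<close>.\<close>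
    define n where "n = N * Suc m"
    have "1 * Suc m \<le> N * Suc m" using N by (intro mult_le_mono1) simp
    then have n: "0 < n" "Suc m \<le> n" using N by (auto simp: n_def)
    have \<Delta>: "T / n = \<delta> / Suc m" by (simp add: n_def \<delta>_def algebra_simps)
    have gM: "grid T n (Suc m) = \<delta>" unfolding grid_def \<Delta> by simp
    let ?q = "bprod {..<n} (\<lambda>_. ref_prob T n)"
    let ?s = "slot_prob T a l n x"
    let ?F = "\<lambda>S. if S \<inter> {..<Suc m} = {} then bprod {..<n} ?s S / ?q S else 0"
    have "(\<integral>u. slot_density T a l n x u * indicator C u \<partial>Q) = (\<integral>u. ?F (active_slots T n u) \<partial>Q)"
    proof (rule Bochner_Integration.integral_cong[OF refl])
      fix u assume u: "u \<in> space Q"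
      have "u \<in> C \<longleftrightarrow> active_slots T n u \<inter> {..<Suc m} = {}"
        using no_count_iff_inactive[OF u n(2,1)] u by (simp add: C_def gM)
      then show "slot_density T a l n x u * indicator C u = ?F (active_slots T n u)"
        by (simp add: slot_density_def indicator_def)
    qed
    also have "\<dots> = (\<Sum>S\<in>Pow {..<n}. ?F S * ?q S)" by (rule integral_active_slots(1)[OF n(1)])
    also have "\<dots> = (\<Sum>S\<in>Pow {..<n}. if S \<inter> {..<Suc m} = {} then bprod {..<n} ?s S else 0)"
      using bprod_ref_pos[OF n(1)] by (intro sum.cong refl) (simp add: less_imp_neq[symmetric])
    also have "\<dots> = (\<Prod>j<Suc m. 1 - ?s j)" by (rule sum_bprod_survival[OF n(2)])
    also have "\<dots> = (\<Prod>j<m. 1 - (\<delta> / Suc m) * r) * (1 - (\<delta> / Suc m) * l)"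
    proof -
      have "?s j = (\<delta> / Suc m) * r" if "j < m" for j
      proof -
        have "grid T n (Suc j) < grid T n (Suc m)"
          unfolding grid_def using that T n(1) by (intro mult_strict_right_mono) auto
        moreover have "grid T n (Suc j) \<in> {0..T}" using that n by (intro grid_in) auto
        ultimately have "x (grid T n (Suc j)) = v" unfolding gM by (simp add: x_def switch_path_def)
        then show ?thesis unfolding slot_prob_def \<Delta> r_def by simp
      qed
      \<comment> \<open>The last slot before \<open>\<delta>\<close> is sampled at its right end,
        where the path has already dropped to 0. This single exceptional factor tends to 1.\<close>
      moreover have "?s m = (\<delta> / Suc m) * l"
        unfolding slot_prob_def \<Delta> gM using \<delta> by (simp add: x_def switch_path_def)
      ultimately show ?thesis by simp
    qed
    finally show ?thesis by (simp add: n_def)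
  qed
  have sm: "strict_mono (\<lambda>m. N * Suc m)" using N by (simp add: strict_mono_Suc_iff)
  from LIMSEQ_subseq_LIMSEQ[OF lim sm]
  have L: "(\<lambda>m. (1 - (\<delta> / Suc m) * r) ^ m * (1 - (\<delta> / Suc m) * l)) \<longlonglongrightarrow> out_prob_real x C"
    by (simp only: comp_def fin)
  have D: "(\<lambda>m. \<delta> / real (Suc m)) \<longlonglongrightarrow> 0" by (rule LIMSEQ_Suc[OF lim_const_over_n])
  have E: "(\<lambda>m. (1 + (- (\<delta> * r)) / real (Suc m)) ^ Suc m) \<longlonglongrightarrow> exp (- (\<delta> * r))"
    by (rule LIMSEQ_Suc[OF tendsto_exp_limit_sequentially])
  have B: "(\<lambda>m. 1 - (\<delta> / real (Suc m)) * r) \<longlonglongrightarrow> 1 - 0 * r" by (intro tendsto_intros D)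
  have "(\<lambda>m. (1 + (- (\<delta> * r)) / real (Suc m)) ^ Suc m / (1 - (\<delta> / real (Suc m)) * r) * (1 - (\<delta> / Suc m) * l))
      \<longlonglongrightarrow> exp (- (\<delta> * r)) / (1 - 0 * r) * (1 - 0 * l)"
    by (intro tendsto_intros E B D) simp
  moreover have "eventually (\<lambda>m. (1 + (- (\<delta> * r)) / real (Suc m)) ^ Suc m / (1 - (\<delta> / real (Suc m)) * r) * (1 - (\<delta> / Suc m) * l)
      = (1 - (\<delta> / Suc m) * r) ^ m * (1 - (\<delta> / Suc m) * l)) sequentially"
  proof -
    have "eventually (\<lambda>m. 0 < 1 - (\<delta> / real (Suc m)) * r) sequentially" using B by (intro order_tendstoD(1)) auto
    then show ?thesis
    proof eventually_elim
      case (elim m)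
      have "1 + (- (\<delta> * r)) / real (Suc m) = 1 - (\<delta> / real (Suc m)) * r" by simp
      then show ?case using elim by (simp del: of_nat_Suc)
    qed
  qed
  ultimately have "(\<lambda>m. (1 - (\<delta> / Suc m) * r) ^ m * (1 - (\<delta> / Suc m) * l)) \<longlonglongrightarrow> exp (- (\<delta> * r)) / (1 - 0 * r) * (1 - 0 * l)"
    by (rule Lim_transform_eventually)
  from LIMSEQ_unique[OF L this] show ?thesis by (simp add: x_def C_def \<delta>_def r_def mult.commute)
qed

text \<open>Mutual information between a binary label with law \<open>p\<close> and the cell of the
  output, with the joint probability \<open>p b * out_prob_real (x b) C\<close> cleared of the
  common factor \<open>p b\<close> inside the logarithm.\<close>

definition two_point_info :: "(bool \<Rightarrow> real) \<Rightarrow> (bool \<Rightarrow> real \<Rightarrow> real) \<Rightarrow> (real \<Rightarrow> real) set set \<Rightarrow> real" where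
  "two_point_info p x \<C> = (\<Sum>C\<in>\<C>. \<Sum>b\<in>UNIV. p b * (out_prob_real (x b) C * ln (out_prob_real (x b) C / (\<Sum>b'\<in>UNIV. p b' * out_prob_real (x b') C))))"

lemma two_point_info_le:
  fixes p v :: "bool \<Rightarrow> real"
  assumes p: "\<And>b. 0 < p b" "sum p UNIV = 1" and v: "\<And>b. v b \<in> {0..1}" and \<delta>: "0 < \<delta>" and C: "\<C> \<in> fin_parts Q"
  shows "two_point_info p (\<lambda>b. switch_path T \<delta> (v b)) \<C> \<le> \<delta> * jgap UNIV p v (phi a l)"
proof -
  define x where "x = (\<lambda>b. switch_path T \<delta> (v b))"
  define \<rho> where "\<rho> = (\<lambda>b. wpoint (p b) (x b))"
  have x: "x b \<in> input_paths T" for b unfolding x_def by (rule switch_path_input[OF T v])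
  have p0: "0 \<le> p b" for b using p(1)[of b] by simp
  have "two_point_info p x \<C> = pinfo UNIV \<rho> \<C>"
    unfolding two_point_info_def pinfo_def
  proof (subst sum.swap, intro sum.cong refl)
    fix b C assume "C \<in> \<C>"
    then have "C \<in> sets Q" using C by (auto simp: fin_parts_def)
    then have c: "cell (\<rho> b) C = p b * out_prob_real (x b) C" for b unfolding \<rho>_def by (rule cell_wpoint[OF x p0])
    have m: "measure (\<rho> b) (space (\<rho> b)) = p b" unfolding \<rho>_def by (rule measure_wpoint[OF x p0])
    show "p b * (out_prob_real (x b) C * ln (out_prob_real (x b) C / (\<Sum>b'\<in>UNIV. p b' * out_prob_real (x b') C))) =
      cell (\<rho> b) C * ln (cell (\<rho> b) C / (measure (\<rho> b) (space (\<rho> b)) * (\<Sum>j\<in>UNIV. cell (\<rho> j) C)))"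
      unfolding c m using p(1)[of b] by simp
  qed
  also have "\<dots> \<le> cond_ent UNIV \<rho> - mass_ent UNIV \<rho>"
    by (rule pinfo_le[OF _ _ C]) (simp_all add: \<rho>_def input_measure_wpoint[OF x p0])
  also have "\<dots> \<le> \<delta> * jgap UNIV p v (phi a l)"
    unfolding \<rho>_def x_def by (rule two_point_upper[OF p v \<delta>])
  finally show ?thesis unfolding x_def .
qed

text \<open>Data processing: the label \<open>b\<close> sits at the point \<open>s b\<close> of
  \<open>S\<close>, so a partition of \<open>S\<close> can at best recover \<open>b\<close>. A cell
  of the partition merges the labels in it, and the log-sum inequality bounds the effect.\<close>

lemma pinfo_le_two_point_info:
  fixes s :: "bool \<Rightarrow> 'm"
  assumes p: "\<And>b. 0 < p b" and x: "\<And>b. x b \<in> input_paths T" and s: "\<And>b. s b \<in> space S"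
    and \<rho>: "\<And>a. a \<in> sets S \<Longrightarrow> input_measure T (\<rho> a)"
    and cell: "\<And>a c. a \<in> sets S \<Longrightarrow> c \<in> sets Q \<Longrightarrow> cell (\<rho> a) c = (\<Sum>b\<in>UNIV. p b * (if s b \<in> a then out_prob_real (x b) c else 0))"
    and A: "\<A> \<in> fin_parts S" and C: "\<C> \<in> fin_parts Q"
  shows "pinfo \<A> \<rho> \<C> \<le> two_point_info p x \<C>"
proof -
  have finA: "finite \<A>" and setsA: "\<And>a. a \<in> \<A> \<Longrightarrow> a \<in> sets S" and part: "partition_on (space S) \<A>"
    using A by (auto simp: fin_parts_def)
  have one: "(\<Sum>a\<in>\<A>. if s b \<in> a then r else 0) = r" for b and r :: real
  proof -
    have "(\<Sum>a\<in>\<A>. if s b \<in> a then r else 0) = r * (\<Sum>a\<in>\<A>. indicator a (s b))"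
      unfolding sum_distrib_left by (intro sum.cong) (auto simp: indicator_def)
    then show ?thesis using sum_indicator_partition[OF finA part s] by simp
  qed
  have "(\<Sum>a\<in>\<A>. cell (\<rho> a) c * ln (cell (\<rho> a) c / (measure (\<rho> a) (space (\<rho> a)) * (\<Sum>j\<in>\<A>. cell (\<rho> j) c)))) \<le>
      (\<Sum>b\<in>UNIV. p b * (out_prob_real (x b) c * ln (out_prob_real (x b) c / (\<Sum>b'\<in>UNIV. p b' * out_prob_real (x b') c))))"
    if c: "c \<in> \<C>" for c
  proof -
    have cs: "c \<in> sets Q" using c C by (auto simp: fin_parts_def)
    define f where "f = (\<lambda>b. out_prob_real (x b) c)"
    define W where "W = (\<Sum>b\<in>UNIV. p b * f b)"
    have f0: "0 \<le> f b" for b unfolding f_def by (rule out_prob_eq(2)[OF x cs])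
    have p0: "0 \<le> p b" for b using p[of b] by simp
    have W0: "0 \<le> W" unfolding W_def using f0 p0 by (intro sum_nonneg mult_nonneg_nonneg)
    have tot: "(\<Sum>j\<in>\<A>. cell (\<rho> j) c) = W"
    proof -
      have "(\<Sum>j\<in>\<A>. cell (\<rho> j) c) = (\<Sum>j\<in>\<A>. \<Sum>b\<in>UNIV. p b * (if s b \<in> j then f b else 0))"
        unfolding f_def by (intro sum.cong cell setsA cs refl)
      also have "\<dots> = (\<Sum>b\<in>UNIV. p b * (\<Sum>j\<in>\<A>. if s b \<in> j then f b else 0))"
        by (subst sum.swap) (simp add: sum_distrib_left)
      finally show ?thesis unfolding one W_def .
    qed
    show ?thesis
    proof (cases "W = 0")
      case True
      then have "\<And>b. p b * f b = 0"
        using f0 p0 unfolding W_def by (subst (asm) sum_nonneg_eq_0_iff) auto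
      then have z: "f b = 0" for b using p[of b] by (metis mult_eq_0_iff order_less_irrefl)
      have z': "out_prob_real (x b) c = 0" for b using z[of b] by (simp add: f_def)
      have "cell (\<rho> a) c = 0" if "a \<in> \<A>" for a
        unfolding cell[OF setsA[OF that] cs] by (intro sum.neutral ballI) (simp add: z')
      then show ?thesis by (simp add: z')
    next
      case False
      then have Wp: "0 < W" using W0 by simp
      have "cell (\<rho> a) c * ln (cell (\<rho> a) c / (measure (\<rho> a) (space (\<rho> a)) * W)) \<le>
          (\<Sum>b\<in>UNIV. if s b \<in> a then p b * (f b * ln (f b / W)) else 0)" if a: "a \<in> \<A>" for a
      proof -
        define w where "w = (\<lambda>b. p b * (if s b \<in> a then 1 else 0))"
        have w0: "0 \<le> w b" for b using p[of b] by (simp add: w_def)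
        have "measure (\<rho> a) (space (\<rho> a)) = cell (\<rho> a) (space Q)" by (rule cell_space[OF \<rho>[OF setsA[OF a]], symmetric])
        also have "\<dots> = sum w UNIV" unfolding cell[OF setsA[OF a] sets.top] w_def
          by (intro sum.cong) (auto simp: out_prob_real_space[OF x, unfolded space_Q])
        finally have m: "measure (\<rho> a) (space (\<rho> a)) = sum w UNIV" .
        have cl: "cell (\<rho> a) c = (\<Sum>b\<in>UNIV. w b * f b)"
          unfolding cell[OF setsA[OF a] cs] w_def f_def by (intro sum.cong) auto
        have "(\<Sum>b\<in>UNIV. w b * f b) * ln ((\<Sum>b\<in>UNIV. w b * f b) / (sum w UNIV * W)) \<le> (\<Sum>b\<in>UNIV. w b * (f b * ln (f b / W)))"
          by (rule log_sum_finite) (use w0 f0 Wp in auto)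
        also have "\<dots> = (\<Sum>b\<in>UNIV. if s b \<in> a then p b * (f b * ln (f b / W)) else 0)"
          by (intro sum.cong) (auto simp: w_def)
        finally show ?thesis unfolding m cl .
      qed
      then have "(\<Sum>a\<in>\<A>. cell (\<rho> a) c * ln (cell (\<rho> a) c / (measure (\<rho> a) (space (\<rho> a)) * W))) \<le>
          (\<Sum>a\<in>\<A>. \<Sum>b\<in>UNIV. if s b \<in> a then p b * (f b * ln (f b / W)) else 0)" by (rule sum_mono)
      also have "\<dots> = (\<Sum>b\<in>UNIV. p b * (f b * ln (f b / W)))" by (subst sum.swap) (simp only: one)
      finally show ?thesis unfolding tot f_def W_def .
    qed
  qed
  then have "(\<Sum>c\<in>\<C>. \<Sum>a\<in>\<A>. cell (\<rho> a) c * ln (cell (\<rho> a) c / (measure (\<rho> a) (space (\<rho> a)) * (\<Sum>j\<in>\<A>. cell (\<rho> j) c)))) \<le> two_point_info p x \<C>"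
    unfolding two_point_info_def by (rule sum_mono)
  then show ?thesis unfolding pinfo_def by (subst sum.swap)
qed

text \<open>A measurable set \<open>A\<close> that separates the points \<open>s True\<close> and
  \<open>s False\<close> reveals the label, so the bound for general partitions is attained.\<close>

lemma pinfo_eq_two_point_info:
  fixes s :: "bool \<Rightarrow> 'm"
  assumes p: "\<And>b. 0 < p b" and x: "\<And>b. x b \<in> input_paths T"
    and \<rho>: "\<And>a. a \<in> sets S \<Longrightarrow> input_measure T (\<rho> a)"
    and cell: "\<And>a c. a \<in> sets S \<Longrightarrow> c \<in> sets Q \<Longrightarrow> cell (\<rho> a) c = (\<Sum>b\<in>UNIV. p b * (if s b \<in> a then out_prob_real (x b) c else 0))"
    and s: "\<And>b. s b \<in> space S" and A: "A \<in> sets S" "s True \<in> A" "s False \<notin> A" and C: "\<C> \<subseteq> sets Q"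
  shows "{A, space S - A} \<in> fin_parts S" "pinfo {A, space S - A} \<rho> \<C> = two_point_info p x \<C>"
proof -
  have sub: "A \<subseteq> space S" using sets.sets_into_space[OF A(1)] .
  have ne: "A \<noteq> space S - A" using A(2) by blast
  have comp: "space S - A \<in> sets S" using A(1) by blast
  have "space S - A \<noteq> {}" using s[of False] A(3) by blast
  then show "{A, space S - A} \<in> fin_parts S"
    using sub A(1,2) unfolding fin_parts_def partition_on_def disjoint_def by auto
  have cellA: "cell (\<rho> A) c = p True * out_prob_real (x True) c" "cell (\<rho> (space S - A)) c = p False * out_prob_real (x False) c" if "c \<in> sets Q" for c
    unfolding cell[OF A(1) that] cell[OF comp that] using A s by (simp_all add: UNIV_bool)
  have m: "measure (\<rho> A) (space (\<rho> A)) = p True" "measure (\<rho> (space S - A)) (space (\<rho> (space S - A))) = p False"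
    using cellA[OF sets.top] out_prob_real_space[OF x] cell_space[OF \<rho>[OF A(1)]] cell_space[OF \<rho>[OF comp]] by simp_all
  have pn: "p b \<noteq> 0" for b using p[of b] by simp
  have "pinfo {A, space S - A} \<rho> \<C> = (\<Sum>c\<in>\<C>. cell (\<rho> A) c * ln (cell (\<rho> A) c / (p True * (cell (\<rho> A) c + cell (\<rho> (space S - A)) c))) +
      cell (\<rho> (space S - A)) c * ln (cell (\<rho> (space S - A)) c / (p False * (cell (\<rho> A) c + cell (\<rho> (space S - A)) c))))"
    unfolding pinfo_def using ne by (simp add: m sum.distrib)
  also have "\<dots> = two_point_info p x \<C>"
    unfolding two_point_info_def
  proof (intro sum.cong refl)
    fix c assume "c \<in> \<C>"
    then have c: "c \<in> sets Q" using C by blast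
    show "cell (\<rho> A) c * ln (cell (\<rho> A) c / (p True * (cell (\<rho> A) c + cell (\<rho> (space S - A)) c))) +
      cell (\<rho> (space S - A)) c * ln (cell (\<rho> (space S - A)) c / (p False * (cell (\<rho> A) c + cell (\<rho> (space S - A)) c))) =
      (\<Sum>b\<in>UNIV. p b * (out_prob_real (x b) c * ln (out_prob_real (x b) c / (\<Sum>b'\<in>UNIV. p b' * out_prob_real (x b') c))))"
      unfolding cellA[OF c] using pn by (simp add: UNIV_bool add.commute)
  qed
  finally show "pinfo {A, space S - A} \<rho> \<C> = two_point_info p x \<C>" .
qed

text \<open>The output is reduced to whether there is a count before \<open>T / N\<close>, which has
  probability \<open>q b\<close>. The term for "no count" is only quadratic: expanding
  \<open>(1 - q) ln (1 - q)\<close> for each label and for the mean \<open>m\<close> of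
  \<open>q\<close>, the linear parts cancel and \<open>- m\<^sup>2\<close> remains as a lower
  bound.\<close>

lemma two_point_info_no_count:
  fixes p v :: "bool \<Rightarrow> real"
  assumes p: "\<And>b. 0 < p b" "sum p UNIV = 1" and v: "\<And>b. v b \<in> {0..1}" and r: "\<And>b. 0 < a * v b + l" and N: "0 < N"
  defines "C \<equiv> {u \<in> space Q. u (T / real N) = 0}"
    and "q \<equiv> \<lambda>b. 1 - exp (- ((a * v b + l) * (T / real N)))"
  shows "{C, space Q - C} \<in> fin_parts Q"
    "(\<Sum>b\<in>UNIV. p b * (q b * ln (q b / (\<Sum>b\<in>UNIV. p b * q b)))) - (\<Sum>b\<in>UNIV. p b * q b)\<^sup>2 \<le>
      two_point_info p (\<lambda>b. switch_path T (T / real N) (v b)) {C, space Q - C}"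
proof -
  define x where "x = (\<lambda>b. switch_path T (T / real N) (v b))"
  have x: "x b \<in> input_paths T" for b unfolding x_def by (rule switch_path_input[OF T v])
  have \<delta>: "0 < T / real N" "T / real N \<le> T" using T N by (auto simp: field_simps)
  have C: "C \<in> sets Q" unfolding C_def using \<delta> by (intro no_count_measurable) auto
  have "0 < (a * v b + l) * (T / real N)" for b using r[of b] \<delta>(1) by (rule mult_pos_pos)
  then have q01: "0 < q b" "q b < 1" for b
    unfolding q_def using exp_gt_zero by (simp_all only: diff_gt_0_iff_gt exp_less_one_iff neg_less_0_iff_less diff_less_eq less_add_same_cancel1)
  have o: "out_prob_real (x b) C = 1 - q b" for b
    using survival_prob[OF N v] by (simp add: x_def C_def q_def)
  have o': "out_prob_real (x b) (space Q - C) = q b" for b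
    using out_prob_real_compl[OF x C] o by simp
  have "C \<noteq> {}"
  proof
    assume "C = {}"
    then have "out_prob_real (x True) C = 0" by (simp add: out_prob_real_def)
    then show False using o[of True] q01[of True] by simp
  qed
  moreover have "space Q - C \<noteq> {}"
  proof
    assume "space Q - C = {}"
    then have "out_prob_real (x True) (space Q - C) = 0" by (simp only: out_prob_real_def) simp
    then show False using o'[of True] q01[of True] by simp
  qed
  moreover have sub: "C \<subseteq> space Q" by (auto simp: C_def)
  moreover have "space Q - C \<in> sets Q" using C by (rule sets.compl_sets)
  ultimately show "{C, space Q - C} \<in> fin_parts Q"
    using C unfolding fin_parts_def partition_on_def disjoint_def by auto
  have ne: "C \<noteq> space Q - C" using \<open>C \<noteq> {}\<close> by blast
  define m where "m = (\<Sum>b\<in>UNIV. p b * q b)"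
  have pe: "p True + p False = 1" using p(2) by (simp add: UNIV_bool add.commute)
  have m01: "0 < m" "m < 1"
  proof -
    show "0 < m" unfolding m_def using p(1) q01 by (intro sum_pos) auto
    have "m < (\<Sum>b\<in>UNIV. p b * 1)" unfolding m_def using p(1) q01 by (intro sum_strict_mono mult_strict_left_mono) auto
    then show "m < 1" using p(2) by simp
  qed
  have om: "(\<Sum>b\<in>UNIV. p b * (1 - q b)) = 1 - m"
    using p(2) by (simp add: m_def algebra_simps sum_subtractf)
  have "two_point_info p x {C, space Q - C} = (\<Sum>b\<in>UNIV. p b * ((1 - q b) * ln ((1 - q b) / (1 - m)))) + (\<Sum>b\<in>UNIV. p b * (q b * ln (q b / m)))"
    unfolding two_point_info_def using ne by (simp only: sum.insert finite.intros singleton_iff sum.empty empty_iff not_False_eq_True add_0_right o o' om m_def[symmetric])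
  moreover have "- m\<^sup>2 \<le> (\<Sum>b\<in>UNIV. p b * ((1 - q b) * ln ((1 - q b) / (1 - m))))"
  proof -
    have "(\<Sum>b\<in>UNIV. p b * ((1 - q b) * ln ((1 - q b) / (1 - m)))) = (\<Sum>b\<in>UNIV. p b * ((1 - q b) * ln (1 - q b)) - (p b * (1 - q b)) * ln (1 - m))"
      using q01 m01 by (intro sum.cong) (auto simp: ln_div algebra_simps)
    also have "\<dots> = (\<Sum>b\<in>UNIV. p b * ((1 - q b) * ln (1 - q b))) - (1 - m) * ln (1 - m)"
      by (simp add: sum_subtractf sum_distrib_right[symmetric] om)
    also have "\<dots> \<ge> (\<Sum>b\<in>UNIV. p b * (- q b)) - (- m + m\<^sup>2)"
      using one_minus_ln_bounds(1)[of "q _"] one_minus_ln_bounds(2)[of m] q01 m01 p(1)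
      by (intro diff_mono sum_mono mult_left_mono) (auto intro: less_imp_le)
    finally show ?thesis by (simp add: m_def sum_negf)
  qed
  ultimately show "(\<Sum>b\<in>UNIV. p b * (q b * ln (q b / (\<Sum>b\<in>UNIV. p b * q b)))) - (\<Sum>b\<in>UNIV. p b * q b)\<^sup>2 \<le>
      two_point_info p (\<lambda>b. switch_path T (T / real N) (v b)) {C, space Q - C}"
    unfolding x_def m_def by linarith
qed

text \<open>Divided by the interval length, \<open>q N b\<close> tends to the rate
  \<open>lm b\<close>. The first sum is homogeneous of degree 1 in \<open>q\<close>, so its quotient
  converges to the Jensen gap of \<open>t ln t\<close> at the rates, which is that of
  \<open>\<phi>\<close> at \<open>v\<close>; the quadratic correction vanishes even after the
  division. Positive rates keep the logarithms continuous in the limit.\<close>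

lemma two_point_info_lower_eventually:
  fixes p v :: "bool \<Rightarrow> real"
  assumes p: "\<And>b. 0 < p b" "sum p UNIV = 1" and v: "\<And>b. v b \<in> {0..1}" and r: "\<And>b. 0 < a * v b + l"
    and g: "g < jgap UNIV p v (phi a l)"
  obtains N \<C> where "0 < N" "\<C> \<in> fin_parts Q" "(T / real N) * g < two_point_info p (\<lambda>b. switch_path T (T / real N) (v b)) \<C>"
proof -
  define lm where "lm = (\<lambda>b. a * v b + l)"
  define q where "q = (\<lambda>N b. 1 - exp (- (lm b * (T / real N))))"
  define mq where "mq = (\<lambda>N. \<Sum>b\<in>UNIV. p b * q N b)"
  define \<delta> where "\<delta> = (\<lambda>N. T / real N)"
  have r: "0 < lm b" for b using r by (simp add: lm_def)
  define ml where "ml = (\<Sum>b\<in>UNIV. p b * lm b)"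
  have ml: "0 < ml" unfolding ml_def using p(1) r by (intro sum_pos) auto
  have ql: "(\<lambda>N. q N b / \<delta> N) \<longlonglongrightarrow> lm b" for b
  proof -
    have pos: "0 < lm b * T" using r T by simp
    have D: "(\<lambda>N. (lm b * T) / real N) \<longlonglongrightarrow> 0" by (rule lim_const_over_n)
    \<comment> \<open>The count probability \<open>q N b\<close> is \<open>ref_prob\<close> with
      \<open>lm b * T\<close> in place of \<open>T\<close>, so the earlier bounds apply.\<close>
    have "(\<lambda>N. ((lm b * T) / N) / ref_prob (lm b * T) N) \<longlonglongrightarrow> 1"
    proof (rule tendsto_sandwich)
      show "eventually (\<lambda>N. 1 \<le> ((lm b * T) / N) / ref_prob (lm b * T) N) sequentially"
        "eventually (\<lambda>N. ((lm b * T) / N) / ref_prob (lm b * T) N \<le> 1 + (lm b * T) / N) sequentially"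
        using eventually_gt_at_top[of 0] by (eventually_elim, use ref_prob_bounds[OF pos] in blast)+
      show "(\<lambda>N. 1 + (lm b * T) / real N) \<longlonglongrightarrow> 1" using tendsto_add[OF tendsto_const D, of 1] by simp
    qed simp
    then have "(\<lambda>N. lm b * inverse (((lm b * T) / N) / ref_prob (lm b * T) N)) \<longlonglongrightarrow> lm b * inverse 1"
      by (intro tendsto_intros) auto
    moreover have "lm b * inverse (((lm b * T) / N) / ref_prob (lm b * T) N) = q N b / \<delta> N" for N
      using r[of b] T by (simp add: q_def \<delta>_def field_simps)
    ultimately show ?thesis by simp
  qed
  have mql: "(\<lambda>N. mq N / \<delta> N) \<longlonglongrightarrow> ml"
  proof -
    have "(\<lambda>N. \<Sum>b\<in>UNIV. p b * (q N b / \<delta> N)) \<longlonglongrightarrow> ml" unfolding ml_def by (intro tendsto_intros ql)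
    then show ?thesis by (simp add: mq_def sum_divide_distrib)
  qed
  have \<delta>l: "\<delta> \<longlonglongrightarrow> 0" unfolding \<delta>_def by (rule lim_const_over_n)
  have mq0: "(\<lambda>N. mq N * (mq N / \<delta> N)) \<longlonglongrightarrow> 0"
  proof -
    have "(\<lambda>N. (mq N / \<delta> N) * \<delta> N) \<longlonglongrightarrow> ml * 0" by (intro tendsto_intros mql \<delta>l)
    moreover have "eventually (\<lambda>N. (mq N / \<delta> N) * \<delta> N = mq N) sequentially"
      using eventually_gt_at_top[of 0] by eventually_elim (use T in \<open>simp add: \<delta>_def\<close>)
    ultimately have "mq \<longlonglongrightarrow> ml * 0" by (rule Lim_transform_eventually)
    from tendsto_mult[OF this mql] show ?thesis by simp
  qed
  have "(\<lambda>N. (\<Sum>b\<in>UNIV. p b * ((q N b / \<delta> N) * ln ((q N b / \<delta> N) / (mq N / \<delta> N)))) - mq N * (mq N / \<delta> N)) \<longlonglongrightarrow>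
      (\<Sum>b\<in>UNIV. p b * (lm b * ln (lm b / ml))) - 0"
    using r ml by (intro tendsto_intros ql mql mq0) (auto simp: less_imp_neq[symmetric])
  moreover have "(\<Sum>b\<in>UNIV. p b * (lm b * ln (lm b / ml))) = jgap UNIV p v (phi a l)"
  proof -
    have "a * (\<Sum>b\<in>UNIV. p b * v b) + l = ml"
    proof -
      have "ml = a * (\<Sum>b\<in>UNIV. p b * v b) + l * sum p UNIV"
        by (simp add: ml_def lm_def algebra_simps sum.distrib sum_distrib_left)
      then show ?thesis using p(2) by simp
    qed
    then have "jgap UNIV p v (phi a l) = (\<Sum>b\<in>UNIV. p b * (lm b * ln (lm b))) - ml * ln ml"
      by (simp add: jgap_def phi_def p(2) lm_def)
    also have "\<dots> = (\<Sum>b\<in>UNIV. p b * (lm b * ln (lm b)) - p b * lm b * ln ml)"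
      by (simp add: sum_subtractf ml_def sum_distrib_right)
    also have "\<dots> = (\<Sum>b\<in>UNIV. p b * (lm b * ln (lm b / ml)))"
      using r ml by (intro sum.cong) (auto simp: ln_div algebra_simps)
    finally show ?thesis by simp
  qed
  ultimately have "(\<lambda>N. (\<Sum>b\<in>UNIV. p b * ((q N b / \<delta> N) * ln ((q N b / \<delta> N) / (mq N / \<delta> N)))) - mq N * (mq N / \<delta> N)) \<longlonglongrightarrow>
      jgap UNIV p v (phi a l)" by simp
  from order_tendstoD(1)[OF this g] eventually_gt_at_top[of 0]
  have "eventually (\<lambda>N. 0 < N \<and> g < (\<Sum>b\<in>UNIV. p b * ((q N b / \<delta> N) * ln ((q N b / \<delta> N) / (mq N / \<delta> N)))) - mq N * (mq N / \<delta> N)) sequentially"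
    by eventually_elim auto
  then obtain N where N: "0 < N" "g < (\<Sum>b\<in>UNIV. p b * ((q N b / \<delta> N) * ln ((q N b / \<delta> N) / (mq N / \<delta> N)))) - mq N * (mq N / \<delta> N)"
    by (auto simp: eventually_sequentially)
  have \<delta>p: "0 < \<delta> N" using N(1) T by (simp add: \<delta>_def)
  have "\<delta> N * g < \<delta> N * ((\<Sum>b\<in>UNIV. p b * ((q N b / \<delta> N) * ln ((q N b / \<delta> N) / (mq N / \<delta> N)))) - mq N * (mq N / \<delta> N))"
    using N(2) \<delta>p by (intro mult_strict_left_mono)
  also have "\<dots> = (\<Sum>b\<in>UNIV. p b * (q N b * ln (q N b / mq N))) - (mq N)\<^sup>2"
    using \<delta>p by (simp add: right_diff_distrib sum_distrib_left power2_eq_square)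
  also have "\<dots> \<le> two_point_info p (\<lambda>b. switch_path T (T / real N) (v b)) {{u \<in> space Q. u (T / real N) = 0}, space Q - {u \<in> space Q. u (T / real N) = 0}}"
    using two_point_info_no_count(2)[of p v N] p v N(1) r unfolding q_def mq_def lm_def by blast
  finally show thesis
    using two_point_info_no_count(1)[of p v N] p v N(1) r unfolding lm_def \<delta>_def by (intro that[OF N(1)]) blast+
qed

end

section \<open>Necessity of convexity\<close>

context two_receivers
begin

text \<open>The weights and points are those of a violated convexity inequality in the interior.
  Interior points secure positive rates at receiver 2, and different points allow the two inputs to
  be told apart at time 0.\<close>

lemma nonconvex_two_points:
  assumes "\<not> convex_on {0..1} (\<lambda>x. phi ay ly x - phi az lz x)"
  obtains p v :: "bool \<Rightarrow> real" where "\<And>b. 0 < p b" "sum p UNIV = 1" "\<And>b. v b \<in> {0<..<1}" "v True \<noteq> v False"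
    "jgap UNIV p v (phi ay ly) < jgap UNIV p v (phi az lz)"
proof -
  let ?\<Phi> = "\<lambda>x. phi ay ly x - phi az lz x"
  have "continuous_on {0..1} ?\<Phi>" by (intro continuous_on_diff continuous_on_phi y.a y.l z.a z.l)
  then obtain s t \<alpha> \<beta> where st: "s \<in> {0<..<1}" "t \<in> {0<..<1}" "0 < \<alpha>" "0 < \<beta>" "\<alpha> + \<beta> = 1"
    "\<alpha> * ?\<Phi> s + \<beta> * ?\<Phi> t < ?\<Phi> (\<alpha> * s + \<beta> * t)"
    using convex_on_from_interior[of ?\<Phi>] assms by (meson not_less)
  have "s \<noteq> t"
  proof
    assume "s = t"
    then have "\<alpha> * s + \<beta> * t = (\<alpha> + \<beta>) * t" "\<alpha> * ?\<Phi> s + \<beta> * ?\<Phi> t = (\<alpha> + \<beta>) * ?\<Phi> t" by (simp_all add: algebra_simps)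
    then show False using st(5,6) by simp
  qed
  have U: "(UNIV :: bool set) = {True, False}" by auto
  show thesis
  proof (rule that[of "\<lambda>b. if b then \<alpha> else \<beta>" "\<lambda>b. if b then s else t"])
    show "jgap UNIV (\<lambda>b. if b then \<alpha> else \<beta>) (\<lambda>b. if b then s else t) (phi ay ly) <
        jgap UNIV (\<lambda>b. if b then \<alpha> else \<beta>) (\<lambda>b. if b then s else t) (phi az lz)"
      using st(5,6) by (simp add: jgap_def U algebra_simps)
  qed (use st \<open>s \<noteq> t\<close> in \<open>auto simp: U\<close>)
qed

lemma nonconvex_two_point_info:
  assumes ncv: "\<not> convex_on {0..1} (\<lambda>x. phi ay ly x - phi az lz x)"
  obtains p :: "bool \<Rightarrow> real" and x \<C> B where "\<And>b. 0 < p b" "sum p UNIV = 1" "\<And>b. x b \<in> input_paths T" "x True 0 \<noteq> x False 0"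
    "\<And>\<D>. \<D> \<in> fin_parts Qy \<Longrightarrow> y.two_point_info p x \<D> \<le> B" "\<C> \<in> fin_parts Qz" "B < z.two_point_info p x \<C>"
proof -
  obtain p v :: "bool \<Rightarrow> real" where p: "\<And>b. 0 < p b" "sum p UNIV = 1" and v: "\<And>b. v b \<in> {0<..<1}" "v True \<noteq> v False"
    and g: "jgap UNIV p v (phi ay ly) < jgap UNIV p v (phi az lz)"
    by (rule nonconvex_two_points[OF ncv]) (rule that; assumption)
  \<comment> \<open>For \<open>az = 0\<close> the first alternative of the parameter condition
    holds, and \<open>\<Phi>\<close> would be convex.\<close>
  have "az \<noteq> 0" using ncv phi_diff_convex_iff[OF y.a z.a y.l z.l] y.a z.l by auto
  then have az: "0 < az" using z.a by simp
  have r: "0 < az * v b + lz" for b using az v(1)[of b] z.l by (intro add_pos_nonneg mult_pos_pos) auto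
  have v': "v b \<in> {0..1}" for b using v(1)[of b] by auto
  obtain N \<C> where N: "0 < N" "\<C> \<in> fin_parts Qz"
    "(T / real N) * jgap UNIV p v (phi ay ly) < z.two_point_info p (\<lambda>b. switch_path T (T / real N) (v b)) \<C>"
    by (rule z.two_point_info_lower_eventually[OF p v' r g])
  have \<delta>: "0 < T / real N" using N(1) y.T by simp
  show thesis
  proof (rule that[OF p _ _ _ N(2,3)])
    show "switch_path T (T / real N) (v b) \<in> input_paths T" for b by (rule switch_path_input[OF y.T v'])
    show "switch_path T (T / real N) (v True) 0 \<noteq> switch_path T (T / real N) (v False) 0"
      using v(2) y.T \<delta> by (simp add: switch_path_def)
    show "y.two_point_info p (\<lambda>b. switch_path T (T / real N) (v b)) \<D> \<le> (T / real N) * jgap UNIV p v (phi ay ly)"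
      if "\<D> \<in> fin_parts Qy" for \<D> by (rule y.two_point_info_le[OF p v' \<delta> that])
  qed
qed

text \<open>The number \<open>B\<close> separates the two suprema: every pair of partitions stays
  below \<open>B\<close> at receiver 1, whereas at receiver 2 the binary partition by
  \<open>A\<close> together with \<open>\<C>\<close> exceeds it. The assumption on integrals says
  that \<open>\<rho> a\<close> is carried by the inputs of those labels whose points lie in
  \<open>a\<close>.\<close>

lemma SUP_pinfo_less:
  fixes s :: "bool \<Rightarrow> 'm"
  assumes p: "\<And>b. 0 < p b" and x: "\<And>b. x b \<in> input_paths T" and s: "\<And>b. s b \<in> space S"
    and \<rho>: "\<And>a. a \<in> sets S \<Longrightarrow> input_measure T (\<rho> a)"
    and A: "A \<in> sets S" "s True \<in> A" "s False \<notin> A"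
    and out: "\<And>a h. a \<in> sets S \<Longrightarrow> h \<in> borel_measurable (input_space T) \<Longrightarrow>
      (\<integral>\<^sup>+w. h w \<partial>\<rho> a) = (\<Sum>b\<in>UNIV. ennreal (p b) * (if s b \<in> a then h (x b) else 0))"
    and B: "\<And>\<D>. \<D> \<in> fin_parts Qy \<Longrightarrow> y.two_point_info p x \<D> \<le> B" and C: "\<C> \<in> fin_parts Qz" "B < z.two_point_info p x \<C>"
  shows "(SUP (\<A>, \<C>) \<in> fin_parts S \<times> fin_parts Qy. ereal (y.pinfo \<A> \<rho> \<C>)) <
    (SUP (\<A>, \<C>) \<in> fin_parts S \<times> fin_parts Qz. ereal (z.pinfo \<A> \<rho> \<C>))"
proof -
  have p0: "0 \<le> p b" for b using p[of b] by simp
  have to_real: "r = (\<Sum>b\<in>UNIV. p b * (if s b \<in> a then f b else 0))"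
    if "ennreal r = (\<Sum>b\<in>UNIV. ennreal (p b) * (if s b \<in> a then ennreal (f b) else 0))" "0 \<le> r" "\<And>b. 0 \<le> f b" for r a f
  proof -
    have nn: "0 \<le> (\<Sum>b\<in>UNIV. p b * (if s b \<in> a then f b else 0))" using p0 that(3) by (intro sum_nonneg mult_nonneg_nonneg) auto
    have "ennreal r = (\<Sum>b\<in>UNIV. ennreal (p b * (if s b \<in> a then f b else 0)))"
      unfolding that(1) using p0 that(3) by (intro sum.cong) (auto simp: ennreal_mult)
    also have "\<dots> = ennreal (\<Sum>b\<in>UNIV. p b * (if s b \<in> a then f b else 0))" using p0 that(3) by (intro sum_ennreal mult_nonneg_nonneg) auto
    finally show ?thesis using that(2) nn by simp
  qed
  have ycell: "y.cell (\<rho> a) c = (\<Sum>b\<in>UNIV. p b * (if s b \<in> a then y.out_prob_real (x b) c else 0))"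
    if a: "a \<in> sets S" and c: "c \<in> sets Qy" for a c
  proof (rule to_real)
    show "ennreal (y.cell (\<rho> a) c) = (\<Sum>b\<in>UNIV. ennreal (p b) * (if s b \<in> a then ennreal (y.out_prob_real (x b) c) else 0))"
      unfolding y.cell_eq_out_prob[OF \<rho>[OF a] c, symmetric] out[OF a y.out_prob_measurable[OF c]] y.out_prob_eq(1)[OF x c] ..
  qed (use y.cell_nonneg[OF \<rho>[OF a]] y.out_prob_eq(2)[OF x c] in auto)
  have zcell: "z.cell (\<rho> a) c = (\<Sum>b\<in>UNIV. p b * (if s b \<in> a then z.out_prob_real (x b) c else 0))"
    if a: "a \<in> sets S" and c: "c \<in> sets Qz" for a c
  proof (rule to_real)
    show "ennreal (z.cell (\<rho> a) c) = (\<Sum>b\<in>UNIV. ennreal (p b) * (if s b \<in> a then ennreal (z.out_prob_real (x b) c) else 0))"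
      unfolding z.cell_eq_out_prob[OF \<rho>[OF a] c, symmetric] out[OF a z.out_prob_measurable[OF c]] z.out_prob_eq(1)[OF x c] ..
  qed (use z.cell_nonneg[OF \<rho>[OF a]] z.out_prob_eq(2)[OF x c] in auto)
  have "(SUP (\<A>, \<C>) \<in> fin_parts S \<times> fin_parts Qy. ereal (y.pinfo \<A> \<rho> \<C>)) \<le> ereal B"
  proof (rule SUP_least)
    fix r assume "r \<in> fin_parts S \<times> fin_parts Qy"
    then obtain \<A> \<D> where r: "r = (\<A>, \<D>)" "\<A> \<in> fin_parts S" "\<D> \<in> fin_parts Qy" by auto
    have "y.pinfo \<A> \<rho> \<D> \<le> y.two_point_info p x \<D>" by (rule y.pinfo_le_two_point_info[where p=p and x=x and S=S and \<rho>=\<rho> and s=s, OF p x s \<rho> ycell r(2,3)])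
    also have "\<dots> \<le> B" by (rule B[OF r(3)])
    finally show "(case r of (\<A>, \<C>) \<Rightarrow> ereal (y.pinfo \<A> \<rho> \<C>)) \<le> ereal B" by (simp add: r(1))
  qed
  also have "\<dots> < ereal (z.two_point_info p x \<C>)" using C(2) by simp
  also have "\<dots> \<le> (SUP (\<A>, \<C>) \<in> fin_parts S \<times> fin_parts Qz. ereal (z.pinfo \<A> \<rho> \<C>))"
  proof (rule SUP_upper2[of "({A, space S - A}, \<C>)"])
    have sub: "\<C> \<subseteq> sets Qz" using C(1) by (simp add: fin_parts_def)
    have parts: "{A, space S - A} \<in> fin_parts S"
      by (rule z.pinfo_eq_two_point_info(1)[where p=p and x=x and S=S and \<rho>=\<rho> and s=s and A=A and \<C>=\<C>])
        (fact p x \<rho> zcell s A sub)+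
    have eq: "z.pinfo {A, space S - A} \<rho> \<C> = z.two_point_info p x \<C>"
      by (rule z.pinfo_eq_two_point_info(2)[where p=p and x=x and S=S and \<rho>=\<rho> and s=s and A=A and \<C>=\<C>])
        (fact p x \<rho> zcell s A sub)+
    show "({A, space S - A}, \<C>) \<in> fin_parts S \<times> fin_parts Qz" using parts C(1) by simp
    show "ereal (z.two_point_info p x \<C>) \<le> (case ({A, space S - A}, \<C>) of (\<A>, \<C>) \<Rightarrow> ereal (z.pinfo \<A> \<rho> \<C>))"
      using eq by simp
  qed
  finally show ?thesis .
qed

lemma nn_integral_two_point:
  assumes p: "\<And>b. 0 < p b" "sum p UNIV = 1"
  shows "(\<integral>\<^sup>+b. f b \<partial>measure_pmf (bernoulli_pmf (p True))) = (\<Sum>b\<in>UNIV. ennreal (p b) * f b)"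
proof -
  have "p True + p False = 1" using p(2) by (simp add: UNIV_bool add.commute)
  then have pf: "1 - p True = p False" "0 \<le> p True" "p True \<le> 1" using p(1)[of True] p(1)[of False] by auto
  have "(\<integral>\<^sup>+b. f b \<partial>measure_pmf (bernoulli_pmf (p True))) = (\<Sum>b\<in>set_pmf (bernoulli_pmf (p True)). f b * ennreal (pmf (bernoulli_pmf (p True)) b))"
    by (rule nn_integral_measure_pmf_finite) (auto intro: finite_subset[of _ UNIV])
  also have "\<dots> = (\<Sum>b\<in>UNIV. f b * ennreal (pmf (bernoulli_pmf (p True)) b))"
    by (intro sum.mono_neutral_left) (auto simp: set_pmf_iff)
  also have "\<dots> = (\<Sum>b\<in>UNIV. ennreal (p b) * f b)"
    using pf by (simp add: UNIV_bool mult.commute)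
  finally show ?thesis .
qed

lemma more_capable_imp_convex:
  assumes mc: "more_capable T ay ly az lz Qy Qz"
  shows "convex_on {0..1} (\<lambda>x. phi ay ly x - phi az lz x)"
proof (rule ccontr)
  assume ncv: "\<not> convex_on {0..1} (\<lambda>x. phi ay ly x - phi az lz x)"
  obtain p :: "bool \<Rightarrow> real" and x \<C> B where p: "\<And>b. 0 < p b" "sum p UNIV = 1" and x: "\<And>b. x b \<in> input_paths T" "x True 0 \<noteq> x False 0"
    and B: "\<And>\<D>. \<D> \<in> fin_parts Qy \<Longrightarrow> y.two_point_info p x \<D> \<le> B" and C: "\<C> \<in> fin_parts Qz" "B < z.two_point_info p x \<C>"
    by (rule nonconvex_two_point_info[OF ncv]) (rule that; assumption)
  let ?b = "measure_pmf (bernoulli_pmf (p True))"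
  define \<rho> where "\<rho> = distr ?b (input_space T) x"
  have xm: "x \<in> ?b \<rightarrow>\<^sub>M input_space T" using x(1) by simp
  have \<rho>: "\<rho> \<in> space (prob_algebra (input_space T))"
    unfolding \<rho>_def space_prob_algebra using prob_space.prob_space_distr[OF prob_space_measure_pmf xm] by simp
  \<comment> \<open>The two paths differ at time 0, so a measurable condition on that one evaluation
    separates them.\<close>
  define A where "A = (\<lambda>w. w 0) -` {x True 0} \<inter> space (input_space T)"
  have "(\<lambda>w. w 0) \<in> borel_measurable (input_space T)" using y.T by (intro input_eval_measurable) auto
  then have A: "A \<in> sets (input_space T)" unfolding A_def by (rule measurable_sets) simp
  have "(SUP (\<A>, \<C>) \<in> fin_parts (input_space T) \<times> fin_parts Qy. ereal (y.pinfo \<A> (\<lambda>a. density \<rho> (indicator a)) \<C>)) <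
    (SUP (\<A>, \<C>) \<in> fin_parts (input_space T) \<times> fin_parts Qz. ereal (z.pinfo \<A> (\<lambda>a. density \<rho> (indicator a)) \<C>))"
  proof (rule SUP_pinfo_less[where p=p and x=x and s=x, OF p(1) x(1) _ _ A _ _ _ B C])
    show "input_measure T (density \<rho> (indicator a))" if "a \<in> sets (input_space T)" for a
      by (rule input_measure_density[OF \<rho> that])
    fix a and h :: "(real \<Rightarrow> real) \<Rightarrow> ennreal" assume a: "a \<in> sets (input_space T)" and h: "h \<in> borel_measurable (input_space T)"
    have "(\<integral>\<^sup>+w. h w \<partial>density \<rho> (indicator a)) = (\<integral>\<^sup>+w. indicator a w * h w \<partial>\<rho>)"
      using a h unfolding \<rho>_def by (intro nn_integral_density) auto
    also have "\<dots> = (\<integral>\<^sup>+b. indicator a (x b) * h (x b) \<partial>?b)"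
      unfolding \<rho>_def using a h by (intro nn_integral_distr xm) auto
    also have "\<dots> = (\<Sum>b\<in>UNIV. ennreal (p b) * (indicator a (x b) * h (x b)))" by (rule nn_integral_two_point[OF p])
    also have "\<dots> = (\<Sum>b\<in>UNIV. ennreal (p b) * (if x b \<in> a then h (x b) else 0))" by (intro sum.cong) (auto simp: indicator_def)
    finally show "(\<integral>\<^sup>+w. h w \<partial>density \<rho> (indicator a)) = (\<Sum>b\<in>UNIV. ennreal (p b) * (if x b \<in> a then h (x b) else 0))" .
  qed (use x in \<open>auto simp: A_def\<close>)
  moreover have "(SUP (\<A>, \<C>) \<in> fin_parts (input_space T) \<times> fin_parts Qz. ereal (z.pinfo \<A> (\<lambda>a. density \<rho> (indicator a)) \<C>)) \<le>
      (SUP (\<A>, \<C>) \<in> fin_parts (input_space T) \<times> fin_parts Qy. ereal (y.pinfo \<A> (\<lambda>a. density \<rho> (indicator a)) \<C>))"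
    using mc \<rho> unfolding more_capable_def Let_def mutual_info_chan[OF \<rho>, symmetric] by blast
  ultimately show False by simp
qed

text \<open>Two messages suffice: each selects one of the two inputs, so that the message carries
  the binary label. On the discrete \<sigma>-field of the message law every kernel is
  measurable.\<close>

lemma less_noisy_imp_convex:
  assumes ln: "less_noisy TYPE('m) T ay ly az lz Qy Qz" and two: "\<exists>m m' :: 'm. m \<noteq> m'"
  shows "convex_on {0..1} (\<lambda>x. phi ay ly x - phi az lz x)"
proof (rule ccontr)
  assume ncv: "\<not> convex_on {0..1} (\<lambda>x. phi ay ly x - phi az lz x)"
  obtain p :: "bool \<Rightarrow> real" and x \<C> B where p: "\<And>b. 0 < p b" "sum p UNIV = 1" and x: "\<And>b. x b \<in> input_paths T" "x True 0 \<noteq> x False 0"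
    and B: "\<And>\<D>. \<D> \<in> fin_parts Qy \<Longrightarrow> y.two_point_info p x \<D> \<le> B" and C: "\<C> \<in> fin_parts Qz" "B < z.two_point_info p x \<C>"
    by (rule nonconvex_two_point_info[OF ncv]) (rule that; assumption)
  obtain m0 m1 :: 'm where mm: "m0 \<noteq> m1" using two by blast
  define s where "s = (\<lambda>b. if b then m0 else m1)"
  have s: "s True \<noteq> s False" using mm by (simp add: s_def)
  define \<nu> where "\<nu> = measure_pmf (map_pmf s (bernoulli_pmf (p True)))"
  define \<mu> where "\<mu> = (\<lambda>m. return (input_space T) (x (m = s True)))"
  have \<nu>: "prob_space \<nu>" unfolding \<nu>_def by (rule prob_space_measure_pmf)
  have \<mu>: "\<mu> \<in> \<nu> \<rightarrow>\<^sub>M prob_algebra (input_space T)"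
    unfolding \<nu>_def \<mu>_def using x(1) by (simp add: space_prob_algebra prob_space_return)
  have "(SUP (\<A>, \<C>) \<in> fin_parts \<nu> \<times> fin_parts Qy. ereal (y.pinfo \<A> (message_input \<nu> \<mu>) \<C>)) <
    (SUP (\<A>, \<C>) \<in> fin_parts \<nu> \<times> fin_parts Qz. ereal (z.pinfo \<A> (message_input \<nu> \<mu>) \<C>))"
  proof (rule SUP_pinfo_less[where p=p and x=x and s=s and A="{s True}", OF p(1) x(1) _ _ _ _ _ _ B C])
    show "input_measure T (message_input \<nu> \<mu> a)" if "a \<in> sets \<nu>" for a by (rule input_measure_message_input[OF \<nu> \<mu> that])
    fix a and h :: "(real \<Rightarrow> real) \<Rightarrow> ennreal" assume a: "a \<in> sets \<nu>" and h: "h \<in> borel_measurable (input_space T)"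
    have "(\<integral>\<^sup>+w. h w \<partial>message_input \<nu> \<mu> a) = (\<integral>\<^sup>+m. indicator a m * (\<integral>\<^sup>+x. h x \<partial>\<mu> m) \<partial>\<nu>)"
      by (rule nn_integral_message_input[OF \<nu> \<mu> a h])
    also have "\<dots> = (\<integral>\<^sup>+m. indicator a m * h (x (m = s True)) \<partial>\<nu>)"
      unfolding \<mu>_def using x(1) h by (intro nn_integral_cong) (simp add: nn_integral_return)
    also have "\<dots> = (\<integral>\<^sup>+b. indicator a (s b) * h (x (s b = s True)) \<partial>measure_pmf (bernoulli_pmf (p True)))"
      unfolding \<nu>_def by (simp add: nn_integral_map_pmf)
    also have "\<dots> = (\<Sum>b\<in>UNIV. ennreal (p b) * (indicator a (s b) * h (x (s b = s True))))" by (rule nn_integral_two_point[OF p])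
    also have "\<dots> = (\<Sum>b\<in>UNIV. ennreal (p b) * (if s b \<in> a then h (x b) else 0))"
    proof (intro sum.cong refl)
      fix b
      have "(s b = s True) = b" using s by (cases b) auto
      then show "ennreal (p b) * (indicator a (s b) * h (x (s b = s True))) = ennreal (p b) * (if s b \<in> a then h (x b) else 0)"
        by (simp add: indicator_def)
    qed
    finally show "(\<integral>\<^sup>+w. h w \<partial>message_input \<nu> \<mu> a) = (\<Sum>b\<in>UNIV. ennreal (p b) * (if s b \<in> a then h (x b) else 0))" .
  qed (use s in \<open>auto simp: \<nu>_def\<close>)
  moreover have "(SUP (\<A>, \<C>) \<in> fin_parts \<nu> \<times> fin_parts Qz. ereal (z.pinfo \<A> (message_input \<nu> \<mu>) \<C>)) \<le>
      (SUP (\<A>, \<C>) \<in> fin_parts \<nu> \<times> fin_parts Qy. ereal (y.pinfo \<A> (message_input \<nu> \<mu>) \<C>))"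
    using ln \<nu> \<mu> unfolding less_noisy_def Let_def mutual_info_joint[OF \<nu> \<mu>, symmetric] by blast
  ultimately show False by simp
qed

end

theorem theorem3:
  fixes T ay az ly lz :: real
    and Qy Qz :: "(real \<Rightarrow> real) measure"
  assumes "0 < T"
    and "0 \<le> ay" and "0 \<le> az" and "0 \<le> ly" and "0 \<le> lz"
    and "unit_poisson_law T Qy" and "unit_poisson_law T Qz"
  defines "cond_I \<equiv> convex_on {0..1} (\<lambda>x. phi ay ly x - phi az lz x)"
    and "cond_II \<equiv> less_noisy TYPE('m + (real \<Rightarrow> real)) T ay ly az lz Qy Qz"
    and "cond_III \<equiv> more_capable T ay ly az lz Qy Qz"
    and "cond_IV \<equiv>
      (ay \<ge> az \<and> ay\<^sup>2 * lz \<ge> az\<^sup>2 * ly) \<or>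
      (0 < ay \<and> ay < az \<and> ay\<^sup>2 * (az + lz) \<ge> az\<^sup>2 * (ay + ly))"
  shows "(cond_I \<longleftrightarrow> cond_II) \<and> (cond_II \<longleftrightarrow> cond_III) \<and> (cond_III \<longleftrightarrow> cond_IV)"
proof -
  interpret two_receivers T Qy Qz ay ly az lz
    by unfold_locales (use assms(1-7) in auto)
  \<comment> \<open>The summand of real functions guarantees two distinct messages whatever the type
    \<open>'m\<close> is.\<close>
  have "\<exists>m m' :: 'm + (real \<Rightarrow> real). m \<noteq> m'"
    by (intro exI[of _ "Inr (\<lambda>_. 0)"] exI[of _ "Inr (\<lambda>_. 1)"]) (auto dest: fun_cong)
  then have "cond_I \<longleftrightarrow> cond_II"
    unfolding cond_I_def cond_II_def using convex_imp_less_noisy less_noisy_imp_convex by blast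
  moreover have "cond_I \<longleftrightarrow> cond_III"
    unfolding cond_I_def cond_III_def using convex_imp_more_capable more_capable_imp_convex by blast
  moreover have "cond_I \<longleftrightarrow> cond_IV"
    unfolding cond_I_def cond_IV_def by (rule phi_diff_convex_iff) (use assms in auto)
  ultimately show ?thesis by blast
qed

end
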